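(* Let $n\ge 1$ and let $\mathbb{M}^n$ be spherical space $\mathbb{S}^n$, Euclidean space $\mathbb{R}^n$, or hyperbolic space $\mathbb{H}^n$. Let $N\in\mathbb{N}$ and let $f_1,\ldots,f_N\colon\mathbb{M}^n\to\mathbb{R}^+$ be bounded and integrable, with $\|f_i\|_\infty>0$ for all $i$, and, if $\mathbb{M}^n=\mathbb{S}^n$, with proper support. For nonnegative bounded integrable functions $g_1,\ldots,g_N$ on $\mathbb{M}^n$ set $$I(g_1,\ldots,g_N)=\int_{\mathbb{M}^n}\cdots\int_{\mathbb{M}^n}U_1(\mathrm{conv}\{x_1,\ldots,x_N\})\prod_{i=1}^N g_i(x_i)\,dx_1\cdots dx_N\in[0,\infty].$$ Then $$I(f_1,\ldots,f_N)\ \ge\ I\big(\|f_1\|_\infty\mathbf{1}_{B_1},\ldots,\|f_N\|_\infty\mathbf{1}_{B_N}\big),$$ where $B_1,\ldots,B_N$ are geodesic balls in $\mathbb{M}^n$ centered at a common point and satisfying $\lambda_n(B_i)=\|f_i\|_{L^1(\mathbb{M}^n)}/\|f_i\|_\infty$ for each $i$.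
   Context: Models. Coordinates of $\mathbb{R}^{n+1}$ are $x_0,\ldots,x_n$; $e=(1,0,\ldots,0)$; $x\cdot y=\sum_{i=0}^n x_iy_i$; $\langle x,y\rangle=x_0y_0-x_1y_1-\cdots-x_ny_n$. Set $\mathbb{S}^n=\{x\in\mathbb{R}^{n+1}: x\cdot x=1\}$; Euclidean space is the affine hyperplane $\{x\in\mathbb{R}^{n+1}: x\cdot e=1\}$, denoted $\mathbb{R}^n$; $\mathbb{H}^n=\{x\in\mathbb{R}^{n+1}: x\cdot e>0,\ \langle x,x\rangle=1\}$. The geodesic distance is $\arccos(x\cdot y)$, $\|x-y\|$, $\mathrm{arcosh}\langle x,y\rangle$, respectively; geodesic balls are balls for this distance. Measures. $\lambda_n$ is the isometry-invariant (Riemannian) volume measure on $\mathbb{M}^n$, and $dx$ means $d\lambda_n(x)$. $\mathcal{M}^n_{n-1}$ is the set of $(n-1)$-dimensional totally geodesic submanifolds of $\mathbb{M}^n$, i.e. the nonempty intersections $E\cap\mathbb{M}^n$ with $E$ an $n$-dimensional linear subspace of $\mathbb{R}^{n+1}$ (great subspheres, affine hyperplanes, hyperbolic hyperplanes). $\mu^n_{n-1}$ is the isometry-invariant measure on $\mathcal{M}^n_{n-1}$, normalized so that $\mu^n_{n-1}(\mathcal{M}^n_{n-1})=1$ if $\mathbb{M}^n=\mathbb{S}^n$, and so that the set of $M\in\mathcal{M}^n_{n-1}$ meeting the geodesic ball of radius $1$ around $e$ has measure $1$ if $\mathbb{M}^n=\mathbb{R}^n$ or $\mathbb{H}^n$.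 $dM$ means $d\mu^n_{n-1}(M)$. Convexity. $K\subseteq\mathbb{M}^n$ is convex if for all $x,y\in K$ (with $x\neq -y$ if $\mathbb{M}^n=\mathbb{S}^n$) the shortest geodesic segment $[x,y]$ lies in $K$. $\mathrm{conv}\,K$ is the intersection of all convex sets containing $K$. A closed subset of $\mathbb{S}^n$ is proper if it is contained in an open hemisphere; a function $f$ on $\mathbb{S}^n$ has proper support if the closure of $\{f\ne0\}$ is proper. The functional $U_1$. For $A\subseteq\mathbb{M}^n$ let $\chi(A)=1$ if $A\neq\emptyset$ and $\chi(\emptyset)=0$. For compact $K\subseteq\mathbb{M}^n$, $U_1(K)=\int_{\mathcal{M}^n_{n-1}}\chi(K\cap M)\,dM$. $\mathbb{R}^+=[0,\infty)$, $\|\cdot\|_\infty$ is the $L^\infty$ norm, $\mathbf{1}_B$ the indicator function of $B$. *)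

theory Defs
  imports "HOL-Probability.Essential_Supremum" "HOL-Analysis.Analysis"
begin

text \<open>
  The dimension is \<open>n = CARD('n)\<close>, and a point of \<open>\<real>\<^bsup>n+1\<^esup>\<close> is a pair \<open>(x\<^sub>0, (x\<^sub>1, \<dots>, x\<^sub>n))\<close>
  of type \<open>real \<times> real ^ 'n\<close>; the inner product of this type is \<open>x\<^sub>0 y\<^sub>0 + \<dots> + x\<^sub>n y\<^sub>n\<close>.
\<close>

type_synonym 'n point = "real \<times> (real ^ 'n)"

datatype geometry = Spherical | Euclidean | Hyperbolic

definition base_point :: "'n::finite point" where
  "base_point = (1, 0)"

definition lorentz :: "'n::finite point \<Rightarrow> 'n point \<Rightarrow> real" where
  "lorentz x y = fst x * fst y - snd x \<bullet> snd y"

fun model_space :: "geometry \<Rightarrow> ('n::finite point) set" where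
  "model_space Spherical = {x. x \<bullet> x = 1}"
| "model_space Euclidean = {x. x \<bullet> base_point = 1}"
| "model_space Hyperbolic = {x. x \<bullet> base_point > 0 \<and> lorentz x x = 1}"

fun gdist :: "geometry \<Rightarrow> 'n::finite point \<Rightarrow> 'n point \<Rightarrow> real" where
  "gdist Spherical x y = arccos (x \<bullet> y)"
| "gdist Euclidean x y = norm (x - y)"
| "gdist Hyperbolic x y = arcosh (lorentz x y)"

definition geodesic_ball :: "geometry \<Rightarrow> 'n::finite point \<Rightarrow> real \<Rightarrow> 'n point set" where
  "geodesic_ball G c r = {x \<in> model_space G. gdist G c x \<le> r}"


section \<open>The volume measure\<close>

text \<open>
  The Riemannian volume is computed in the graph charts \<open>u \<mapsto> (s * height G u, u)\<close>, where the
  sign \<open>s\<close> selects the sheet. On the sphere the two charts cover everything except the equator,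
  which is a null set; in the other two cases the single chart is global. With \<open>h = height G u\<close>,
  the Gram matrix of the metric (induced by the inner product, respectively by
  \<open>- lorentz\<close>) in this chart is \<open>I + u u\<^sup>T / h\<^sup>2\<close>, \<open>I\<close> and \<open>I - u u\<^sup>T / h\<^sup>2\<close>, respectively, and its
  determinant is \<open>1 / h\<^sup>2\<close> in all three cases. Hence the volume element is \<open>du / h\<close>.
\<close>

fun chart_signs :: "geometry \<Rightarrow> real set" where
  "chart_signs Spherical = {1, -1}"
| "chart_signs Euclidean = {1}"
| "chart_signs Hyperbolic = {1}"

fun chart_domain :: "geometry \<Rightarrow> (real ^ 'n::finite) set" where
  "chart_domain Spherical = ball 0 1"
| "chart_domain Euclidean = UNIV"
| "chart_domain Hyperbolic = UNIV"

fun height :: "geometry \<Rightarrow> real ^ 'n::finite \<Rightarrow> real" where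
  "height Spherical u = sqrt (1 - u \<bullet> u)"
| "height Euclidean u = 1"
| "height Hyperbolic u = sqrt (1 + u \<bullet> u)"

definition volume :: "geometry \<Rightarrow> ('n::finite point) measure" where
  "volume G = measure_of (model_space G) (sets (restrict_space borel (model_space G)))
     (\<lambda>A. \<Sum>s\<in>chart_signs G. \<integral>\<^sup>+u\<in>chart_domain G.
            ennreal (1 / height G u) * indicator A (s * height G u, u) \<partial>lborel)"

lemma space_volume [simp]: "space (volume G) = model_space G"
  using sets.sets_into_space[of _ "restrict_space borel (model_space G)"]
  by (auto simp: volume_def space_measure_of_conv)

lemma sets_model_space [measurable]: "model_space G \<in> sets (borel :: ('n::finite point) measure)"
proof (cases G)
  case Spherical
  have "closed {x::'n point. x \<bullet> x = 1}"
    by (intro closed_Collect_eq continuous_intros)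
  then show ?thesis using Spherical by simp
next
  case Euclidean
  have "closed {x::'n point. x \<bullet> base_point = 1}"
    by (intro closed_Collect_eq continuous_intros)
  then show ?thesis using Euclidean by simp
next
  case Hyperbolic
  have "open {x::'n point. x \<bullet> base_point > 0}" "closed {x::'n point. lorentz x x = 1}"
    unfolding lorentz_def by (intro open_Collect_less closed_Collect_eq continuous_intros)+
  then have "{x::'n point. x \<bullet> base_point > 0} \<inter> {x. lorentz x x = 1} \<in> sets borel"
    by (intro sets.Int borel_open borel_closed)
  then show ?thesis using Hyperbolic by (simp add: Int_def)
qed

lemma sets_volume [measurable_cong]: "sets (volume G) = sets (restrict_space borel (model_space G))"
  using sets.sets_measure_of_eq[of "restrict_space borel (model_space G)"]
  by (simp add: volume_def space_restrict_space)

lemma height_measurable [measurable]: "height G \<in> borel_measurable borel"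
  by (cases G) (simp_all add: fun_eq_iff[symmetric] cong: measurable_cong)

lemma emeasure_volume:
  fixes A :: "'n::finite point set"
  assumes "A \<in> sets (volume G)"
  shows "emeasure (volume G) A = (\<Sum>s\<in>chart_signs G. \<integral>\<^sup>+u\<in>chart_domain G.
            ennreal (1 / height G u) * indicator A (s * height G u, u) \<partial>lborel)"
proof -
  define \<mu> where "\<mu> A = (\<Sum>s\<in>chart_signs G. \<integral>\<^sup>+u\<in>chart_domain G.
            ennreal (1 / height G u) * indicator A (s * height G u, u) \<partial>lborel)" for A :: "'n point set"
  have "countably_additive (sets (volume G)) \<mu>"
  proof (rule countably_additiveI)
    fix A :: "nat \<Rightarrow> 'n point set"
    assume A: "range A \<subseteq> sets (volume G)" "disjoint_family A"
    have [measurable]: "A i \<in> sets borel" for i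
    proof -
      have "A i \<in> sets (volume G)"
        using A(1) by blast
      then show ?thesis
        using sets_model_space[of G] by (simp add: sets_volume sets_restrict_space_iff)
    qed
    have [measurable]: "chart_domain G \<in> sets (borel :: (real ^ 'n) measure)"
      by (cases G) auto
    have [simp]: "(\<Sum>i. (indicator (A i) x :: ennreal)) = indicator (\<Union>i. A i) x" for x
      using suminf_indicator[OF A(2)] by (simp add: fun_eq_iff)
    show "(\<Sum>i. \<mu> (A i)) = \<mu> (\<Union>i. A i)"
      unfolding \<mu>_def by (simp add: suminf_sum nn_integral_suminf[symmetric])
  qed
  moreover have "positive (sets (volume G)) \<mu>"
    by (simp add: positive_def \<mu>_def)
  moreover have "sets (restrict_space borel (model_space G)) \<subseteq> Pow (model_space G)"
    using sets.sets_into_space[of _ "restrict_space borel (model_space G)"] by auto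
  moreover have "volume G = measure_of (model_space G) (sets (restrict_space borel (model_space G))) \<mu>"
    by (simp add: volume_def \<mu>_def[abs_def])
  ultimately have "emeasure (volume G) A = \<mu> A"
    using assms by (intro emeasure_measure_of[of "volume G" "model_space G"])
  then show ?thesis
    by (simp only: \<mu>_def)
qed


section \<open>The measure on totally geodesic hypersurfaces\<close>

definition hypersurfaces :: "geometry \<Rightarrow> ('n::finite point) set set" where
  "hypersurfaces G =
     {E \<inter> model_space G | E. subspace E \<and> dim E = CARD('n) \<and> E \<inter> model_space G \<noteq> {}}"

text \<open>The usual hit-or-miss (Fell) sigma-algebra.\<close>

definition hypersurface_algebra :: "geometry \<Rightarrow> ('n::finite point) set measure" where
  "hypersurface_algebra G = sigma (hypersurfaces G)
     {{M \<in> hypersurfaces G. M \<inter> K \<noteq> {}} | K. compact K \<and> K \<subseteq> model_space G}"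

definition section_by_normal :: "geometry \<Rightarrow> 'n::finite point \<Rightarrow> 'n point set" where
  "section_by_normal G v = {x \<in> model_space G. v \<bullet> x = 0}"

text \<open>
  The hypersurfaces are the sets \<open>section_by_normal G v\<close> with \<open>normal_form G v > 0\<close>, where \<open>v\<close> is
  unique up to a scalar. An isometry of the model is the restriction of a linear map
  \<open>T\<close> of \<open>\<real>\<^bsup>n+1\<^esup>\<close> with determinant \<open>1\<close> or \<open>-1\<close>; it acts on normals by the inverse transpose
  of \<open>T\<close>, which preserves both \<open>normal_form G\<close> and Lebesgue measure. So the image of Lebesgue
  measure on \<open>{v. 0 < normal_form G v \<le> 1}\<close> is an isometry-invariant measure on hypersurfaces,
  and it only remains to normalise it.
\<close>

fun normal_form :: "geometry \<Rightarrow> 'n::finite point \<Rightarrow> real" where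
  "normal_form Spherical v = v \<bullet> v"
| "normal_form Euclidean v = snd v \<bullet> snd v"
| "normal_form Hyperbolic v = - lorentz v v"

definition unnormalised_hypersurface_measure :: "geometry \<Rightarrow> ('n::finite point) set measure" where
  "unnormalised_hypersurface_measure G =
     distr (restrict_space lborel {v. 0 < normal_form G v \<and> normal_form G v \<le> 1})
       (hypersurface_algebra G) (section_by_normal G)"

fun normalising_set :: "geometry \<Rightarrow> ('n::finite point) set set" where
  "normalising_set Spherical = hypersurfaces Spherical"
| "normalising_set Euclidean =
     {M \<in> hypersurfaces Euclidean. M \<inter> geodesic_ball Euclidean base_point 1 \<noteq> {}}"
| "normalising_set Hyperbolic =
     {M \<in> hypersurfaces Hyperbolic. M \<inter> geodesic_ball Hyperbolic base_point 1 \<noteq> {}}"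

definition hypersurface_measure :: "geometry \<Rightarrow> ('n::finite point) set measure" where
  "hypersurface_measure G =
     (let \<nu> = unnormalised_hypersurface_measure G
      in scale_measure (inverse (emeasure \<nu> (normalising_set G))) \<nu>)"

text \<open>The normalising constant is neither \<open>0\<close> nor infinite, so that the normalisation is effective.\<close>

lemma space_hypersurface_algebra [simp]: "space (hypersurface_algebra G) = hypersurfaces G"
  by (auto simp: hypersurface_algebra_def intro!: space_measure_of)

lemma section_by_normal_in_hypersurfaces:
  fixes v :: "'n::finite point"
  assumes "normal_form G v > 0"
  shows "section_by_normal G v \<in> hypersurfaces G"
proof -
  have nz: "v \<noteq> 0"
    using assms by (cases G) (auto simp: lorentz_def)
  have "section_by_normal G v \<noteq> {}"
  proof (cases G)
    case Spherical
    have "dim {x. v \<bullet> x = 0} = DIM('n point) - 1"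
      using nz by (rule dim_hyperplane)
    then have "dim {x. v \<bullet> x = 0} \<noteq> 0"
      by simp
    then obtain x where "v \<bullet> x = 0" "x \<noteq> 0"
      by (metis (mono_tags, lifting) dim_eq_0 mem_Collect_eq singletonI subsetI)
    then have "x /\<^sub>R norm x \<in> section_by_normal Spherical v"
      by (simp add: section_by_normal_def dot_square_norm)
    then show ?thesis using Spherical by blast
  next
    case Euclidean
    have "(1, - (fst v / (snd v \<bullet> snd v)) *\<^sub>R snd v) \<in> section_by_normal Euclidean v"
      using assms Euclidean by (simp add: section_by_normal_def base_point_def inner_prod_def)
    then show ?thesis using Euclidean by blast
  next
    case Hyperbolic
    define q where "q = snd v \<bullet> snd v"
    define a where "a = sqrt (q / (q - (fst v)\<^sup>2))"
    have q: "q - (fst v)\<^sup>2 > 0"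
      using assms Hyperbolic by (simp add: lorentz_def q_def power2_eq_square)
    then have q0: "q > 0"
      by (smt (verit) zero_le_power2)
    have a: "a > 0" "a * a = q / (q - (fst v)\<^sup>2)"
      using q q0 by (auto simp: a_def)
    have "a * a - (a * fst v / q) * (a * fst v / q) * q = a * a * ((q - (fst v)\<^sup>2) / q)"
      using q0 by (simp add: field_simps power2_eq_square)
    also have "\<dots> = 1"
      using q q0 unfolding a(2) by simp
    finally have "(a, - (a * fst v / q) *\<^sub>R snd v) \<in> section_by_normal Hyperbolic v"
      using a q0 by (simp add: section_by_normal_def base_point_def inner_prod_def lorentz_def
          flip: q_def)
    then show ?thesis using Hyperbolic by blast
  qed
  moreover have "dim {x. v \<bullet> x = 0} = CARD('n)"
    using dim_hyperplane[OF nz] by simp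
  ultimately show ?thesis
    unfolding hypersurfaces_def section_by_normal_def
    by (intro CollectI exI[of _ "{x. v \<bullet> x = 0}"]) (auto simp: subspace_hyperplane)
qed

lemma closed_normals_hitting:
  assumes "compact (K :: 'n::finite point set)"
  shows "closed {v. \<exists>x\<in>K. v \<bullet> x = 0}"
proof -
  have "closed ({z :: 'n point \<times> 'n point. fst z \<bullet> snd z = 0} \<inter> UNIV \<times> K)"
    using assms
    by (intro closed_Int closed_Collect_eq continuous_intros closed_Times closed_UNIV compact_imp_closed)
  then have "closedin (top_of_set (UNIV \<times> K)) ({z. fst z \<bullet> snd z = 0} \<inter> UNIV \<times> K)"
    by (rule closed_subset[rotated]) auto
  then have "closedin (top_of_set UNIV) (fst ` ({z. fst z \<bullet> snd z = 0} \<inter> UNIV \<times> K))"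
    by (rule Starlike.closed_map_fst[OF assms])
  also have "fst ` ({z. fst z \<bullet> snd z = 0} \<inter> UNIV \<times> K) = {v. \<exists>x\<in>K. v \<bullet> x = 0}"
    by force
  finally show ?thesis by simp
qed

lemma normal_form_measurable [measurable]: "normal_form G \<in> borel_measurable borel"
  by (cases G)
    (auto simp: lorentz_def intro!: borel_measurable_continuous_onI continuous_intros)

lemma section_by_normal_measurable [measurable]:
  "section_by_normal G \<in>
     restrict_space lborel {v. 0 < normal_form G v \<and> normal_form G v \<le> 1} \<rightarrow>\<^sub>M hypersurface_algebra G"
  unfolding hypersurface_algebra_def
proof (rule measurable_measure_of)
  let ?V = "{v. 0 < normal_form G v \<and> normal_form G v \<le> 1}"
  show "section_by_normal G \<in> space (restrict_space lborel ?V) \<rightarrow> hypersurfaces G"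
    by (auto simp: space_restrict_space section_by_normal_in_hypersurfaces)
  fix A assume "A \<in> {{M \<in> hypersurfaces G. M \<inter> K \<noteq> {}} | K. compact K \<and> K \<subseteq> model_space G}"
  then obtain K where K: "compact K" "K \<subseteq> model_space G"
    and A: "A = {M \<in> hypersurfaces G. M \<inter> K \<noteq> {}}" by blast
  have "section_by_normal G -` A \<inter> ?V = {v. \<exists>x\<in>K. v \<bullet> x = 0} \<inter> ?V"
    using K(2) by (auto simp: A section_by_normal_in_hypersurfaces) (auto simp: section_by_normal_def)
  then show "section_by_normal G -` A \<inter> space (restrict_space lborel ?V) \<in> sets (restrict_space lborel ?V)"
    using closed_normals_hitting[OF K(1)]
    by (auto simp: space_restrict_space sets_restrict_space_iff intro!: sets.Int)
qed auto


lemma base_in_model [simp]: "base_point \<in> model_space G"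
  by (cases G) (auto simp: base_point_def lorentz_def)

lemma arcosh_le_1_iff: "1 \<le> x \<Longrightarrow> arcosh x \<le> 1 \<longleftrightarrow> x \<le> cosh (1::real)"
  using arcosh_less_iff_real[of "cosh 1" x] cosh_real_ge_1[of 1]
  by (simp add: arcosh_cosh_real not_less[symmetric])

lemma compact_unit_geodesic_ball:
  assumes "G \<noteq> Spherical"
  shows "compact (geodesic_ball G (base_point :: 'n::finite point) 1)"
proof (cases G)
  case Euclidean
  have "geodesic_ball G (base_point :: 'n point) 1 = {x. x \<bullet> base_point = 1} \<inter> cball base_point 1"
    using Euclidean by (auto simp: geodesic_ball_def dist_norm)
  moreover have "closed {x :: 'n point. x \<bullet> base_point = 1}"
    by (intro closed_Collect_eq continuous_intros)
  ultimately show ?thesis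
    by (simp add: closed_Int_compact)
next
  case Hyperbolic
  have ball: "geodesic_ball G (base_point :: 'n point) 1 =
      {x. lorentz x x = 1} \<inter> {x. 1 \<le> fst x} \<inter> {x. fst x \<le> cosh 1}" (is "_ = ?B")
  proof -
    have "x \<in> geodesic_ball G base_point 1 \<longleftrightarrow> x \<in> ?B" for x :: "'n point"
    proof (cases "lorentz x x = 1 \<and> 1 \<le> fst x")
      case True
      have "arcosh (fst x) \<le> 1 \<longleftrightarrow> fst x \<le> cosh 1"
        using True arcosh_le_1_iff[of "fst x"] by simp
      then show ?thesis
        using True Hyperbolic
        by (auto simp: geodesic_ball_def lorentz_def base_point_def inner_prod_def)
    next
      case False
      have "1 \<le> fst x" if "lorentz x x = 1" "fst x > 0"
      proof -
        have "1\<^sup>2 \<le> (fst x)\<^sup>2"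
          using that(1) by (simp add: lorentz_def power2_eq_square) (smt (verit) inner_ge_zero)
        then show ?thesis
          using that(2) power2_le_imp_le[of 1 "fst x"] by simp
      qed
      then show ?thesis
        using False Hyperbolic by (auto simp: geodesic_ball_def base_point_def inner_prod_def)
    qed
    then show ?thesis by blast
  qed
  have "closed ?B"
    unfolding lorentz_def by (intro closed_Int closed_Collect_eq closed_Collect_le continuous_intros)
  moreover have "bounded ?B"
  proof (rule boundedI)
    fix x :: "'n point" assume x: "x \<in> ?B"
    have "(norm x)\<^sup>2 \<le> (sqrt 2 * cosh 1)\<^sup>2"
    proof -
      have "fst x * fst x \<le> cosh 1 * cosh 1"
        using x by (intro mult_mono) auto
      moreover have "(norm x)\<^sup>2 = fst x * fst x + snd x \<bullet> snd x"
        by (simp add: power2_norm_eq_inner inner_prod_def)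
      ultimately show ?thesis
        using x by (simp add: lorentz_def power_mult_distrib) (simp add: power2_eq_square)
    qed
    then show "norm x \<le> sqrt 2 * cosh 1"
      by (rule power2_le_imp_le) simp
  qed
  ultimately show ?thesis
    unfolding ball by (simp add: compact_eq_bounded_closed)
qed (use assms in simp)

lemma normalising_set_measurable [measurable]:
  "(normalising_set G :: 'n::finite point set set) \<in> sets (hypersurface_algebra G)"
proof (cases "G = Spherical")
  case True
  then show ?thesis
    using sets.top[of "hypersurface_algebra G"] by simp
next
  case False
  let ?A = "{{M \<in> hypersurfaces G. M \<inter> K \<noteq> {}} | K :: 'n point set. compact K \<and> K \<subseteq> model_space G}"
  have "normalising_set G = {M :: 'n point set. M \<in> hypersurfaces G \<and> M \<inter> geodesic_ball G base_point 1 \<noteq> {}}"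
    using False by (cases G) auto
  moreover have "\<dots> \<in> ?A"
    using compact_unit_geodesic_ball[OF False] by (auto simp: geodesic_ball_def)
  ultimately have "normalising_set G \<in> ?A"
    by (rule ssubst)
  moreover have "?A \<subseteq> Pow (hypersurfaces G)"
    by auto
  ultimately show ?thesis
    unfolding hypersurface_algebra_def by (rule in_measure_of[rotated])
qed

lemma normalising_constant:
  "emeasure (unnormalised_hypersurface_measure G) (normalising_set G :: 'n::finite point set set) \<noteq> 0"
  "emeasure (unnormalised_hypersurface_measure G) (normalising_set G :: 'n::finite point set set) \<noteq> \<infinity>"
proof -
  let ?V = "{v :: 'n point. 0 < normal_form G v \<and> normal_form G v \<le> 1}"
  define P where "P = {v \<in> ?V. section_by_normal G v \<in> normalising_set G}"
  have V[measurable]: "?V \<in> sets borel" by measurable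
  have "P = section_by_normal G -` normalising_set G \<inter> space (restrict_space lborel ?V)"
    by (auto simp: P_def space_restrict_space)
  also have "\<dots> \<in> sets (restrict_space lborel ?V)"
    by (rule measurable_sets[OF section_by_normal_measurable normalising_set_measurable])
  finally have P: "P \<in> sets borel"
    using V by (auto simp: sets_restrict_space_iff)
  have eq: "emeasure (unnormalised_hypersurface_measure G) (normalising_set G :: 'n point set set) = emeasure lborel P"
  proof -
    have "emeasure (unnormalised_hypersurface_measure G) (normalising_set G :: 'n point set set) =
       emeasure (restrict_space lborel ?V)
         (section_by_normal G -` normalising_set G \<inter> space (restrict_space lborel ?V))"
      unfolding unnormalised_hypersurface_measure_def
      by (rule emeasure_distr) measurable
    also have "section_by_normal G -` normalising_set G \<inter> space (restrict_space lborel ?V) = P"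
      by (auto simp: P_def space_restrict_space)
    also have "emeasure (restrict_space lborel ?V) P = emeasure lborel P"
      using V by (intro emeasure_restrict_space) (auto simp: P_def)
    finally show ?thesis .
  qed
  have bound: "snd v \<bullet> snd v \<le> (cosh 1)\<^sup>2 \<and> fst v * fst v \<le> (cosh 1)\<^sup>2" if v: "v \<in> P" for v
  proof (cases G)
    case Spherical
    have "1 \<le> (cosh (1::real))\<^sup>2"
      using cosh_real_ge_1[of 1] by (simp add: one_le_power)
    then show ?thesis
      using v Spherical by (auto simp: P_def inner_prod_def) (smt (verit) inner_ge_zero zero_le_square)+
  next
    case Euclidean
    have c: "1 \<le> (cosh (1::real))\<^sup>2"
      using cosh_real_ge_1[of 1] by (simp add: one_le_power)
    obtain x where "x \<in> section_by_normal G v" "x \<in> geodesic_ball G base_point 1"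
      using v Euclidean by (auto simp: P_def)
    then have x: "norm (snd x) \<le> 1" "fst v + snd v \<bullet> snd x = 0"
      using Euclidean
      by (auto simp: section_by_normal_def geodesic_ball_def inner_prod_def base_point_def
          norm_prod_def abs_square_le_1)
    have "\<bar>fst v\<bar> \<le> norm (snd v) * norm (snd x)"
      using Cauchy_Schwarz_ineq2[of "snd v" "snd x"] x(2) by linarith
    also have "\<dots> \<le> norm (snd v)"
      using x(1) by (simp add: mult_left_le)
    finally have "(fst v)\<^sup>2 \<le> (norm (snd v))\<^sup>2"
      by (simp add: abs_le_square_iff[symmetric])
    then show ?thesis
      using v Euclidean c by (simp add: P_def power2_norm_eq_inner) (simp add: power2_eq_square)
  next
    case Hyperbolic
    let ?a = "(fst v)\<^sup>2" and ?q = "snd v \<bullet> snd v"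
    obtain x where "x \<in> section_by_normal G v" "x \<in> geodesic_ball G base_point 1"
      using v Hyperbolic by (auto simp: P_def)
    then have x: "x \<in> model_space G" "arcosh (fst x) \<le> 1" "fst v * fst x + snd v \<bullet> snd x = 0"
      using Hyperbolic
      by (auto simp: section_by_normal_def geodesic_ball_def inner_prod_def base_point_def lorentz_def)
    define X where "X = (fst x)\<^sup>2"
    have pos: "fst x > 0" and l: "X = 1 + snd x \<bullet> snd x"
      using x(1) Hyperbolic by (auto simp: base_point_def lorentz_def X_def power2_eq_square inner_prod_def)
    then have "1\<^sup>2 \<le> (fst x)\<^sup>2"
      by (simp add: X_def)
    then have x1: "1 \<le> fst x"
      using pos power2_le_imp_le[of 1 "fst x"] by simp
    then have "fst x \<le> cosh 1"
      using arcosh_le_1_iff[of "fst x"] x(2) by simp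
    then have X: "X \<le> (cosh 1)\<^sup>2" "1 \<le> X"
      using pos x1 by (auto simp: X_def power_mono one_le_power)
    have "(fst v * fst x)\<^sup>2 = (snd v \<bullet> snd x)\<^sup>2"
      using x(3) by (metis add_eq_0_iff2 power2_minus)
    also have "\<dots> \<le> ?q * (snd x \<bullet> snd x)"
      by (rule Cauchy_Schwarz_ineq)
    finally have "?a * X \<le> ?q * (X - 1)"
      using l by (simp add: power_mult_distrib X_def)
    moreover have "?q \<le> 1 + ?a"
      using v Hyperbolic by (simp add: P_def lorentz_def power2_eq_square)
    then have "?q * (X - 1) \<le> (1 + ?a) * (X - 1)"
      using X(2) by (intro mult_right_mono) auto
    ultimately have "?a \<le> X - 1"
      by (simp add: algebra_simps)
    then show ?thesis
      using \<open>?q \<le> 1 + ?a\<close> X(1) by (simp add: power2_eq_square)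
  qed
  have "bounded P"
  proof (rule boundedI)
    fix v assume "v \<in> P"
    then have "(norm v)\<^sup>2 \<le> (sqrt 2 * cosh 1)\<^sup>2"
      using bound by (fastforce simp: power2_norm_eq_inner inner_prod_def power_mult_distrib)
    then show "norm v \<le> sqrt 2 * cosh 1"
      by (rule power2_le_imp_le) simp
  qed
  then have "emeasure lborel P < \<infinity>"
    by (rule emeasure_bounded_finite)
  then show "emeasure (unnormalised_hypersurface_measure G) (normalising_set G :: 'n point set set) \<noteq> \<infinity>"
    using eq by simp
  define O' where "O' = {v :: 'n point. 4 * (fst v * fst v) < snd v \<bullet> snd v} \<inter> ball 0 1"
  have "O' \<subseteq> P"
  proof
    fix v assume v: "v \<in> O'"
    define q where "q = snd v \<bullet> snd v"
    have q: "4 * (fst v * fst v) < q" "q > 0"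
      using v zero_le_square[of "fst v"] by (auto simp: O'_def q_def simp del: zero_le_square)
    have "(norm v)\<^sup>2 < 1"
      using v by (simp add: O'_def power_less_one_iff abs_square_less_1)
    then have n: "fst v * fst v + q < 1"
      by (simp add: q_def power2_norm_eq_inner inner_prod_def)
    have "snd v \<noteq> 0"
      using q(2) by (auto simp: q_def)
    then have V: "v \<in> ?V"
      using q n zero_le_square[of "fst v"]
      by (cases G) (auto simp: lorentz_def inner_prod_def simp flip: q_def simp del: zero_le_square)
    then have h: "section_by_normal G v \<in> hypersurfaces G"
      by (simp add: section_by_normal_in_hypersurfaces)
    have "section_by_normal G v \<in> normalising_set G"
    proof (cases G)
      case Spherical
      then show ?thesis using h by simp
    next
      case Euclidean
      define x where "x = (1::real, - (fst v / q) *\<^sub>R snd v)"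
      have "(norm (- (fst v / q) *\<^sub>R snd v))\<^sup>2 = fst v * fst v / q"
        using q(2) unfolding power2_norm_eq_inner by (simp flip: q_def)
      also have "\<dots> \<le> 1\<^sup>2"
        using q zero_le_square[of "fst v"] by (simp add: divide_le_eq del: zero_le_square)
      finally have "norm (- (fst v / q) *\<^sub>R snd v) \<le> 1"
        by (rule power2_le_imp_le) simp
      then have "x \<in> section_by_normal G v \<inter> geodesic_ball G base_point 1"
        using Euclidean q(2)
        by (simp add: x_def section_by_normal_def geodesic_ball_def base_point_def inner_prod_def
            norm_prod_def abs_square_le_1 abs_mult flip: q_def)
      then show ?thesis using h Euclidean by auto
    next
      case Hyperbolic
      define d where "d = q - fst v * fst v"
      define a where "a = sqrt (q / d)"
      have d: "d > 0" "q \<le> 4 / 3 * d"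
        using q zero_le_square[of "fst v"] by (auto simp: d_def simp del: zero_le_square)
      have a: "a > 0" "a * a = q / d"
        using q d by (auto simp: a_def)
      define x where "x = (a, - (a * fst v / q) *\<^sub>R snd v)"
      have "a * a - (a * fst v / q) * (a * fst v / q) * q = a * a * (d / q)"
        using q by (simp add: field_simps d_def)
      also have "\<dots> = 1"
        using q d unfolding a(2) by simp
      finally have x: "lorentz x x = 1"
        using q by (simp add: x_def lorentz_def flip: q_def)
      have "a \<ge> 1"
        using q d by (simp add: a_def) (simp add: d_def)
      have "a\<^sup>2 \<le> (cosh 1)\<^sup>2"
      proof -
        have "a\<^sup>2 \<le> 4 / 3"
          using a(2) d by (simp add: power2_eq_square divide_le_eq)
        moreover have "5 / 4 \<le> cosh (1::real)"
        proof -
          have "(1 + 1/2)\<^sup>2 \<le> (exp (1/2::real))\<^sup>2" "(1 + (-1/2))\<^sup>2 \<le> (exp (-1/2::real))\<^sup>2"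
            using exp_ge_add_one_self[of "1/2::real"] exp_ge_add_one_self[of "-1/2::real"]
            by (intro power_mono; simp)+
          then have "9/4 \<le> exp (1::real)" "1/4 \<le> exp (-1::real)"
            by (simp_all add: power2_eq_square flip: exp_add)
          then show ?thesis
            by (simp add: cosh_def)
        qed
        then have "(5/4)\<^sup>2 \<le> (cosh (1::real))\<^sup>2"
          by (intro power_mono) auto
        ultimately show ?thesis by (simp add: power2_eq_square)
      qed
      then have "a \<le> cosh 1"
        by (rule power2_le_imp_le) simp
      then have "arcosh a \<le> 1"
        using \<open>a \<ge> 1\<close> arcosh_le_1_iff[of "a"] by simp
      then have "x \<in> section_by_normal G v \<inter> geodesic_ball G base_point 1"
        using Hyperbolic q(2) x a(1)
        by (simp add: x_def section_by_normal_def geodesic_ball_def base_point_def inner_prod_def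
            lorentz_def flip: q_def)
      then show ?thesis using h Hyperbolic by auto
    qed
    then show "v \<in> P"
      using V by (simp add: P_def)
  qed
  moreover have "open O'"
    unfolding O'_def by (intro open_Int open_ball open_Collect_less continuous_intros)
  moreover have "O' \<noteq> {}"
  proof -
    have "(0, axis undefined (1/2)) \<in> O'"
      by (simp add: O'_def norm_prod_def inner_axis_axis norm_eq_sqrt_inner)
    then show ?thesis by blast
  qed
  have "\<not> negligible O'"
    using \<open>open O'\<close> \<open>O' \<noteq> {}\<close> by (simp add: open_not_negligible)
  then have "emeasure lborel O' \<noteq> 0"
    using \<open>open O'\<close> by (auto simp: negligible_iff_null_sets null_sets_def)
  moreover have "emeasure lborel O' \<le> emeasure lborel P"
    using \<open>O' \<subseteq> P\<close> P by (intro emeasure_mono) auto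
  ultimately show "emeasure (unnormalised_hypersurface_measure G) (normalising_set G :: 'n point set set) \<noteq> 0"
    using eq by auto
qed

lemma emeasure_normalising_set:
  "emeasure (hypersurface_measure G) (normalising_set G :: 'n::finite point set set) = 1"
  using normalising_constant[where 'n='n, of G]
  by (simp add: hypersurface_measure_def Let_def mult.commute[of "inverse _"] less_top
      flip: divide_ennreal_def)


section \<open>Convexity\<close>

text \<open>
  The points of the shortest geodesic segment from \<open>x\<close> to \<open>y\<close> are the points lying between
  them in the geodesic distance; this is used on the sphere only for \<open>x \<noteq> -y\<close>.
\<close>

definition geodesic_segment :: "geometry \<Rightarrow> 'n::finite point \<Rightarrow> 'n point \<Rightarrow> 'n point set" where
  "geodesic_segment G x y = {z \<in> model_space G. gdist G x z + gdist G z y = gdist G x y}"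

definition geodesically_convex :: "geometry \<Rightarrow> ('n::finite point) set \<Rightarrow> bool" where
  "geodesically_convex G K \<longleftrightarrow> K \<subseteq> model_space G \<and>
     (\<forall>x\<in>K. \<forall>y\<in>K. (G = Spherical \<longrightarrow> x \<noteq> - y) \<longrightarrow> geodesic_segment G x y \<subseteq> K)"

definition conv :: "geometry \<Rightarrow> ('n::finite point) set \<Rightarrow> 'n point set" where
  "conv G K = geodesically_convex G hull K"

definition in_open_hemisphere :: "('n::finite point) set \<Rightarrow> bool" where
  "in_open_hemisphere A \<longleftrightarrow> (\<exists>v\<in>model_space Spherical. A \<subseteq> {x \<in> model_space Spherical. v \<bullet> x > 0})"

definition proper_support :: "('n::finite point \<Rightarrow> real) \<Rightarrow> bool" where
  "proper_support f \<longleftrightarrow> in_open_hemisphere (closure {x \<in> model_space Spherical. f x \<noteq> 0})"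


section \<open>The functionals\<close>

definition chi :: "'a set \<Rightarrow> ennreal" where
  "chi A = (if A \<noteq> {} then 1 else 0)"

definition U1 :: "geometry \<Rightarrow> ('n::finite point) set \<Rightarrow> ennreal" where
  "U1 G K = (\<integral>\<^sup>+M. chi (K \<inter> M) \<partial>hypersurface_measure G)"

definition L1_norm :: "geometry \<Rightarrow> ('n::finite point \<Rightarrow> real) \<Rightarrow> real" where
  "L1_norm G f = (\<integral>x. \<bar>f x\<bar> \<partial>volume G)"

definition Linf_norm :: "geometry \<Rightarrow> ('n::finite point \<Rightarrow> real) \<Rightarrow> real" where
  "Linf_norm G f = real_of_ereal (esssup (volume G) (\<lambda>x. ereal \<bar>f x\<bar>))"

text \<open>The iterated integral, as an integral over the \<open>N\<close>-fold product measure.\<close>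

definition I_functional :: "geometry \<Rightarrow> nat \<Rightarrow> (nat \<Rightarrow> 'n::finite point \<Rightarrow> real) \<Rightarrow> ennreal" where
  "I_functional G N g =
     (\<integral>\<^sup>+x. U1 G (conv G (x ` {1..N})) * (\<Prod>i\<in>{1..N}. ennreal (g i (x i)))
        \<partial>PiM {1..N} (\<lambda>_. volume G))"

end

theory Submission
  imports Defs "HOL-Probability.Distribution_Functions"
begin

text \<open>
For points \<open>x\<^sub>1, \<dots>, x\<^sub>N\<close> and a hypersurface with normal \<open>v\<close>, the hull of the points meets the
hypersurface exactly when the points do not all lie on one open side of it (\<open>conv_crosses_iff\<close>; on
the sphere, tuples containing antipodal points form a null set). By Fubini the functional is
therefore, up to the normalising constant, an integral over normals \<open>v\<close> of the mass of the tuples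
that \<open>v\<close> separates. For indicators of sets \<open>E\<^sub>i\<close> of mass \<open>m\<^sub>i\<close> that mass is
\<open>\<Prod>m\<^sub>i - \<Prod>P\<^sub>i(v) - \<Prod>P\<^sub>i(-v)\<close>, where \<open>P\<^sub>i(v)\<close> is the mass of \<open>E\<^sub>i\<close> in the half-space \<open>v \<bullet> x > 0\<close>.

The functional is linear in each \<open>f\<^sub>i\<close>, so the bathtub principle replaces the functions one after the
other by multiples of indicators, \<open>\<parallel>f\<^sub>i\<parallel>\<^sub>\<infinity>\<close> times the indicator of a set of the measure of the ball
\<open>B\<^sub>i\<close>, without increasing the functional (\<open>exists_indicators_below\<close>). It remains to compare sets
\<open>E\<^sub>i\<close> with concentric balls of the same measure (\<open>crossing_energy_centred_le\<close>).

This is done by polarization (two-point symmetrization). Let \<open>h\<close> be the normal of a hypersurface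
whose closed side \<open>h \<bullet> x \<ge> 0\<close> contains the centre, and let \<open>v'\<close> be the mirror image of \<open>v\<close>. On the
side \<open>h \<bullet> x \<ge> 0\<close> one of the two half-spaces of \<open>v\<close> and \<open>v'\<close> contains the other. Hence polarizing all
\<open>E\<^sub>i\<close> with respect to \<open>h\<close> keeps each sum \<open>P\<^sub>i(v) + P\<^sub>i(v')\<close> and makes the same one of the two summands
larger for all \<open>i\<close> at once, so that \<open>\<Prod>P\<^sub>i(v) + \<Prod>P\<^sub>i(v')\<close> grows. Since reflections preserve the
measure on normals, the energy decreases (\<open>crossing_energy_polarize\<close>).

Polarization also never increases the mass of \<open>E\<^sub>i\<close> outside \<open>B\<^sub>i\<close>, and it strictly decreases this mass
when the reflection maps a part of \<open>E\<^sub>i - B\<^sub>i\<close> into \<open>B\<^sub>i - E\<^sub>i\<close>. Some reflection does so by an amount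
that depends only on the measures of these two sets and on a bounded region that contains most of
them (\<open>exists_reflection_overlap\<close>): for fixed \<open>x\<close>, the mirror image of \<open>x\<close> in a random hypersurface
has a density bounded from below on bounded sets, because
\<open>h \<mapsto> normal_form h * reflect h x\<close> is a quadratic polynomial and has a bounded Jacobian. Consequently
the infimum of the total discrepancy over all iterated polarizations is zero, and Fatou's lemma
gives the inequality for the balls.

The three geometries are treated together by means of the curvature \<open>\<kappa> \<in> {1, 0, -1}\<close>: the model is a
sheet of \<open>x\<^sub>0\<^sup>2 + \<kappa> |x'|\<^sup>2 = 1\<close>, the form on normals is \<open>\<kappa> v\<^sub>0\<^sup>2 + |v'|\<^sup>2\<close>, and the volume of a set is
\<open>n + 1\<close> times the Lebesgue measure of the cone over it (\<open>emeasure_volume_solid_cone\<close>). Therefore the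
volume inherits its invariance from Lebesgue measure on the ambient space.
\<close>

section \<open>Change of variables in the ambient space\<close>

text \<open>
Determinants and Jacobians concern maps of \<open>real ^ 'm\<close> with a well-ordered index type \<open>'m\<close>. The
following type with \<open>n + 1\<close> elements plays this role for \<open>\<real>\<^bsup>n+1\<^esup>\<close>; its order comes from an arbitrary
injection into the natural numbers.
\<close>

datatype 'n coord = Zeroth | Other 'n

lemma UNIV_coord: "UNIV = insert Zeroth (range Other)"
  by (auto intro: coord.exhaust)

lemma inj_Other: "inj Other"
  by (simp add: inj_on_def)

lemma sum_coord: "(\<Sum>j\<in>UNIV. g j) = g Zeroth + (\<Sum>i\<in>UNIV. g (Other (i::'n::finite)))"
  unfolding UNIV_coord by (subst sum.insert) (auto simp: sum.reindex inj_Other)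

lemma prod_coord: "(\<Prod>j\<in>UNIV. g j) = g Zeroth * (\<Prod>i\<in>UNIV. g (Other (i::'n::finite)))"
  unfolding UNIV_coord by (subst prod.insert) (auto simp: prod.reindex inj_Other)

lemma all_coord: "(\<forall>j. P j) \<longleftrightarrow> P Zeroth \<and> (\<forall>i. P (Other i))"
  by (metis coord.exhaust)

instance coord :: (finite) finite
  by standard (simp add: UNIV_coord)

lemma CARD_coord: "CARD('n::finite coord) = Suc CARD('n)"
  by (simp add: UNIV_coord card_insert_if card_image inj_on_def image_iff)

instantiation coord :: (finite) linorder
begin

definition coord_rank :: "'a coord \<Rightarrow> nat" where
  "coord_rank = (SOME f. inj f)"

definition less_eq_coord :: "'a coord \<Rightarrow> 'a coord \<Rightarrow> bool" where
  "less_eq_coord i j \<longleftrightarrow> coord_rank i \<le> coord_rank j"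

definition less_coord :: "'a coord \<Rightarrow> 'a coord \<Rightarrow> bool" where
  "less_coord i j \<longleftrightarrow> coord_rank i < coord_rank j"

lemma inj_coord_rank: "inj (coord_rank :: 'a coord \<Rightarrow> nat)"
  using finite_imp_inj_to_nat_seg[OF finite_class.finite_UNIV[where 'a="'a coord"]]
  unfolding coord_rank_def by (metis someI_ex)

instance
  by standard (auto simp: less_eq_coord_def less_coord_def dest: injD[OF inj_coord_rank])

end

instance coord :: (finite) wellorder
proof (rule wf_wellorderI)
  have "{(x :: 'a coord, y). x < y} = inv_image less_than coord_rank"
    by (auto simp: less_coord_def inv_image_def)
  then show "wf {(x :: 'a coord, y). x < y}"
    by simp
qed standard

definition coord_join :: "real ^ 'n coord \<Rightarrow> 'n::finite point" where
  "coord_join y = (y $ Zeroth, \<chi> i. y $ Other i)"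

definition coord_split :: "'n::finite point \<Rightarrow> real ^ 'n coord" where
  "coord_split z = (\<chi> j. case j of Zeroth \<Rightarrow> fst z | Other i \<Rightarrow> snd z $ i)"

lemma coord_join_coord_split [simp]: "coord_join (coord_split z) = z"
  by (simp add: coord_join_def coord_split_def)

lemma coord_split_coord_join [simp]: "coord_split (coord_join y) = y"
  by (simp add: coord_join_def coord_split_def vec_eq_iff split: coord.split)

lemma linear_coord_join: "linear coord_join"
  by (rule linearI) (auto simp: coord_join_def vec_eq_iff)

lemma linear_coord_split: "linear coord_split"
  by (rule linearI) (auto simp: coord_split_def vec_eq_iff split: coord.split)

lemma coord_split_image_eq_vimage: "coord_split ` S = coord_join -` S"
  by (auto simp: image_iff) (metis coord_split_coord_join)

lemma inner_coord_join: "coord_join x \<bullet> coord_join y = x \<bullet> y"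
proof -
  have "x \<bullet> y = (\<Sum>j\<in>UNIV. x $ j * y $ j)"
    by (simp add: inner_vec_def)
  also have "\<dots> = x $ Zeroth * y $ Zeroth + (\<Sum>i\<in>UNIV. x $ Other i * y $ Other i)"
    by (simp add: sum_coord)
  finally show ?thesis
    by (simp add: coord_join_def inner_prod_def) (simp add: inner_vec_def)
qed

lemma norm_coord_split: "norm (coord_split z) = norm z"
  using inner_coord_join[of "coord_split z" "coord_split z"] by (simp add: norm_eq_sqrt_inner)

lemma measurable_coord_join [measurable]: "coord_join \<in> borel_measurable borel"
  using linear_coord_join by (intro borel_measurable_continuous_onI linear_continuous_on) (simp add:
      linear_conv_bounded_linear)

text \<open>
The isometry \<open>coord_join\<close> permutes coordinates, so preimages of boxes are boxes with the same side
lengths.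
\<close>

lemma distr_coord_join: "distr lborel borel coord_join = (lborel :: 'n::finite point measure)"
proof (rule lborel_eqI[symmetric])
  fix l u :: "'n point"
  assume le: "\<And>b. b \<in> Basis \<Longrightarrow> l \<bullet> b \<le> u \<bullet> b"
  have *: "coord_join -` box l u = box (coord_split l) (coord_split u)"
  proof (rule set_eqI)
    fix y :: "real ^ 'n coord"
    have "y \<in> coord_join -` box l u \<longleftrightarrow> (fst l < y $ Zeroth \<and> y $ Zeroth < fst u) \<and>
        (\<forall>i. snd l $ i < y $ Other i \<and> y $ Other i < snd u $ i)"
      by (cases l, cases u) (auto simp: coord_join_def mem_box Basis_prod_def Basis_vec_def inner_axis)
    also have "\<dots> \<longleftrightarrow> y \<in> box (coord_split l) (coord_split u)"
      by (simp add: mem_box_cart all_coord coord_split_def)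
    finally show "y \<in> coord_join -` box l u \<longleftrightarrow> y \<in> box (coord_split l) (coord_split u)" .
  qed
  have "emeasure (distr lborel borel coord_join) (box l u)
      = emeasure lborel (box (coord_split l) (coord_split u))"
    by (simp add: emeasure_distr *)
  also have "\<dots> = ennreal (\<Prod>b\<in>Basis. (coord_split u - coord_split l) \<bullet> b)"
  proof (rule emeasure_lborel_box)
    fix b :: "real ^ 'n coord" assume "b \<in> Basis"
    then obtain j where j: "b = axis j 1"
      by (auto simp: Basis_vec_def)
    have "coord_join b = (case j of Zeroth \<Rightarrow> (1, 0) | Other i \<Rightarrow> (0, axis i 1))"
      by (cases j) (auto simp: j coord_join_def axis_def vec_eq_iff)
    then have "coord_join b \<in> Basis"
      by (auto simp: Basis_prod_def axis_in_Basis_iff split: coord.split)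
    then show "coord_split l \<bullet> b \<le> coord_split u \<bullet> b"
      using le[of "coord_join b"] inner_coord_join[of "coord_split l" b] inner_coord_join[of
          "coord_split u" b] by simp
  qed
  also have "(\<Prod>b\<in>Basis. (coord_split u - coord_split l) \<bullet> b) = (\<Prod>j\<in>UNIV. (coord_split u
      - coord_split l) $ j)"
    by (simp add: Basis_vec_def UNION_singleton_eq_range prod.reindex inj_on_def axis_eq_axis inner_axis)
  also have "\<dots> = (\<Prod>b\<in>Basis. (u - l) \<bullet> b)"
  proof -
    have eq: "(Basis :: 'n point set) = insert (1, 0) (range (\<lambda>i. (0, axis i 1)))"
      by (auto simp: Basis_prod_def Basis_vec_def)
    have inj: "inj (\<lambda>i::'n. (0::real, axis i (1::real)))"
      by (simp add: inj_on_def axis_eq_axis)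
    show ?thesis
      unfolding eq by (subst prod.insert) (auto simp: prod_coord prod.reindex inj coord_split_def
          inner_axis inner_prod_def)
  qed
  finally show "emeasure (distr lborel borel coord_join) (box l u) = ennreal (prod ((\<bullet>) (u - l)) Basis)"
    by simp
qed simp

lemma emeasure_lborel_split_image:
  assumes "S \<in> sets borel"
  shows "emeasure lborel (coord_split ` S) = emeasure lborel (S :: 'n::finite point set)"
proof -
  have "emeasure lborel S = emeasure (distr lborel borel coord_join) S"
    by (simp add: distr_coord_join)
  also have "\<dots> = emeasure lborel (coord_split ` S)"
    using assms by (simp add: emeasure_distr coord_split_image_eq_vimage)
  finally show ?thesis ..
qed

lemma sets_split_image: "S \<in> sets borel \<Longrightarrow> coord_split ` S \<in> sets borel"
  unfolding coord_split_image_eq_vimage using measurable_sets[OF measurable_coord_join, of S] by simp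

text \<open>
The square of the determinant of an involution is \<open>1\<close>.
\<close>

lemma distr_lborel_involution:
  fixes T :: "'n::finite point \<Rightarrow> 'n point"
  assumes T: "linear T" "\<And>z. T (T z) = z"
  shows "distr lborel borel T = lborel"
proof (rule lborel_eqI[symmetric])
  have T_meas [measurable]: "T \<in> borel_measurable borel"
    using T(1) by (intro borel_measurable_continuous_onI linear_continuous_on) (simp add:
        linear_conv_bounded_linear)
  define T' where "T' = coord_split \<circ> T \<circ> coord_join"
  have lin: "linear T'"
    unfolding T'_def using T(1) linear_coord_join linear_coord_split by (intro linear_compose)
  have "T' \<circ> T' = id"
    by (auto simp: T'_def T(2))
  then have "matrix T' ** matrix T' = mat 1"
    using matrix_compose[OF lin lin] by (simp add: matrix_id_mat_1)
  then have "det (matrix T') * det (matrix T') = 1"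
    by (metis det_mul det_I)
  then have det: "\<bar>det (matrix T')\<bar> = 1"
    using abs_square_eq_1[of "det (matrix T')"] by (simp add: power2_eq_square)
  fix l u :: "'n point"
  assume le: "\<And>b. b \<in> Basis \<Longrightarrow> l \<bullet> b \<le> u \<bullet> b"
  have B: "T -` box l u \<in> sets borel"
    using measurable_sets[OF T_meas, of "box l u"] by simp
  have bdd: "bounded (coord_split ` box l u)"
    using linear_coord_split by (intro bounded_linear_image) (auto simp: linear_conv_bounded_linear)
  then have lm: "coord_split ` box l u \<in> lmeasurable"
    by (intro bounded_set_imp_lmeasurable) (auto intro!: sets_completionI_sets sets_split_image)
  have im: "coord_split ` (T -` box l u) = T' ` (coord_split ` box l u)"
  proof -
    have "T -` box l u = T ` box l u"
      by (intro set_eqI iffI) (metis T(2) image_eqI vimageD, metis T(2) imageE vimageI)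
    then show ?thesis
      by (simp add: T'_def image_image)
  qed
  have "emeasure (distr lborel borel T) (box l u) = emeasure lborel (T -` box l u)"
    by (simp add: emeasure_distr)
  also have "\<dots> = emeasure lborel (coord_split ` (T -` box l u))"
    by (simp add: emeasure_lborel_split_image B)
  also have "\<dots> = emeasure lebesgue (T' ` (coord_split ` box l u))"
    using sets_split_image[OF B] by (simp add: im)
  also have "\<dots> = ennreal (measure lebesgue (T' ` (coord_split ` box l u)))"
    using measurable_linear_image[OF lin lm] by (rule emeasure_eq_measure2)
  also have "\<dots> = ennreal (measure lebesgue (coord_split ` box l u))"
    by (simp add: measure_linear_image[OF lin lm] det)
  also have "\<dots> = emeasure lebesgue (coord_split ` box l u)"
    using emeasure_eq_measure2[OF lm] by simp
  also have "\<dots> = emeasure lborel (box l u)"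
    using emeasure_lborel_split_image[of "box l u"] sets_split_image[of "box l u"] by simp
  also have "\<dots> = ennreal (prod ((\<bullet>) (u - l)) Basis)"
    using le by (intro emeasure_lborel_box)
  finally show "emeasure (distr lborel borel T) (box l u) = ennreal (prod ((\<bullet>) (u - l)) Basis)" .
qed simp

text \<open>
This is the Leibniz formula: there are \<open>m!\<close> products of \<open>m\<close> entries.
\<close>

lemma abs_det_le:
  fixes A :: "real ^ 'm ^ 'm"
  assumes "\<And>i j. \<bar>A $ i $ j\<bar> \<le> C"
  shows "\<bar>det A\<bar> \<le> fact CARD('m) * C ^ CARD('m)"
proof -
  have "\<bar>det A\<bar> \<le> (\<Sum>p | p permutes (UNIV :: 'm set). \<bar>of_int (sign p) * (\<Prod>i\<in>UNIV. A $ i $ p i)\<bar>)"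
    unfolding det_def by (rule sum_abs)
  also have "\<dots> \<le> (\<Sum>p | p permutes (UNIV :: 'm set). C ^ CARD('m))"
  proof (rule sum_mono)
    fix p :: "'m \<Rightarrow> 'm"
    have "(\<Prod>i\<in>UNIV. \<bar>A $ i $ p i\<bar>) \<le> (\<Prod>i\<in>(UNIV :: 'm set). C)"
      by (intro prod_mono) (auto simp: assms)
    then show "\<bar>of_int (sign p) * (\<Prod>i\<in>UNIV. A $ i $ p i)\<bar> \<le> C ^ CARD('m)"
      by (simp add: abs_mult abs_prod sign_def)
  qed
  also have "\<dots> = fact CARD('m) * C ^ CARD('m)"
    by (simp add: card_permutations)
  finally show ?thesis .
qed

text \<open>
One half of the change of variables formula, with the Jacobian replaced by the bound that follows
from a bound \<open>C\<close> on the derivative. It is used to show that a set of normals is large because its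
image is.
\<close>

lemma emeasure_le_differentiable_image:
  fixes f :: "'n::finite point \<Rightarrow> 'n point" and C :: real
  assumes S: "S \<in> sets borel" "bounded S"
    and Z: "Z \<in> sets borel" "Z \<subseteq> f ` S"
    and deriv: "\<And>h. (f has_derivative f' h) (at h)"
    and cont: "\<And>\<eta>. continuous_on UNIV (\<lambda>h. f' h \<eta>)"
    and C: "\<And>h \<eta>. h \<in> S \<Longrightarrow> norm (f' h \<eta>) \<le> C * norm \<eta>"
  shows "emeasure lborel Z \<le> ennreal (fact (Suc CARD('n)) * C ^ Suc CARD('n)) * emeasure lborel S"
proof -
  let ?S = "coord_split ` S" and ?F = "coord_split \<circ> f \<circ> coord_join" and ?F' =
      "\<lambda>y. coord_split \<circ> f' (coord_join y) \<circ> coord_join"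
  let ?B = "fact (Suc CARD('n)) * C ^ Suc CARD('n)"
  have bl: "bounded_linear coord_join" "bounded_linear coord_split"
    using linear_coord_join linear_coord_split by (auto simp: linear_conv_bounded_linear)
  have deriv': "(?F has_derivative ?F' y) (at y within ?S)" for y
  proof -
    have "(coord_join has_derivative coord_join) (at y)" 
      using bl(1) by (rule bounded_linear_imp_has_derivative)
    then have "(coord_split \<circ> f \<circ> coord_join has_derivative coord_split \<circ> f' (coord_join y) \<circ>
        coord_join) (at y)"
      by (rule diff_chain_at[OF diff_chain_at[OF _ deriv] bounded_linear_imp_has_derivative[OF bl(2)],
          unfolded o_assoc])
    then show ?thesis by (rule has_derivative_at_withinI)
  qed
  have det_le: "\<bar>det (matrix (?F' y))\<bar> \<le> ?B" if y: "y \<in> ?S" for y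
  proof -
    have "\<bar>matrix (?F' y) $ i $ j\<bar> \<le> C" for i j :: "'n coord"
    proof -
      have "\<bar>matrix (?F' y) $ i $ j\<bar> \<le> norm (?F' y (axis j 1))"
        using component_le_norm_cart[of "?F' y (axis j 1)" i] by (simp add: matrix_def)
      also have "\<dots> \<le> C * norm (coord_join (axis j 1 :: real ^ 'n coord))"
        using y by (auto simp: norm_coord_split intro: C)
      also have "norm (coord_join (axis j 1 :: real ^ 'n coord)) = 1"
        by (simp add: norm_eq_sqrt_inner inner_coord_join inner_axis_axis)
      finally show ?thesis by (simp only: mult_1_right)
    qed
    from abs_det_le[of "matrix (?F' y)" C, OF this] show ?thesis
      by (simp add: CARD_coord)
  qed
  have bdd: "bounded ?S"
    using S(2) bl(2) by (rule bounded_linear_image)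
  have lm: "?S \<in> lmeasurable"
    using bdd by (intro bounded_set_imp_lmeasurable) (auto intro!: sets_completionI_sets sets_split_image S)
  have cont': "continuous_on UNIV (\<lambda>y. \<bar>det (matrix (?F' y))\<bar>)"
  proof -
    have c: "continuous_on UNIV (\<lambda>y. (coord_split (f' (coord_join y) \<eta>)) $ i)" for \<eta> i
    proof -
      have "continuous_on UNIV (\<lambda>y. f' (coord_join y) \<eta>)"
        using continuous_on_compose2[OF cont[of \<eta>] linear_continuous_on[OF bl(1)]] by simp
      then show ?thesis
        by (intro continuous_on_component bounded_linear.continuous_on[OF bl(2)])
    qed
    show ?thesis
      unfolding det_def matrix_def o_def vec_lambda_beta
      by (intro c continuous_on_rabs continuous_on_sum continuous_on_mult continuous_on_prod
          continuous_on_const)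
  qed
  obtain a where a: "?S \<subseteq> cbox (-a) a"
    using bdd bounded_subset_cbox_symmetric by blast
  have int: "(\<lambda>y. \<bar>det (matrix (?F' y))\<bar>) integrable_on ?S"
  proof -
    have "(\<lambda>y. \<bar>det (matrix (?F' y))\<bar>) absolutely_integrable_on cbox (-a) a"
      by (intro absolutely_integrable_continuous continuous_on_subset[OF cont']) auto
    then have "(\<lambda>y. \<bar>det (matrix (?F' y))\<bar>) absolutely_integrable_on ?S"
      using fmeasurableD[OF lm] a by (rule set_integrable_subset)
    then show ?thesis by (simp add: absolutely_integrable_on_def)
  qed
  note im = measurable_bounded_differentiable_image[OF lm deriv' int det_le]
    measure_bounded_differentiable_image[OF lm deriv' int det_le]
  have fin: "emeasure lebesgue (?F ` ?S) = ennreal (measure lebesgue (?F ` ?S))"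
    "emeasure lebesgue ?S = ennreal (measure lebesgue ?S)"
    using emeasure_eq_measure2[OF im(1)] emeasure_eq_measure2[OF lm] by blast+
  have "emeasure lborel Z = emeasure lebesgue (coord_split ` Z)"
    using emeasure_lborel_split_image[OF Z(1)] sets_split_image[OF Z(1)] by simp
  also have "\<dots> \<le> emeasure lebesgue (?F ` ?S)"
  proof (rule emeasure_mono)
    have "(coord_split \<circ> f \<circ> coord_join) ` coord_split ` S = coord_split ` f ` S"
      by (simp add: image_image)
    then show "coord_split ` Z \<subseteq> (coord_split \<circ> f \<circ> coord_join) ` coord_split ` S"
      using image_mono[OF Z(2), of coord_split] by simp
    show "(coord_split \<circ> f \<circ> coord_join) ` coord_split ` S \<in> sets lebesgue"
      using im(1) by (rule fmeasurableD)
  qed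
  also have "\<dots> \<le> ennreal (?B * measure lebesgue ?S)"
    unfolding fin(1) by (intro ennreal_leI) (use im(2) in simp)
  also have "\<dots> = ennreal ?B * emeasure lborel S"
  proof (cases "S = {}")
    case False
    then obtain h where "h \<in> S" by blast
    from C[OF this, of "(1,0)"] have "norm (f' h (1, 0)) \<le> C"
      by (simp add: norm_Pair)
    then have "0 \<le> C"
      by (rule order_trans[OF norm_ge_zero])
    then have "ennreal (?B * measure lebesgue ?S) = ennreal ?B * ennreal (measure lebesgue ?S)"
      by (intro ennreal_mult mult_nonneg_nonneg) auto
    also have "ennreal (measure lebesgue ?S) = emeasure lborel (coord_split ` S)"
      unfolding fin(2)[symmetric] using sets_split_image[OF S(1)] by simp
    finally show ?thesis
      unfolding emeasure_lborel_split_image[OF S(1)] .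
  qed simp
  finally show ?thesis .
qed

section \<open>Reflections of the three models\<close>

text \<open>
The sectional curvature. All formulas below that contain it are valid for the three models
simultaneously.
\<close>

fun curv :: "geometry \<Rightarrow> real" where
  "curv Spherical = 1"
| "curv Euclidean = 0"
| "curv Hyperbolic = -1"

definition qform :: "geometry \<Rightarrow> 'n::finite point \<Rightarrow> real" where
  "qform G x = (fst x)\<^sup>2 + curv G * (snd x \<bullet> snd x)"

lemma normal_form_curv: "normal_form G v = curv G * (fst v)\<^sup>2 + snd v \<bullet> snd v"
  by (cases G) (auto simp: inner_prod_def lorentz_def power2_eq_square)

lemma model_space_curv:
  "x \<in> model_space G \<longleftrightarrow> qform G x = 1 \<and> (G \<noteq> Spherical \<longrightarrow> 0 < fst x)"
  by (cases G) (auto simp: qform_def inner_prod_def lorentz_def base_point_def power2_eq_square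
      square_eq_1_iff)

declare model_space.simps [simp del]

text \<open>
The direction in which the reflection in the hypersurface with normal \<open>h\<close> moves points. In the
spherical and the hyperbolic case it is the vector dual to \<open>h\<close> with respect to \<open>curv\<close> times the form
of the model; in the Euclidean case it drops the offset \<open>fst h\<close> of the hyperplane.
\<close>

definition sharp :: "geometry \<Rightarrow> 'n::finite point \<Rightarrow> 'n point" where
  "sharp G h = (curv G * fst h, snd h)"

definition reflect :: "geometry \<Rightarrow> 'n::finite point \<Rightarrow> 'n point \<Rightarrow> 'n point" where
  "reflect G h x = x - (2 * (h \<bullet> x) / normal_form G h) *\<^sub>R sharp G h"

text \<open>
The transpose of \<open>reflect G h\<close>, which is the action of the reflection on normals.
\<close>

definition coreflect :: "geometry \<Rightarrow> 'n::finite point \<Rightarrow> 'n point \<Rightarrow> 'n point" where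
  "coreflect G h v = v - (2 * (sharp G h \<bullet> v) / normal_form G h) *\<^sub>R h"

lemma inner_sharp: "h \<bullet> sharp G h = normal_form G h"
  by (simp add: sharp_def inner_prod_def normal_form_curv power2_eq_square)

lemma linear_reflect: "linear (reflect G h)"
  by (rule linearI) (simp_all add: reflect_def algebra_simps inner_add_right scaleR_add_left[symmetric]
      add_divide_distrib flip: scaleR_add_left)

lemma linear_coreflect: "linear (coreflect G h)"
  by (rule linearI) (simp_all add: coreflect_def algebra_simps inner_add_right add_divide_distrib)

lemma inner_reflect: "v \<bullet> reflect G h x = coreflect G h v \<bullet> x"
  by (simp add: reflect_def coreflect_def inner_diff_left inner_diff_right inner_commute)

lemma inner_normal_reflect:
  assumes "normal_form G h > 0"
  shows "h \<bullet> reflect G h x = - (h \<bullet> x)"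
    using assms by (simp add: reflect_def inner_diff_right inner_sharp)

lemma reflect_reflect:
  assumes "normal_form G h > 0"
  shows "reflect G h (reflect G h x) = x"
  using inner_normal_reflect[OF assms, of x]
  by (simp add: reflect_def[of G h "reflect G h x"]) (simp add: reflect_def)

lemma inner_sharp_coreflect:
  assumes "normal_form G h > 0"
  shows "sharp G h \<bullet> coreflect G h v = - (sharp G h \<bullet> v)"
  using assms by (simp add: coreflect_def inner_diff_right inner_sharp inner_commute[of "sharp G h" h])

lemma coreflect_coreflect:
  assumes "normal_form G h > 0"
  shows "coreflect G h (coreflect G h v) = v"
  using inner_sharp_coreflect[OF assms, of v]
  by (simp add: coreflect_def[of G h "coreflect G h v"]) (simp add: coreflect_def)

lemma normal_form_coreflect:
  assumes "normal_form G h > 0"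
  shows "normal_form G (coreflect G h v) = normal_form G v"
proof -
  define c where "c = 2 * (sharp G h \<bullet> v) / normal_form G h"
  have "normal_form G (coreflect G h v) = normal_form G v - 2 * c * (sharp G h \<bullet> v) + c\<^sup>2 * normal_form G h"
    by (simp add: coreflect_def flip: c_def)
      (simp add: normal_form_curv sharp_def inner_prod_def inner_diff_left inner_diff_right
        inner_commute power2_eq_square algebra_simps)
  also have "c * normal_form G h = 2 * (sharp G h \<bullet> v)"
    using assms by (simp add: c_def)
  then have "c\<^sup>2 * normal_form G h = 2 * c * (sharp G h \<bullet> v)"
    by (simp add: power2_eq_square)
  finally show ?thesis by simp
qed

lemma qform_reflect:
  assumes "normal_form G h > 0"
  shows "qform G (reflect G h x) = qform G x"
proof -
  define c where "c = 2 * (h \<bullet> x) / normal_form G h"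
  have "qform G (reflect G h x) = qform G x - 2 * c * curv G * (h \<bullet> x) + c\<^sup>2 * curv G * normal_form G h"
    by (simp add: reflect_def flip: c_def)
      (cases G; simp add: normal_form_curv qform_def sharp_def inner_prod_def inner_diff_left
          inner_diff_right
        inner_commute power2_eq_square algebra_simps)
  also have "c * normal_form G h = 2 * (h \<bullet> x)"
    using assms by (simp add: c_def)
  then have "c\<^sup>2 * curv G * normal_form G h = 2 * c * curv G * (h \<bullet> x)"
    by (simp add: power2_eq_square)
  finally show ?thesis by simp
qed

text \<open>
On differences of points of the model, \<open>normal_form\<close> is an increasing function of the geodesic
distance. So a point moves away from \<open>y\<close> when it is reflected from the side of \<open>y\<close> to the other
side.
\<close>

lemma normal_form_reflect_diff:
  assumes "normal_form G h > 0" "x \<in> model_space G" "y \<in> model_space G"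
  shows "normal_form G (reflect G h x - y) - normal_form G (x - y)
    = 4 * (h \<bullet> x) * (h \<bullet> y) / normal_form G h"
proof -
  define c where "c = 2 * (h \<bullet> x) / normal_form G h"
  have k: "curv G * curv G * fst h * (fst x - fst y) = fst h * (fst x - fst y)"
    using assms(2,3) by (cases G) (auto simp: model_space_curv qform_def power2_eq_1_iff)
  have "normal_form G (reflect G h x - y) = normal_form G (x - y)
      - 2 * c * (curv G * curv G * fst h * (fst x - fst y) + snd h \<bullet> snd (x - y))
     + c\<^sup>2 * normal_form G h"
    by (simp add: reflect_def flip: c_def)
      (cases G; simp add: normal_form_curv qform_def sharp_def inner_prod_def inner_diff_left
          inner_diff_right
        inner_commute power2_eq_square algebra_simps)
  also have "curv G * curv G * fst h * (fst x - fst y) + snd h \<bullet> snd (x - y) = h \<bullet> x - h \<bullet> y"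
    unfolding k by (simp add: inner_prod_def inner_diff_right algebra_simps)
  also have c: "c * normal_form G h = 2 * (h \<bullet> x)"
    using assms by (simp add: c_def)
  then have "c\<^sup>2 * normal_form G h = 2 * c * (h \<bullet> x)"
    by (simp add: power2_eq_square)
  finally have "normal_form G (reflect G h x - y) - normal_form G (x - y) = 2 * c * (h \<bullet> y)"
    by (simp add: algebra_simps)
  then show ?thesis by (simp add: c_def)
qed

text \<open>
The quadratic form is preserved, so only the sheet matters. In the hyperbolic case, points \<open>x\<close> and
\<open>y\<close> of different sheets satisfy \<open>lorentz x y \<le> -1\<close>, whereas a point has a positive Lorentz
product with its mirror image.
\<close>

lemma reflect_in_model_space:
  assumes "normal_form G h > 0" "x \<in> model_space G"
  shows "reflect G h x \<in> model_space G"
proof (cases G)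
  case Hyperbolic
  define y where "y = reflect G h x"
  have q: "qform G y = 1"
    using assms by (simp add: y_def qform_reflect model_space_curv)
  have x: "0 < fst x" "(fst x)\<^sup>2 = 1 + snd x \<bullet> snd x"
    using assms(2) Hyperbolic by (auto simp: model_space_curv qform_def)
  have y: "(fst y)\<^sup>2 = 1 + snd y \<bullet> snd y"
    using q Hyperbolic by (auto simp: qform_def)
  have "0 < fst y"
  proof (rule ccontr)
    assume "\<not> 0 < fst y"
    then have n: "fst x * fst y \<le> 0"
      using x by (simp add: mult_nonneg_nonpos)
    have "lorentz x (sharp G h) = - (h \<bullet> x)"
      using Hyperbolic by (simp add: lorentz_def sharp_def inner_prod_def inner_commute)
    moreover have "lorentz x y = lorentz x x - 2 * (h \<bullet> x) / normal_form G h * lorentz x (sharp G h)"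
      by (simp add: y_def reflect_def lorentz_def inner_diff_right algebra_simps)
    moreover have "lorentz x x = 1"
      using x by (simp add: lorentz_def power2_eq_square)
    ultimately have "lorentz x y = 1 + 2 * (h \<bullet> x)\<^sup>2 / normal_form G h"
      by (simp add: power2_eq_square)
    also have "\<dots> > 0"
      using assms(1) by (intro add_pos_nonneg) auto
    finally have "snd x \<bullet> snd y < fst x * fst y"
      by (simp add: lorentz_def)
    then have "(fst x * fst y)\<^sup>2 < (snd x \<bullet> snd y)\<^sup>2"
      using n by (metis (no_types, opaque_lifting) abs_le_square_iff abs_of_nonpos less_le_not_le
          neg_le_iff_le not_le order_less_le_trans)
    also have "\<dots> \<le> (snd x \<bullet> snd x) * (snd y \<bullet> snd y)"
      by (rule Cauchy_Schwarz_ineq)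
    also have "\<dots> \<le> (fst x * fst y)\<^sup>2"
      unfolding power_mult_distrib x(2) y by (intro mult_mono) auto
    finally show False by simp
  qed
  then show ?thesis
    using q by (simp add: model_space_curv y_def)
qed (use assms in \<open>auto simp: model_space_curv qform_reflect\<close>, simp add: reflect_def sharp_def)

lemma inner_coreflect_diff:
  "v \<bullet> x - coreflect G h v \<bullet> x = 2 * (sharp G h \<bullet> v) / normal_form G h * (h \<bullet> x)"
  by (simp add: coreflect_def inner_diff_left)

lemma distr_reflect: "normal_form G h > 0 \<Longrightarrow> distr lborel borel (reflect G h) = lborel"
  by (intro distr_lborel_involution linear_reflect reflect_reflect)

lemma distr_coreflect: "normal_form G h > 0 \<Longrightarrow> distr lborel borel (coreflect G h) = lborel"
  by (intro distr_lborel_involution linear_coreflect coreflect_coreflect)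

section \<open>The volume as the measure of a cone\<close>

lemma chart_domain_curv: "chart_domain G = {u. curv G * (u \<bullet> u) < 1}"
proof (cases G)
  case Hyperbolic
  have "- 1 < u \<bullet> u" for u :: "real ^ 'a"
    using inner_ge_zero[of u] by linarith
  then show ?thesis using Hyperbolic by simp
qed (auto simp: norm_eq_sqrt_inner)

lemma height_curv: "height G u = sqrt (1 - curv G * (u \<bullet> u))"
  by (cases G) auto

text \<open>
The union of the segments from the origin to the points of \<open>A\<close>, without the origin. Its Lebesgue
measure is invariant under all linear isometries of the model.
\<close>

definition solid_cone :: "geometry \<Rightarrow> 'n::finite point set \<Rightarrow> 'n point set" where
  "solid_cone G A = {z. 0 < qform G z \<and> qform G z \<le> 1 \<and> (G \<noteq> Spherical \<longrightarrow> 0 < fst z)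
      \<and> z /\<^sub>R sqrt (qform G z) \<in> A}"

lemma measurable_qform [measurable]: "qform G \<in> borel_measurable borel"
  unfolding qform_def by (intro borel_measurable_continuous_onI continuous_intros)

lemma sets_solid_cone:
  assumes [measurable]: "A \<in> sets borel"
  shows "solid_cone G A \<in> sets borel"
proof -
  have "(\<lambda>z. inverse (sqrt (qform G z)) *\<^sub>R z) \<in> borel_measurable borel"
    by (intro borel_measurable_scaleR borel_measurable_inverse
        measurable_compose[OF measurable_qform borel_measurable_sqrt] measurable_ident_sets refl)
  from measurable_sets[OF this assms] have "{z. z /\<^sub>R sqrt (qform G z) \<in> A} \<in> sets borel"
    by (simp add: vimage_def)
  moreover have "{z. 0 < qform G z \<and> qform G z \<le> 1} \<in> sets borel"
    by measurable
  moreover have "{z :: 'a point. G \<noteq> Spherical \<longrightarrow> 0 < fst z} \<in> sets borel"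
    by (cases "G = Spherical") (auto intro!: borel_open open_Collect_less continuous_intros)
  moreover have "solid_cone G A = {z. 0 < qform G z \<and> qform G z \<le> 1} \<inter> {z. G \<noteq> Spherical \<longrightarrow> 0 < fst z}
      \<inter> {z. z /\<^sub>R sqrt (qform G z) \<in> A}"
    by (auto simp: solid_cone_def)
  ultimately show ?thesis by simp
qed

lemma le_sqrt_iff_power2: "0 \<le> z \<Longrightarrow> z \<le> sqrt b \<longleftrightarrow> z\<^sup>2 \<le> b"
  using real_sqrt_le_iff[of "z\<^sup>2" b] by simp

lemma sqrt_le_iff_power2: "0 \<le> z \<Longrightarrow> sqrt b \<le> z \<longleftrightarrow> b \<le> z\<^sup>2"
  using real_sqrt_le_iff[of b "z\<^sup>2"] by simp

text \<open>
A point \<open>(z, w)\<close> of the cone is \<open>t\<close> times the point of the model over \<open>u = w / t\<close>, where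
\<open>t\<^sup>2 = z\<^sup>2 + curv G * (w \<bullet> w)\<close>. For fixed \<open>w\<close> with \<open>a = w \<bullet> w\<close> the lemma replaces the variable \<open>z\<close> by
\<open>t\<close>. On the sphere \<open>t\<close> is a smooth function of \<open>z\<close> up to the end points, and in the hyperbolic case
\<open>z\<close> is a smooth function of \<open>t\<close>; this decides in which direction the substitution rule is used.
\<close>

lemma line_substitution:
  fixes F :: "real \<Rightarrow> real" and a :: real
  assumes [measurable]: "F \<in> borel_measurable borel" and F: "\<And>z. 0 \<le> F z" and a: "0 < a"
  shows "(\<integral>\<^sup>+z. ennreal (F z) * indicator {z. 0 < z \<and> 0 < z\<^sup>2 + curv G * a \<and> z\<^sup>2 + curv G * a
      \<le> 1} z \<partial>lborel)
    = (\<integral>\<^sup>+t. ennreal (F (sqrt (t\<^sup>2 - curv G * a)) * (t / sqrt (t\<^sup>2 - curv G * a)))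
          * indicator {t. 0 < t \<and> t \<le> 1 \<and> curv G * a < t\<^sup>2} t \<partial>lborel)"
proof -
  have p: "0 < t\<^sup>2 + a" "sqrt (t\<^sup>2 + a) \<noteq> 0" for t :: real
  proof -
    show *: "0 < t\<^sup>2 + a" using a by (intro add_nonneg_pos) auto
    show "sqrt (t\<^sup>2 + a) \<noteq> 0" using * by simp
  qed
  show ?thesis
  proof (cases G)
    case Euclidean
    have "0 < z \<and> 0 < z\<^sup>2 + curv G * a \<and> z\<^sup>2 + curv G * a \<le> 1
        \<longleftrightarrow> 0 < z \<and> z \<le> 1 \<and> curv G * a < z\<^sup>2" for z :: real
      using Euclidean by (cases "0 < z") (simp_all add: power_le_one_iff)
    then show ?thesis
      using Euclidean by (intro nn_integral_cong) (auto simp: indicator_def)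
  next
    case Hyperbolic
    \<comment> \<open>the height as a function of the scale\<close>
    define g where "g t = sqrt (t\<^sup>2 + a)" for t
    have "(g has_real_derivative t / g t) (at t)" for t :: real
      unfolding g_def using p[of t] by (auto intro!: derivative_eq_intros simp: field_simps)
    moreover have "continuous_on {0..1} (\<lambda>t. t / g t)"
      unfolding g_def using a by (intro continuous_intros) (use p in auto)
    moreover have "t / g t \<ge> 0" if "t \<in> {0..1}" for t
      using that by (simp add: g_def a less_imp_le)
    moreover have "set_borel_measurable borel {g 0..g 1} F"
      unfolding set_borel_measurable_def by measurable
    ultimately have "(\<integral>\<^sup>+z. F z * indicator {g 0..g 1} z \<partial>lborel) =
        (\<integral>\<^sup>+t. F (g t) * (t / g t) * indicator {0..1} t \<partial>lborel)"
      by (intro nn_integral_substitution) auto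
    moreover have "(\<integral>\<^sup>+z. F z * indicator {g 0..g 1} z \<partial>lborel) =
       (\<integral>\<^sup>+z. ennreal (F z) * indicator {z. 0 < z \<and> 0 < z\<^sup>2 + curv G * a \<and> z\<^sup>2 + curv G * a \<le> 1} z \<partial>lborel)"
    proof (rule nn_integral_cong_AE)
      have iff: "z \<in> {g 0..g 1} \<longleftrightarrow> 0 < z \<and> 0 < z\<^sup>2 + curv G * a \<and> z\<^sup>2 + curv G * a \<le> 1" if "z \<noteq> sqrt a" for z
      proof -
        have "sqrt a \<le> z \<and> z \<le> sqrt (1 + a) \<longleftrightarrow> 0 < z \<and> a < z\<^sup>2 \<and> z\<^sup>2 \<le> 1 + a"
        proof (cases "0 < z")
          case True
          have "sqrt a \<le> z \<longleftrightarrow> a \<le> z\<^sup>2" "z \<le> sqrt (1 + a) \<longleftrightarrow> z\<^sup>2 \<le> 1 + a"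
            using True by (simp_all add: le_sqrt_iff_power2 sqrt_le_iff_power2)
          moreover have "a \<noteq> z\<^sup>2"
            using that True by auto
          ultimately show ?thesis using True by auto
        qed (use real_sqrt_gt_zero[OF a] in linarith)
        then show ?thesis
          using Hyperbolic by (simp add: g_def algebra_simps)
      qed
      show "AE z in lborel. ennreal (F z * indicator {g 0..g 1} z) =
          ennreal (F z) * indicator {z. 0 < z \<and> 0 < z\<^sup>2 + curv G * a \<and> z\<^sup>2 + curv G * a \<le> 1} z"
        using AE_lborel_singleton[of "sqrt a"] by eventually_elim (use iff in \<open>auto simp: indicator_def\<close>)
    qed
    moreover have "(\<integral>\<^sup>+t. F (g t) * (t / g t) * indicator {0..1} t \<partial>lborel) = 
       (\<integral>\<^sup>+t. ennreal (F (sqrt (t\<^sup>2 - curv G * a)) * (t / sqrt (t\<^sup>2 - curv G * a)))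
            * indicator {t. 0 < t \<and> t \<le> 1 \<and> curv G * a < t\<^sup>2} t \<partial>lborel)"
    proof (intro nn_integral_cong)
      fix t :: real
      have "- a < t\<^sup>2"
        using a by (smt (verit) zero_le_power2)
      then show "ennreal (F (g t) * (t / g t) * indicator {0..1} t) =
           ennreal (F (sqrt (t\<^sup>2 - curv G * a)) * (t / sqrt (t\<^sup>2 - curv G * a)))
            * indicator {t. 0 < t \<and> t \<le> 1 \<and> curv G * a < t\<^sup>2} t"
        using Hyperbolic by (cases "t = 0") (auto simp: g_def indicator_def)
    qed
    ultimately show ?thesis by simp
  next
    case Spherical
    show ?thesis
    proof (cases "a < 1")
      case False
      have "{z::real. 0 < z \<and> 0 < z\<^sup>2 + curv G * a \<and> z\<^sup>2 + curv G * a \<le> 1} = {}"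
        using False Spherical by (auto) (smt (verit) zero_less_power2)
      moreover have "\<not> (0 < t \<and> t \<le> 1 \<and> curv G * a < t\<^sup>2)" for t
        using False Spherical power_le_one[of t 2] by auto
      ultimately show ?thesis by simp
    next
      case True
      \<comment> \<open>the scale as a function of the height\<close>
      define g where "g z = sqrt (z\<^sup>2 + a)" for z
      define f where "f t = F (sqrt (t\<^sup>2 - a)) * (t / sqrt (t\<^sup>2 - a))" for t
      define Z where "Z = sqrt (1 - a)"
      have Z: "0 < Z" "g Z = 1" "g 0 = sqrt a"
        using True by (simp_all add: Z_def g_def)
      have "(g has_real_derivative t / g t) (at t)" for t :: real
        unfolding g_def using p[of t] by (auto intro!: derivative_eq_intros simp: field_simps)
      moreover have "continuous_on {0..Z} (\<lambda>t. t / g t)"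
        unfolding g_def using a by (intro continuous_intros) (use p in auto)
      moreover have "t / g t \<ge> 0" if "t \<in> {0..Z}" for t
        using that by (simp add: g_def a less_imp_le)
      moreover have "set_borel_measurable borel {g 0..g Z} f"
        unfolding set_borel_measurable_def f_def by measurable
      ultimately have "(\<integral>\<^sup>+t. f t * indicator {g 0..g Z} t \<partial>lborel) =
          (\<integral>\<^sup>+z. f (g z) * (z / g z) * indicator {0..Z} z \<partial>lborel)"
        using Z(1) by (intro nn_integral_substitution) auto
      moreover have "(\<integral>\<^sup>+t. f t * indicator {g 0..g Z} t \<partial>lborel) =
         (\<integral>\<^sup>+t. ennreal (F (sqrt (t\<^sup>2 - curv G * a)) * (t / sqrt (t\<^sup>2 - curv G * a)))
            * indicator {t. 0 < t \<and> t \<le> 1 \<and> curv G * a < t\<^sup>2} t \<partial>lborel)"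
      proof (rule nn_integral_cong_AE)
        have iff: "t \<in> {g 0..g Z} \<longleftrightarrow> 0 < t \<and> t \<le> 1 \<and> a < t\<^sup>2" if "t \<noteq> sqrt a" for t
        proof (cases "0 < t")
          case t: True
          have "sqrt a \<le> t \<longleftrightarrow> a \<le> t\<^sup>2"
            using t by (simp add: sqrt_le_iff_power2)
          moreover have "a \<noteq> t\<^sup>2"
            using that t by auto
          ultimately show ?thesis using t Z by auto
        qed (use real_sqrt_gt_zero[OF a] in \<open>unfold Z(3) atLeastAtMost_iff, linarith\<close>)
        show "AE t in lborel. ennreal (f t * indicator {g 0..g Z} t) =
            ennreal (F (sqrt (t\<^sup>2 - curv G * a)) * (t / sqrt (t\<^sup>2 - curv G * a)))
            * indicator {t. 0 < t \<and> t \<le> 1 \<and> curv G * a < t\<^sup>2} t"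
          using AE_lborel_singleton[of "sqrt a"]
          by eventually_elim (use iff Spherical in \<open>auto simp: indicator_def f_def\<close>)
      qed
      moreover have "(\<integral>\<^sup>+z. f (g z) * (z / g z) * indicator {0..Z} z \<partial>lborel) =
        (\<integral>\<^sup>+z. ennreal (F z) * indicator {z. 0 < z \<and> 0 < z\<^sup>2 + curv G * a \<and> z\<^sup>2 + curv G * a
            \<le> 1} z \<partial>lborel)"
      proof (rule nn_integral_cong_AE)
        have eq: "ennreal (f (g z) * (z / g z) * indicator {0..Z} z) =
          ennreal (F z) * indicator {z. 0 < z \<and> 0 < z\<^sup>2 + curv G * a \<and> z\<^sup>2 + curv G * a \<le> 1} z" if
              "z \<noteq> 0" for z
        proof (cases "0 < z")
          case z: True
          have p: "0 < z\<^sup>2 + a"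
            using p by simp
          have "f (g z) * (z / g z) = F z"
            using z p by (simp add: f_def g_def)
          moreover have "z \<le> Z \<longleftrightarrow> z\<^sup>2 + a \<le> 1"
            using z by (auto simp: Z_def le_sqrt_iff_power2)
          ultimately show ?thesis
            using z p Spherical by (auto simp: indicator_def)
        qed (use that in \<open>auto simp: indicator_def\<close>)
        show "AE z in lborel. ennreal (f (g z) * (z / g z) * indicator {0..Z} z) =
          ennreal (F z) * indicator {z. 0 < z \<and> 0 < z\<^sup>2 + curv G * a \<and> z\<^sup>2 + curv G * a \<le> 1} z"
          using AE_lborel_singleton[of 0] by eventually_elim (rule eq)
      qed
      ultimately show ?thesis by simp
    qed
  qed
qed

lemma nn_integral_scaleR:
  fixes H :: "real ^ 'n::finite \<Rightarrow> ennreal"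
  assumes [measurable]: "H \<in> borel_measurable borel" and t: "0 < t"
  shows "(\<integral>\<^sup>+w. H w \<partial>lborel) = ennreal (t ^ CARD('n)) * (\<integral>\<^sup>+u. H (t *\<^sub>R u) \<partial>lborel)"
proof -
  have "(\<integral>\<^sup>+w. H w \<partial>lborel) =
      (\<integral>\<^sup>+w. H w \<partial>density (distr lborel borel (\<lambda>x. 0 + t *\<^sub>R x)) (\<lambda>_. ennreal (\<bar>t\<bar> ^ DIM(real ^ 'n))))"
    using t by (subst lborel_affine[of t 0]) auto
  also have "\<dots> = ennreal (t ^ CARD('n)) * (\<integral>\<^sup>+u. H (t *\<^sub>R u) \<partial>lborel)"
    using t by (simp add: nn_integral_density nn_integral_distr nn_integral_cmult)
  finally show ?thesis .
qed

lemma nn_integral_power_unit: "(\<integral>\<^sup>+t. ennreal (t ^ n) * indicator {t. 0 < t \<and> t \<le> 1} t \<partial>lborel)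
    = ennreal (1 / Suc n)"
proof -
  have "(\<integral>\<^sup>+t. ennreal (t ^ n) * indicator {t. 0 < t \<and> t \<le> 1} t \<partial>lborel)
      = (\<integral>\<^sup>+t. ennreal (t ^ n) * indicator {0..1} t \<partial>lborel)"
    using AE_lborel_singleton[of "0::real"] by (intro nn_integral_cong_AE) (auto elim!: eventually_mono
        simp: indicator_def)
  also have "\<dots> = ennreal (1 ^ Suc n / Suc n - 0 ^ Suc n / Suc n)"
  proof (rule nn_integral_FTC_Icc[where f = "\<lambda>t. t ^ n" and F = "\<lambda>t. t ^ Suc n / Suc n"])
    show "((\<lambda>t. t ^ Suc n / real (Suc n)) has_real_derivative t ^ n) (at t)" for t :: real
      by (rule derivative_eq_intros refl | simp)+
  qed auto
  finally show ?thesis by simp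
qed

text \<open>
Integrate over the height first, replace it by the scale \<open>t\<close>, and exchange the integrals. At scale
\<open>t\<close> the substitution \<open>w = t u\<close> produces \<open>t\<^sup>n\<close> times the integral that defines the volume in the
chart, and the integral of \<open>t\<^sup>n\<close> over the unit interval is \<open>1 / (n + 1)\<close>.
\<close>

lemma emeasure_volume_solid_cone:
  assumes A: "A \<in> sets (volume G)"
  shows "emeasure (volume G) A = ennreal (real (Suc CARD('n))) * emeasure lborel (solid_cone G (A ::
      'n::finite point set))"
proof -
  have [measurable]: "A \<in> sets borel"
    using A sets_model_space[of G] by (simp add: sets_volume sets_restrict_space_iff)
  have [measurable]: "solid_cone G A \<in> sets (borel \<Otimes>\<^sub>M borel)"
    unfolding borel_prod by (rule sets_solid_cone) fact
  \<comment> \<open>\<open>D a\<close> are the heights of the upper half of the unit cone over \<open>w\<close> with \<open>w \<bullet> w = a\<close>, and \<open>ph s z w\<close>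
    tells whether the ray of \<open>(s * z, w)\<close> meets \<open>A\<close>\<close>
  define D where "D a = {z::real. 0 < z \<and> 0 < z\<^sup>2 + curv G * a \<and> z\<^sup>2 + curv G * a \<le> 1}" for a
  define ph where "ph s z w = (indicator A ((s * z, w) /\<^sub>R sqrt (z\<^sup>2 + curv G * (w \<bullet> w))) :: real)"
      for s z and w :: "real ^ 'n"
  have [measurable]: "(\<lambda>(z, w). ph s z w) \<in> borel_measurable (borel \<Otimes>\<^sub>M borel)" for s
    unfolding ph_def split_beta by measurable
  have [measurable]: "(\<lambda>z. ph s z w) \<in> borel_measurable borel" for s w
    unfolding ph_def by measurable
  have "emeasure lborel (solid_cone G A) = (\<integral>\<^sup>+w. \<integral>\<^sup>+z. indicator (solid_cone G A) (z, w) \<partial>lborel \<partial>lborel)"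
    using sets_solid_cone[of A G] by (subst lborel_pair.nn_integral_snd) (auto simp: lborel_prod)
  also have "\<dots> = (\<integral>\<^sup>+w. (\<Sum>s\<in>chart_signs G. \<integral>\<^sup>+z. ennreal (ph s z w) * indicator (D (w \<bullet> w)) z \<partial>lborel)
      \<partial>lborel)"
  proof (rule nn_integral_cong)
    fix w :: "real ^ 'n"
    have [measurable]: "D a \<in> sets borel" for a
      unfolding D_def by measurable
    have pos: "indicator (solid_cone G A) (z, w) = ennreal (ph 1 z w) * indicator (D (w \<bullet> w)) z" if
        "0 < z" for z
      using that by (auto simp: solid_cone_def qform_def ph_def D_def indicator_def)
    show "(\<integral>\<^sup>+z. indicator (solid_cone G A) (z, w) \<partial>lborel) =
      (\<Sum>s\<in>chart_signs G. \<integral>\<^sup>+z. ennreal (ph s z w) * indicator (D (w \<bullet> w)) z \<partial>lborel)"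
    proof (cases "G = Spherical")
      case False
      have "indicator (solid_cone G A) (z, w) = ennreal (ph 1 z w) * indicator (D (w \<bullet> w)) z" for z
        using pos[of z] False by (cases "0 < z") (auto simp: solid_cone_def D_def)
      then show ?thesis
        using False by (cases G) auto
    next
      case True
      have neg: "indicator (solid_cone G A) (z, w)
          = ennreal (ph (-1) (-z) w) * indicator (D (w \<bullet> w)) (-z)" if "z < 0" for z
        using that True by (auto simp: solid_cone_def qform_def ph_def D_def indicator_def)
      have "(\<integral>\<^sup>+z. indicator (solid_cone G A) (z, w) \<partial>lborel) =
          (\<integral>\<^sup>+z. ennreal (ph 1 z w) * indicator (D (w \<bullet> w)) z
            + ennreal (ph (-1) (-z) w) * indicator (D (w \<bullet> w)) (-z) \<partial>lborel)"
      proof (rule nn_integral_cong_AE)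
        show "AE z in lborel. indicator (solid_cone G A) (z, w)
            = ennreal (ph 1 z w) * indicator (D (w \<bullet> w)) z
            + ennreal (ph (-1) (-z) w) * indicator (D (w \<bullet> w)) (-z)"
          using AE_lborel_singleton[of "0 :: real"]
        proof eventually_elim
          case (elim z)
          then show ?case
            using pos[of z] neg[of z] by (cases "0 < z") (auto simp: D_def)
        qed
      qed
      also have "\<dots> = (\<integral>\<^sup>+z. ennreal (ph 1 z w) * indicator (D (w \<bullet> w)) z \<partial>lborel)
          + (\<integral>\<^sup>+z. ennreal (ph (-1) (-z) w) * indicator (D (w \<bullet> w)) (-z) \<partial>lborel)"
        by (intro nn_integral_add) measurable
      also have "(\<integral>\<^sup>+z. ennreal (ph (-1) (-z) w) * indicator (D (w \<bullet> w)) (-z) \<partial>lborel) =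
          (\<integral>\<^sup>+z. ennreal (ph (-1) z w) * indicator (D (w \<bullet> w)) z \<partial>lborel)"
        using nn_integral_real_affine[of "\<lambda>z. ennreal (ph (-1) z w) * indicator (D (w \<bullet> w)) z" "-1" 0]
        by simp
      finally show ?thesis
        using True by simp
    qed
  qed
  also have "\<dots> = (\<integral>\<^sup>+w. (\<Sum>s\<in>chart_signs G.
      (\<integral>\<^sup>+t. ennreal (ph s (sqrt (t\<^sup>2 - curv G * (w \<bullet> w))) w * (t / sqrt (t\<^sup>2 - curv G * (w \<bullet> w))))
          * indicator {t. 0 < t \<and> t \<le> 1 \<and> curv G * (w \<bullet> w) < t\<^sup>2} t \<partial>lborel)) \<partial>lborel)"
  proof (rule nn_integral_cong_AE)
    show "AE w in lborel. (\<Sum>s\<in>chart_signs G. \<integral>\<^sup>+z. ennreal (ph s z w) * indicator (D (w \<bullet> w)) z \<partial>lborel) =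
      (\<Sum>s\<in>chart_signs G.
      (\<integral>\<^sup>+t. ennreal (ph s (sqrt (t\<^sup>2 - curv G * (w \<bullet> w))) w * (t / sqrt (t\<^sup>2 - curv G * (w \<bullet> w))))
          * indicator {t. 0 < t \<and> t \<le> 1 \<and> curv G * (w \<bullet> w) < t\<^sup>2} t \<partial>lborel))"
      using AE_lborel_singleton[of "0 :: real ^ 'n"]
    proof eventually_elim
      case (elim w)
      then show ?case
        unfolding D_def by (intro sum.cong refl line_substitution) (auto simp: ph_def)
    qed
  qed
  also have "\<dots> = (\<Sum>s\<in>chart_signs G. \<integral>\<^sup>+t. \<integral>\<^sup>+w. ennreal (ph s (sqrt (t\<^sup>2
      - curv G * (w \<bullet> w))) w * (t / sqrt (t\<^sup>2 - curv G * (w \<bullet> w))))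
          * indicator {t. 0 < t \<and> t \<le> 1 \<and> curv G * (w \<bullet> w) < t\<^sup>2} t \<partial>lborel \<partial>lborel)"
  proof -
    have [measurable]: "(\<lambda>(t, w). ennreal (ph s (sqrt (t\<^sup>2 - curv G * (w \<bullet> w))) w * (t / sqrt (t\<^sup>2
        - curv G * (w \<bullet> w))))
          * indicator {t. 0 < t \<and> t \<le> 1 \<and> curv G * (w \<bullet> w) < t\<^sup>2} t) \<in> borel_measurable (lborel \<Otimes>\<^sub>M
              lborel)" for s
      unfolding indicator_def by measurable
    show ?thesis
      by (subst nn_integral_sum) (auto intro!: sum.cong lborel_pair.Fubini')
  qed
  also have "\<dots> = (\<Sum>s\<in>chart_signs G. \<integral>\<^sup>+t. (ennreal (t ^ CARD('n)) * indicator {t. 0 < t \<and> t \<le> 1} t) *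
      (\<integral>\<^sup>+u\<in>chart_domain G. ennreal (1 / height G u) * indicator A (s * height G u, u) \<partial>lborel) \<partial>lborel)"
  proof (intro sum.cong refl nn_integral_cong)
    fix s t :: real
    define H where "H w = ennreal (ph s (sqrt (t\<^sup>2 - curv G * (w \<bullet> w))) w * (t / sqrt (t\<^sup>2
        - curv G * (w \<bullet> w))))
          * indicator {w. curv G * (w \<bullet> w) < t\<^sup>2} w" for w :: "real ^ 'n"
    have [measurable]: "H \<in> borel_measurable borel"
      unfolding H_def ph_def by measurable
    show "(\<integral>\<^sup>+w. ennreal (ph s (sqrt (t\<^sup>2 - curv G * (w \<bullet> w))) w * (t / sqrt (t\<^sup>2 - curv G * (w \<bullet> w))))
          * indicator {t. 0 < t \<and> t \<le> 1 \<and> curv G * (w \<bullet> w) < t\<^sup>2} t \<partial>lborel) =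
      ennreal (t ^ CARD('n)) * indicator {t. 0 < t \<and> t \<le> 1} t *
      (\<integral>\<^sup>+u\<in>chart_domain G. ennreal (1 / height G u) * indicator A (s * height G u, u) \<partial>lborel)"
    proof (cases "0 < t \<and> t \<le> 1")
      case True
      then have t: "0 < t" by simp
      have "(\<integral>\<^sup>+w. ennreal (ph s (sqrt (t\<^sup>2 - curv G * (w \<bullet> w))) w * (t / sqrt (t\<^sup>2 - curv G * (w \<bullet> w))))
          * indicator {t. 0 < t \<and> t \<le> 1 \<and> curv G * (w \<bullet> w) < t\<^sup>2} t \<partial>lborel) = (\<integral>\<^sup>+w. H w \<partial>lborel)"
        using True by (intro nn_integral_cong) (auto simp: H_def indicator_def)
      also have "\<dots> = ennreal (t ^ CARD('n)) * (\<integral>\<^sup>+u. H (t *\<^sub>R u) \<partial>lborel)"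
        using t by (intro nn_integral_scaleR) auto
      also have "(\<integral>\<^sup>+u. H (t *\<^sub>R u) \<partial>lborel) = (\<integral>\<^sup>+u\<in>chart_domain G. ennreal (1 / height G u) *
          indicator A (s * height G u, u) \<partial>lborel)"
      proof (intro nn_integral_cong)
        fix u :: "real ^ 'n"
        define k where "k = curv G * (u \<bullet> u)"
        have sq: "sqrt (t\<^sup>2 - curv G * (t *\<^sub>R u \<bullet> t *\<^sub>R u)) = t * sqrt (1 - k)"
        proof -
          have "t\<^sup>2 - curv G * (t *\<^sub>R u \<bullet> t *\<^sub>R u) = t\<^sup>2 * (1 - k)"
            by (simp add: k_def power2_eq_square algebra_simps)
          then show ?thesis using t by (simp add: real_sqrt_mult)
        qed
        have dom: "curv G * (t *\<^sub>R u \<bullet> t *\<^sub>R u) < t\<^sup>2 \<longleftrightarrow> k < 1"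
        proof -
          have "curv G * (t *\<^sub>R u \<bullet> t *\<^sub>R u) = t\<^sup>2 * k"
            by (simp add: k_def power2_eq_square algebra_simps)
          then show ?thesis using t by simp
        qed
        have H: "H (t *\<^sub>R u) = ennreal (ph s (t * sqrt (1 - k)) (t *\<^sub>R u) * (t / (t * sqrt (1
            - k)))) * of_bool (k < 1)"
          by (simp only: H_def sq indicator_def mem_Collect_eq dom)
        show "H (t *\<^sub>R u) = ennreal (1 / height G u) * indicator A (s * height G u, u) * indicator
            (chart_domain G) u"
        proof (cases "k < 1")
          case k: True
          have "(t * sqrt (1 - k))\<^sup>2 + curv G * (t *\<^sub>R u \<bullet> t *\<^sub>R u) = t\<^sup>2"
            using k by (simp add: power_mult_distrib k_def power2_eq_square algebra_simps)
          then have "sqrt ((t * sqrt (1 - k))\<^sup>2 + curv G * (t *\<^sub>R u \<bullet> t *\<^sub>R u)) = t"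
            using t by simp
          moreover have "(s * (t * sqrt (1 - k)), t *\<^sub>R u) /\<^sub>R t = (s * sqrt (1 - k), u)"
            using t by simp
          ultimately have "ph s (t * sqrt (1 - k)) (t *\<^sub>R u) = indicator A (s * sqrt (1 - k), u)"
            by (simp only: ph_def)
          then show ?thesis
            using k t by (simp add: H chart_domain_curv height_curv indicator_def flip: k_def)
        qed (simp add: H chart_domain_curv flip: k_def)
      qed
      finally show ?thesis using True by simp
    qed auto
  qed
  also have "\<dots> = (\<Sum>s\<in>chart_signs G. ennreal (1 / Suc CARD('n)) *
      (\<integral>\<^sup>+u\<in>chart_domain G. ennreal (1 / height G u) * indicator A (s * height G u, u) \<partial>lborel))"
    by (subst nn_integral_multc) (auto simp: nn_integral_power_unit)
  also have "\<dots> = ennreal (1 / Suc CARD('n)) * emeasure (volume G) A"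
    by (simp add: emeasure_volume[OF A] sum_distrib_left)
  finally have "ennreal (real (Suc CARD('n))) * emeasure lborel (solid_cone G A) =
      (ennreal (real (Suc CARD('n))) * ennreal (1 / Suc CARD('n))) * emeasure (volume G) A"
    by (simp add: mult.assoc)
  also have "ennreal (real (Suc CARD('n))) * ennreal (1 / Suc CARD('n)) = 1"
    by (subst ennreal_mult[symmetric]) auto
  finally show ?thesis by simp
qed

section \<open>Invariance and null sets of the volume\<close>

lemma sets_volume_iff: "A \<in> sets (volume G) \<longleftrightarrow> A \<in> sets borel \<and> A \<subseteq> model_space G"
  using sets_model_space[of G] by (auto simp: sets_volume sets_restrict_space_iff)

lemma measurable_reflect [measurable]: "reflect G h \<in> borel_measurable borel"
  using linear_reflect[of G h]
  by (intro borel_measurable_continuous_onI linear_continuous_on) (simp add: linear_conv_bounded_linear)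

lemma measurable_coreflect [measurable]: "coreflect G h \<in> borel_measurable borel"
  using linear_coreflect[of G h]
  by (intro borel_measurable_continuous_onI linear_continuous_on) (simp add: linear_conv_bounded_linear)

lemma measurable_volume_if_borel: "f \<in> borel_measurable borel \<Longrightarrow> f \<in> borel_measurable (volume G)"
  by (subst measurable_cong_sets[OF sets_volume refl]) (rule measurable_restrict_space1)

lemma measurable_reflect_volume [measurable]:
  assumes "normal_form G h > 0"
  shows "reflect G h \<in> volume G \<rightarrow>\<^sub>M volume G"
proof -
  have "reflect G h \<in> restrict_space borel (model_space G) \<rightarrow>\<^sub>M restrict_space borel (model_space G)"
    using assms by (intro measurable_restrict_space3) (auto intro: reflect_in_model_space)
  then show ?thesis
    by (subst measurable_cong_sets[OF sets_volume sets_volume])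
qed

lemma normalize_in_model_space:
  assumes "0 < qform G z" "G \<noteq> Spherical \<longrightarrow> 0 < fst z"
  shows "z /\<^sub>R sqrt (qform G z) \<in> model_space G"
proof -
  have "qform G (t *\<^sub>R z) = t\<^sup>2 * qform G z" for t
    by (simp add: qform_def power2_eq_square algebra_simps)
  then have "qform G (z /\<^sub>R sqrt (qform G z)) = 1"
    using assms(1) by (simp add: power_inverse)
  then show ?thesis
    using assms by (simp add: model_space_curv)
qed

text \<open>
The reflection is linear and preserves Lebesgue measure, and it maps cones over sets to cones over
their images.
\<close>

lemma emeasure_volume_reflect:
  fixes A :: "'n::finite point set"
  assumes h: "normal_form G h > 0" and A: "A \<in> sets (volume G)"
  shows "emeasure (volume G) (reflect G h -` A \<inter> model_space G) = emeasure (volume G) A"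
proof -
  let ?B = "reflect G h -` A \<inter> model_space G"
  have B: "?B \<in> sets (volume G)"
    using measurable_sets[OF measurable_reflect_volume[OF h] A] by simp
  have A': "A \<in> sets borel" "A \<subseteq> model_space G"
    using A by (auto simp: sets_volume_iff)
  have R: "reflect G h (c *\<^sub>R z) = c *\<^sub>R reflect G h z" for c z
    using linear_reflect[of G h] by (simp add: linear_scale)
  have pos: "0 < fst (reflect G h z)" if "G \<noteq> Spherical" "0 < qform G z" "0 < fst z" for z
  proof -
    have "reflect G h (z /\<^sub>R sqrt (qform G z)) \<in> model_space G"
      using that by (intro reflect_in_model_space h normalize_in_model_space) auto
    then have "0 < fst (reflect G h z /\<^sub>R sqrt (qform G z))"
      using that by (simp add: model_space_curv R)
    then show ?thesis
      using that by (simp add: zero_less_divide_iff zero_less_mult_iff)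
  qed
  have "z \<in> solid_cone G ?B \<longleftrightarrow> reflect G h z \<in> solid_cone G A" for z
    using pos[of z] pos[of "reflect G h z"] normalize_in_model_space[of G z] h A'(2)
    by (auto simp: solid_cone_def qform_reflect reflect_reflect R)
  then have "solid_cone G ?B = reflect G h -` solid_cone G A"
    by auto
  then have "emeasure lborel (solid_cone G ?B)
      = emeasure (distr lborel borel (reflect G h)) (solid_cone G A)"
    using sets_solid_cone[OF A'(1)] by (subst emeasure_distr) auto
  then show ?thesis
    using emeasure_volume_solid_cone[OF A] emeasure_volume_solid_cone[OF B]
        by (simp add: distr_reflect[OF h])
qed

lemma distr_volume_reflect:
  assumes h: "normal_form G h > 0"
  shows "distr (volume G) (volume G) (reflect G h) = volume G"
  using h by (intro measure_eqI) (auto simp: emeasure_distr emeasure_volume_reflect)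

lemma nn_integral_volume_reflect:
  assumes "normal_form G h > 0" "f \<in> borel_measurable (volume G)"
  shows "(\<integral>\<^sup>+x. f (reflect G h x) \<partial>volume G) = (\<integral>\<^sup>+x. f x \<partial>volume G)"
proof -
  have "(\<integral>\<^sup>+x. f x \<partial>distr (volume G) (volume G) (reflect G h)) = (\<integral>\<^sup>+x. f (reflect G h x) \<partial>volume G)"
    using assms by (intro nn_integral_distr) auto
  then show ?thesis
    by (simp add: distr_volume_reflect[OF assms(1)])
qed

lemma AE_coordinate_neq: "AE u in lborel. u $ i \<noteq> (s :: real)" for i :: "'n::finite"
proof -
  have "negligible {u :: real ^ 'n. u $ i = s}"
    using negligible_standard_hyperplane[of "axis i 1 :: real ^ 'n" s]
    by (simp add: inner_axis axis_in_Basis_iff)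
  moreover have "{u :: real ^ 'n. u $ i = s} \<in> sets borel"
    by (intro borel_closed closed_Collect_eq continuous_intros)
  ultimately have "{u :: real ^ 'n. u $ i = s} \<in> null_sets lborel"
    by (simp add: negligible_iff_null_sets null_sets_def)
  from AE_not_in[OF this] show ?thesis by simp
qed

text \<open>
This shows that the volume has no atoms, and it provides a function with continuous distribution
for splitting sets into parts of prescribed measure.
\<close>

lemma null_sets_coordinate:
  "{x \<in> model_space G. snd x $ i = s} \<in> null_sets (volume G)" for i :: "'n::finite"
proof -
  let ?A = "{x \<in> model_space G. snd x $ i = s}"
  have "{x :: 'n point. snd x $ i = s} \<in> sets borel"
    by (intro borel_closed closed_Collect_eq continuous_intros)
  then have A: "?A \<in> sets (volume G)"
    using sets_model_space[of G] by (simp add: sets_volume_iff Collect_conj_eq)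
  have "(\<integral>\<^sup>+u\<in>chart_domain G. ennreal (1 / height G u) * indicator ?A (t * height G u, u) \<partial>lborel)
      = (\<integral>\<^sup>+u. 0 \<partial>(lborel :: (real ^ 'n) measure))" for t
    using AE_coordinate_neq[of i s] by (intro nn_integral_cong_AE) (auto elim!: eventually_mono simp:
        indicator_def)
  then show ?thesis
    using emeasure_volume[OF A] A by (simp add: null_sets_def)
qed

lemma null_sets_singleton: "x \<in> model_space G \<Longrightarrow> {x} \<in> null_sets (volume G)"
  by (rule null_sets_subset[OF null_sets_coordinate[of G undefined "snd x $ undefined"]])
    (auto simp: sets_volume_iff)

lemma bounded_solid_cone:
  assumes "bounded A"
  shows "bounded (solid_cone G A)"
proof -
  obtain R where R: "\<And>x. x \<in> A \<Longrightarrow> norm x \<le> R"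
    using assms by (auto simp: bounded_iff)
  have "norm z \<le> \<bar>R\<bar>" if z: "z \<in> solid_cone G A" for z
  proof -
    have q: "0 < qform G z" "qform G z \<le> 1" "z /\<^sub>R sqrt (qform G z) \<in> A"
      using z by (auto simp: solid_cone_def)
    have "norm z = sqrt (qform G z) * norm (z /\<^sub>R sqrt (qform G z))"
      using q by simp
    also have "\<dots> \<le> 1 * \<bar>R\<bar>"
      using q R[OF q(3)] by (intro mult_mono) auto
    finally show ?thesis by simp
  qed
  then show ?thesis
    by (intro boundedI[of _ "\<bar>R\<bar>"])
qed

lemma emeasure_volume_bounded:
  fixes A :: "'n::finite point set"
  assumes "A \<in> sets (volume G)" "bounded A"
  shows "emeasure (volume G) A < \<infinity>"
  using emeasure_volume_solid_cone[OF assms(1)] emeasure_bounded_finite[OF bounded_solid_cone[OF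
      assms(2), of G]]
  by (simp add: ennreal_mult_less_top)

lemma sets_volume_Int: "A \<in> sets borel \<Longrightarrow> A \<inter> model_space G \<in> sets (volume G)"
  using sets_model_space[of G] by (simp add: sets_volume_iff)

lemma sigma_finite_volume: "sigma_finite_measure (volume G :: 'n::finite point measure)"
proof
  define A where "A k = cball 0 (real k) \<inter> (model_space G :: 'n point set)" for k
  have "A k \<in> sets (volume G)" for k
    unfolding A_def by (intro sets_volume_Int) simp
  moreover have "emeasure (volume G) (A k) \<noteq> \<infinity>" for k
    using emeasure_volume_bounded[of "A k" G] calculation by (auto simp: A_def bounded_Int)
  moreover have "(\<Union>k. A k) = space (volume G)"
    by (auto simp: A_def real_arch_simple)
  ultimately show "\<exists>A. countable A \<and> A \<subseteq> sets (volume G) \<and> \<Union> A = space (volume G)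
      \<and> (\<forall>a\<in>A. emeasure (volume G :: 'n point measure) a \<noteq> \<infinity>)"
    by (intro exI[of _ "range A"]) auto
qed

interpretation volume: sigma_finite_measure "volume G :: 'n::finite point measure" for G
  by (rule sigma_finite_volume)

section \<open>Polarization\<close>

text \<open>
In each pair of mirror images of which exactly one belongs to \<open>E\<close>, the point on the side
\<open>0 \<le> h \<bullet> x\<close> is chosen.
\<close>

definition polarize :: "geometry \<Rightarrow> 'n::finite point \<Rightarrow> 'n point set \<Rightarrow> 'n point set" where
  "polarize G h E = {x \<in> model_space G.
     if 0 \<le> h \<bullet> x then x \<in> E \<or> reflect G h x \<in> E else x \<in> E \<and> reflect G h x \<in> E}"

lemma sets_polarize:
  assumes h: "normal_form G h > 0" and E: "E \<in> sets (volume G)"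
  shows "polarize G h E \<in> sets (volume G)"
proof -
  let ?R = "reflect G h -` E \<inter> model_space G"
  have R: "?R \<in> sets (volume G)"
    using measurable_sets[OF measurable_reflect_volume[OF h] E] by simp
  have "{x. 0 \<le> h \<bullet> x} \<in> sets borel"
    by (intro borel_closed closed_Collect_le continuous_intros)
  then have H: "{x. 0 \<le> h \<bullet> x} \<inter> model_space G \<in> sets (volume G)"
    by (rule sets_volume_Int)
  have "polarize G h E = ({x. 0 \<le> h \<bullet> x} \<inter> model_space G) \<inter> (E \<union> ?R)
      \<union> ((E \<inter> ?R) - {x. 0 \<le> h \<bullet> x} \<inter> model_space G)"
    using E by (auto simp: polarize_def sets_volume_iff)
  then show ?thesis
    using R H E by simp
qed

text \<open>
Reflections preserve the volume, so integrals may be compared after summing the integrands over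
each pair of mirror images.
\<close>

lemma nn_integral_le_symmetrized:
  assumes h: "normal_form G h > 0"
    and [measurable]: "f \<in> borel_measurable (volume G)" "g \<in> borel_measurable (volume G)"
    and le: "\<And>x. x \<in> model_space G \<Longrightarrow> f x + f (reflect G h x) \<le> g x + g (reflect G h x)"
  shows "(\<integral>\<^sup>+x. f x \<partial>volume G) \<le> (\<integral>\<^sup>+x. g x \<partial>volume G)"
proof -
  have two: "(\<integral>\<^sup>+x. u x + u (reflect G h x) \<partial>volume G) = 2 * (\<integral>\<^sup>+x. u x \<partial>volume G)"
    if [measurable]: "u \<in> borel_measurable (volume G)" for u
  proof -
    have "(\<lambda>x. u (reflect G h x)) \<in> borel_measurable (volume G)"
      using measurable_compose[OF measurable_reflect_volume[OF h] that] .
    then show ?thesis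
      using h that by (subst nn_integral_add) (auto simp: nn_integral_volume_reflect mult_2)
  qed
  have "2 * (\<integral>\<^sup>+x. f x \<partial>volume G) \<le> 2 * (\<integral>\<^sup>+x. g x \<partial>volume G)"
    unfolding two[symmetric, OF assms(2)] two[symmetric, OF assms(3)]
    by (intro nn_integral_mono le) auto
  then show ?thesis
    by (subst (asm) ennreal_mult_le_mult_iff) auto
qed

abbreviation "positive_side v \<equiv> {x. 0 < v \<bullet> x}"

lemma sets_positive_side: "E \<in> sets (volume G) \<Longrightarrow> E \<inter> positive_side v \<in> sets (volume G)"
proof -
  assume E: "E \<in> sets (volume G)"
  have "positive_side v \<in> sets borel"
    by (intro borel_open open_Collect_less continuous_intros)
  then show ?thesis
    using E by (auto simp: sets_volume_iff)
qed

lemma polarize_cases: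
  assumes h: "normal_form G h > 0" and x: "x \<in> model_space G"
  shows "0 < h \<bullet> x \<and> (x \<in> polarize G h E \<longleftrightarrow> x \<in> E \<or> reflect G h x \<in> E) \<and>
           (reflect G h x \<in> polarize G h E \<longleftrightarrow> x \<in> E \<and> reflect G h x \<in> E) \<or>
         h \<bullet> x < 0 \<and> (x \<in> polarize G h E \<longleftrightarrow> x \<in> E \<and> reflect G h x \<in> E) \<and>
           (reflect G h x \<in> polarize G h E \<longleftrightarrow> x \<in> E \<or> reflect G h x \<in> E) \<or>
         h \<bullet> x = 0 \<and> reflect G h x = x \<and> (x \<in> polarize G h E \<longleftrightarrow> x \<in> E)"
proof -
  have "reflect G h x = x" if "h \<bullet> x = 0"
    using that by (simp add: reflect_def)
  then show ?thesis
    using reflect_in_model_space[OF h x] x h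
    by (auto simp: polarize_def inner_normal_reflect reflect_reflect)
qed

lemma emeasure_polarize:
  assumes h: "normal_form G h > 0" and E: "E \<in> sets (volume G)"
  shows "emeasure (volume G) (polarize G h E) = emeasure (volume G) E"
proof -
  have eq: "(indicator (polarize G h E) x :: ennreal) + indicator (polarize G h E) (reflect G h x)
      = indicator E x + indicator E (reflect G h x)" if "x \<in> model_space G" for x
    using polarize_cases[OF h that, of E] by (auto simp: indicator_def)
  have "(\<integral>\<^sup>+x. indicator (polarize G h E) x \<partial>volume G) = (\<integral>\<^sup>+x. indicator E x \<partial>volume G)"
    using sets_polarize[OF h E] E eq by (intro antisym nn_integral_le_symmetrized[OF h]) auto
  then show ?thesis
    using sets_polarize[OF h E] E by simp
qed

lemma inner_reflect_order:
  assumes h: "normal_form G h > 0" and v: "0 \<le> sharp G h \<bullet> v"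
  shows "0 \<le> h \<bullet> x \<Longrightarrow> v \<bullet> reflect G h x \<le> v \<bullet> x" "h \<bullet> x \<le> 0 \<Longrightarrow> v \<bullet> x \<le> v \<bullet> reflect G h x"
proof -
  have "v \<bullet> x - v \<bullet> reflect G h x = 2 * (sharp G h \<bullet> v) / normal_form G h * (h \<bullet> x)"
    using inner_coreflect_diff[of v x G h] by (simp add: inner_reflect)
  moreover have "0 \<le> 2 * (sharp G h \<bullet> v) / normal_form G h"
    using h v by simp
  ultimately show "0 \<le> h \<bullet> x \<Longrightarrow> v \<bullet> reflect G h x \<le> v \<bullet> x" "h \<bullet> x \<le> 0 \<Longrightarrow> v \<bullet> x \<le> v \<bullet> reflect G h x"
    by (metis diff_ge_0_iff_ge mult_nonneg_nonneg, metis diff_le_0_iff_le mult_nonneg_nonpos)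
qed

text \<open>
By \<open>inner_coreflect_diff\<close> the values of \<open>v\<close> and of its mirror image at \<open>x\<close> differ by a nonnegative
multiple of \<open>h \<bullet> x\<close>. Hence, on the side \<open>0 \<le> h \<bullet> x\<close> to which polarization moves mass, the half-space
of \<open>v\<close> contains the one of its mirror image, and the opposite inclusion holds on the other side.
\<close>

lemma emeasure_polarize_positive_side:
  fixes E :: "'n::finite point set"
  assumes h: "normal_form G h > 0" and E: "E \<in> sets (volume G)" and v: "0 \<le> sharp G h \<bullet> v"
  shows "emeasure (volume G) (E \<inter> positive_side v)
      \<le> emeasure (volume G) (polarize G h E \<inter> positive_side v)" (is ?A)
    and "emeasure (volume G) (E \<inter> positive_side (coreflect G h v))
        \<le> emeasure (volume G) (polarize G h E \<inter> positive_side v)" (is ?B)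
    and "emeasure (volume G) (polarize G h E \<inter> positive_side v) + emeasure (volume G) (polarize G h E \<inter>
        positive_side (coreflect G h v))
      = emeasure (volume G) (E \<inter> positive_side v) + emeasure (volume G) (E \<inter> positive_side (coreflect G
          h v))" (is ?C)
proof -
  note [simp] = sets_positive_side[OF E] sets_positive_side[OF sets_polarize[OF h E]]
  have rr: "reflect G h (reflect G h x) = x" for x :: "'n point"
    using h by (rule reflect_reflect)
  have mono: "emeasure (volume G) A \<le> emeasure (volume G) B"
    if "A \<in> sets (volume G)" "B \<in> sets (volume G)"
      "\<And>x. x \<in> model_space G \<Longrightarrow> (indicator A x :: ennreal) + indicator A (reflect G h x)
          \<le> indicator B x + indicator B (reflect G h x)"
    for A B :: "'n point set"
    using nn_integral_le_symmetrized[OF h, of "indicator A" "indicator B"] that by simp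
  have ord: "(0 \<le> h \<bullet> x \<longrightarrow> 0 < v \<bullet> reflect G h x \<longrightarrow> 0 < v \<bullet> x) \<and> (h \<bullet> x
      \<le> 0 \<longrightarrow> 0 < v \<bullet> x \<longrightarrow> 0 < v \<bullet> reflect G h x)" for x
    using inner_reflect_order[OF h v, of x] by linarith
  show ?A
  proof (rule mono)
    fix x :: "'n point" assume x: "x \<in> model_space G"
    show "(indicator (E \<inter> positive_side v) x :: ennreal) + indicator (E \<inter> positive_side v) (reflect G h x)
       \<le> indicator (polarize G h E \<inter> positive_side v) x + indicator (polarize G h E \<inter> positive_side v)
           (reflect G h x)"
      using polarize_cases[OF h x, of E] ord[of x] by (auto simp: indicator_def)
  qed auto
  show ?B
  proof (rule mono)
    fix x :: "'n point" assume x: "x \<in> model_space G"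
    show "(indicator (E \<inter> positive_side (coreflect G h v)) x :: ennreal) + indicator (E \<inter> positive_side
        (coreflect G h v)) (reflect G h x)
       \<le> indicator (polarize G h E \<inter> positive_side v) x + indicator (polarize G h E \<inter> positive_side v)
           (reflect G h x)"
      using polarize_cases[OF h x, of E] ord[of x] by (auto simp: indicator_def inner_reflect[symmetric] rr)
  qed auto
  have sum: "emeasure (volume G) (A \<inter> positive_side v) + emeasure (volume G) (A \<inter> positive_side
      (coreflect G h v))
      = (\<integral>\<^sup>+x. indicator (A \<inter> positive_side v) x + indicator (A \<inter> positive_side (coreflect G h v)) x
          \<partial>volume G)"
    if "A \<in> sets (volume G)" for A :: "'n point set"
    using sets_positive_side[OF that] by (simp add: nn_integral_add)
  have eq: "(indicator (polarize G h E \<inter> positive_side v) x + indicator (polarize G h E \<inter> positive_side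
      (coreflect G h v)) x)
      + (indicator (polarize G h E \<inter> positive_side v) (reflect G h x) + indicator (polarize G h E \<inter>
          positive_side (coreflect G h v)) (reflect G h x))
      = ((indicator (E \<inter> positive_side v) x + indicator (E \<inter> positive_side (coreflect G h v)) x)
      + (indicator (E \<inter> positive_side v) (reflect G h x) + indicator (E \<inter> positive_side (coreflect G h
          v)) (reflect G h x)) :: ennreal)"
    if x: "x \<in> model_space G" for x :: "'n point"
    using polarize_cases[OF h x, of E] by (auto simp: indicator_def inner_reflect[symmetric] rr)
  have m: "(\<lambda>x. indicator (A \<inter> positive_side v) x + indicator (A \<inter> positive_side (coreflect G h v)) x ::
      ennreal)
      \<in> borel_measurable (volume G)" if "A \<in> sets (volume G)" for A :: "'n point set"
  proof -
    note [measurable] = sets_positive_side[OF that]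
    show ?thesis by measurable
  qed
  show ?C
    unfolding sum[OF E] sum[OF sets_polarize[OF h E]]
    using m[OF E] m[OF sets_polarize[OF h E]]
    by (intro antisym nn_integral_le_symmetrized[OF h]) (simp_all add: eq)
qed

text \<open>
For fixed sums, \<open>\<Prod>p\<^sub>i + \<Prod>q\<^sub>i\<close> is largest if the larger member of each pair stands in the same product
and the pairs are spread as far as possible. The induction has to carry along that \<open>\<Prod>p\<^sub>i\<close> bounds both
\<open>\<Prod>a\<^sub>i\<close> and \<open>\<Prod>b\<^sub>i\<close>.
\<close>

lemma prod_add_prod_le:
  fixes a b p q :: "'i \<Rightarrow> real"
  assumes "finite I"
    and "\<And>i. i \<in> I \<Longrightarrow> 0 \<le> a i" "\<And>i. i \<in> I \<Longrightarrow> 0 \<le> b i" "\<And>i. i \<in> I \<Longrightarrow> 0 \<le> q i"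
    and "\<And>i. i \<in> I \<Longrightarrow> a i \<le> p i" "\<And>i. i \<in> I \<Longrightarrow> b i \<le> p i"
    and "\<And>i. i \<in> I \<Longrightarrow> a i + b i \<le> p i + q i"
  shows "prod a I + prod b I \<le> prod p I + prod q I"
proof -
  have "prod a I \<le> prod p I \<and> prod b I \<le> prod p I \<and> prod a I + prod b I \<le> prod p I + prod q I
    \<and> 0 \<le> prod a I \<and> 0 \<le> prod b I \<and> 0 \<le> prod q I"
    using assms
  proof (induction I rule: finite_induct)
    case (insert i I)
    define A B P Q where "A = prod a I" "B = prod b I" "P = prod p I" "Q = prod q I"
    note d = A_B_P_Q_def
    have IH: "A \<le> P" "B \<le> P" "A + B \<le> P + Q" "0 \<le> A" "0 \<le> B" "0 \<le> Q"
      using insert.IH insert.prems unfolding d by (auto)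
    have i: "0 \<le> a i" "0 \<le> b i" "0 \<le> q i" "a i \<le> p i" "b i \<le> p i" "a i + b i \<le> p i + q i"
      using insert.prems by auto
    have main: "A * a i + B * b i \<le> P * p i + Q * q i"
    proof -
      have gen: "X * x + Y * y \<le> P * p i + Q * q i"
        if X: "Y \<le> X" "0 \<le> Y" "X \<le> P" "X + Y \<le> P + Q" and x: "x \<le> p i" "x + y \<le> p i + q i" "0 \<le> x" "0
            \<le> y" "y \<le> p i" for X Y x y
      proof (cases "q i \<le> p i")
        case True
        have "X * x + Y * y \<le> X * p i + Y * q i"
        proof -
          have "Y * (y - q i) \<le> Y * (p i - x)"
            using X x by (intro mult_left_mono) auto
          also have "\<dots> \<le> X * (p i - x)"
            using X x by (intro mult_right_mono) auto
          finally show ?thesis by (simp add: algebra_simps)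
        qed
        also have "\<dots> \<le> P * p i + Q * q i"
        proof -
          have "(Y - Q) * q i \<le> (P - X) * q i"
            using X i by (intro mult_right_mono) auto
          also have "\<dots> \<le> (P - X) * p i"
            using X True by (intro mult_left_mono) auto
          finally show ?thesis by (simp add: algebra_simps)
        qed
        finally show ?thesis .
      next
        case False
        have "X * x + Y * y \<le> X * p i + Y * p i"
          using X x by (intro add_mono mult_left_mono) auto
        also have "\<dots> \<le> (P + Q) * p i"
          using X x by (simp add: mult_right_mono flip: distrib_right)
        also have "\<dots> \<le> P * p i + Q * q i"
          using False IH by (simp add: distrib_right mult_left_mono)
        finally show ?thesis .
      qed
      show ?thesis
      proof (cases "B \<le> A")
        case True
        then show ?thesis using IH i by (intro gen) auto
      next
        case False
        then have "B * b i + A * a i \<le> P * p i + Q * q i"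
          using IH i by (intro gen) auto
        then show ?thesis by simp
      qed
    qed
    have "A * a i \<le> P * p i" "B * b i \<le> P * p i"
      using IH i by (auto intro!: mult_mono)
    then show ?case
      using main IH i insert.hyps by (simp add: d mult.commute)
  qed simp
  then show ?thesis by simp
qed

section \<open>The crossing energy decreases under polarization\<close>

text \<open>
Normals up to positive multiples are represented by the directions of the points of this set; Lebesgue
measure on it induces the invariant measure on hypersurfaces.
\<close>

definition unit_normals :: "geometry \<Rightarrow> 'n::finite point set" where
  "unit_normals G = {v. 0 < normal_form G v \<and> normal_form G v \<le> 1}"

lemma sets_unit_normals [measurable]: "unit_normals G \<in> sets borel"
  unfolding unit_normals_def by measurable

lemma measurable_volume_ident [measurable]: "(\<lambda>x. x) \<in> volume G \<rightarrow>\<^sub>M borel"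
  using measurable_volume_if_borel[of "\<lambda>x. x" G] by simp

lemma measurable_emeasure_positive_side [measurable]:
  fixes E :: "'n::finite point set"
  assumes E[measurable]: "E \<in> sets (volume G)"
  shows "(\<lambda>v. emeasure (volume G) (E \<inter> positive_side v)) \<in> borel_measurable borel"
proof -
  define Q where "Q = {z \<in> space (borel \<Otimes>\<^sub>M (volume G :: 'n point measure)). snd z \<in> E \<and> 0 < fst z \<bullet> snd z}"
  have [measurable]: "(\<lambda>z. snd z) \<in> (borel :: 'n point measure) \<Otimes>\<^sub>M volume G \<rightarrow>\<^sub>M borel"
    using measurable_compose[OF measurable_snd measurable_volume_ident] .
  have [measurable]: "(\<lambda>z. fst z \<bullet> snd z) \<in> borel_measurable ((borel :: 'n point measure) \<Otimes>\<^sub>M volume G)"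
    by (intro borel_measurable_inner) auto
  have "{z \<in> space (borel \<Otimes>\<^sub>M (volume G :: 'n point measure)). snd z \<in> E} \<in> sets ((borel :: 'n point
      measure) \<Otimes>\<^sub>M volume G)"
    by measurable
  moreover have "{z \<in> space (borel \<Otimes>\<^sub>M (volume G :: 'n point measure)). 0 < fst z \<bullet> snd z} \<in> sets
      ((borel :: 'n point measure) \<Otimes>\<^sub>M volume G)"
    by measurable
  ultimately have Q: "Q \<in> sets (borel \<Otimes>\<^sub>M volume G)"
    unfolding Q_def by (auto intro: sets.sets_Collect_conj)
  have "Pair v -` Q = E \<inter> positive_side v" for v
    using sets.sets_into_space[OF E] by (auto simp: Q_def space_pair_measure)
  then show ?thesis
    using volume.measurable_emeasure_Pair[OF Q] by simp
qed

lemma nn_integral_unit_normals_coreflect: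
  assumes h: "normal_form G h > 0" and [measurable]: "F \<in> borel_measurable borel"
  shows "(\<integral>\<^sup>+v\<in>unit_normals G. F (coreflect G h v) \<partial>lborel) = (\<integral>\<^sup>+v\<in>unit_normals G. F v \<partial>lborel)"
proof -
  have "(\<integral>\<^sup>+v\<in>unit_normals G. F v \<partial>lborel) = (\<integral>\<^sup>+v. F v * indicator (unit_normals G) v \<partial>distr lborel
      borel (coreflect G h))"
    by (simp add: distr_coreflect[OF h])
  also have "\<dots> = (\<integral>\<^sup>+v\<in>unit_normals G. F (coreflect G h v) \<partial>lborel)"
    by (subst nn_integral_distr) (auto simp: unit_normals_def normal_form_coreflect[OF h] indicator_def)
  finally show ?thesis ..
qed

abbreviation "mass G E \<equiv> measure (volume G) E"

text \<open>
The mass of the tuples in the product of the sets \<open>E i\<close> that are contained neither in the open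
half-space of \<open>v\<close> nor in that of \<open>- v\<close>.
\<close>

definition separation :: "geometry \<Rightarrow> 'i set \<Rightarrow> ('i \<Rightarrow> 'n::finite point set) \<Rightarrow> 'n point \<Rightarrow> real" where
  "separation G I E v = (\<Prod>i\<in>I. mass G (E i)) - (\<Prod>i\<in>I. mass G (E i \<inter> positive_side v))
     - (\<Prod>i\<in>I. mass G (E i \<inter> positive_side (- v)))"

definition crossing_energy :: "geometry \<Rightarrow> 'i set \<Rightarrow> ('i \<Rightarrow> 'n::finite point set) \<Rightarrow> ennreal" where
  "crossing_energy G I E = (\<integral>\<^sup>+v\<in>unit_normals G. ennreal (separation G I E v) \<partial>lborel)"

lemma measurable_separation:
  assumes "\<And>i. i \<in> I \<Longrightarrow> E i \<in> sets (volume G)"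
  shows "separation G I E \<in> borel_measurable borel"
proof -
  have [measurable]: "(\<lambda>v. mass G (E i \<inter> positive_side v)) \<in> borel_measurable borel" if "i \<in> I" for i
    using measurable_emeasure_positive_side[OF assms[OF that]] unfolding measure_def by measurable
  have "(\<lambda>v. mass G (E i \<inter> positive_side (- v))) \<in> borel_measurable borel" if "i \<in> I" for i
    using measurable_compose[OF _ \<open>i \<in> I \<Longrightarrow> (\<lambda>v. mass G (E i \<inter> positive_side v)) \<in> borel_measurable
        borel\<close>, of uminus borel] that
    by simp
  note [measurable] = this
  show ?thesis
    unfolding separation_def by measurable
qed

lemma mass_positive_side_add_le:
  assumes "E \<in> sets (volume G)" "emeasure (volume G) E < \<infinity>"
  shows "mass G (E \<inter> positive_side v) + mass G (E \<inter> positive_side (- v)) \<le> mass G E"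
proof -
  define A where "A = E \<inter> positive_side v"
  define B where "B = E \<inter> positive_side (- v)"
  have s: "A \<in> sets (volume G)" "B \<in> sets (volume G)"
    unfolding A_def B_def by (intro sets_positive_side assms(1))+
  have f: "emeasure (volume G) A \<noteq> \<infinity>" "emeasure (volume G) B \<noteq> \<infinity>"
    using emeasure_mono[of A E "volume G"] emeasure_mono[of B E "volume G"] assms
    by (auto simp: A_def B_def top_unique)
  have "mass G A + mass G B = mass G (A \<union> B)"
    using s f by (intro measure_Union[symmetric]) (auto simp: A_def B_def)
  also have "\<dots> \<le> mass G E"
    using s assms by (intro measure_mono_fmeasurable) (auto simp: A_def B_def fmeasurable_def)
  finally show ?thesis
    by (simp only: A_def B_def)
qed

text \<open>
The case \<open>q = 0\<close> of \<open>prod_add_prod_le\<close>. For empty \<open>I\<close> the separation is \<open>-1\<close>.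
\<close>

lemma separation_nonneg:
  assumes "finite I" "I \<noteq> {}"
    and E: "\<And>i. i \<in> I \<Longrightarrow> E i \<in> sets (volume G)" "\<And>i. i \<in> I \<Longrightarrow> emeasure (volume G) (E i) < \<infinity>"
  shows "0 \<le> separation G I E v"
proof -
  have le: "mass G (E i \<inter> positive_side v) + mass G (E i \<inter> positive_side (- v)) \<le> mass G (E i)" if
      "i \<in> I" for i
    using E[OF that] by (rule mass_positive_side_add_le)
  have le': "mass G (E i \<inter> positive_side u) \<le> mass G (E i)" if "i \<in> I" for i u
    using E[OF that] by (intro measure_mono_fmeasurable sets_positive_side) (auto simp: fmeasurable_def)
  have "(\<Prod>i\<in>I. mass G (E i \<inter> positive_side v)) + (\<Prod>i\<in>I. mass G (E i \<inter> positive_side (- v)))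
      \<le> (\<Prod>i\<in>I. mass G (E i)) + (\<Prod>i\<in>I. (0 :: real))"
    using assms(1) le le' le'[where u = "- v"] by (intro prod_add_prod_le) auto
  also have "(\<Prod>i\<in>I. (0 :: real)) = 0"
    using assms(1,2) by (simp add: card_gt_0_iff)
  finally show ?thesis
    by (simp add: separation_def)
qed

text \<open>
Exchanging \<open>v\<close> with its mirror image, one may assume that the half-space of \<open>v\<close> is the one that gains
mass; then it gains for all indices, as \<open>prod_add_prod_le\<close> requires.
\<close>

lemma prod_mass_polarize_le:
  assumes h: "normal_form G h > 0" and I: "finite I"
    and E: "\<And>i. i \<in> I \<Longrightarrow> E i \<in> sets (volume G)" "\<And>i. i \<in> I \<Longrightarrow> emeasure (volume G) (E i) < \<infinity>"
  shows "(\<Prod>i\<in>I. mass G (E i \<inter> positive_side v)) + (\<Prod>i\<in>I. mass G (E i \<inter> positive_side (coreflect G h v)))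
    \<le> (\<Prod>i\<in>I. mass G (polarize G h (E i) \<inter> positive_side v)) + (\<Prod>i\<in>I. mass G (polarize G h (E i) \<inter>
        positive_side (coreflect G h v)))"
proof -
  have pos: "(\<Prod>i\<in>I. mass G (E i \<inter> positive_side v)) + (\<Prod>i\<in>I. mass G (E i \<inter> positive_side (coreflect G h v)))
    \<le> (\<Prod>i\<in>I. mass G (polarize G h (E i) \<inter> positive_side v)) + (\<Prod>i\<in>I. mass G (polarize G h (E i) \<inter>
        positive_side (coreflect G h v)))"
    if v: "0 \<le> sharp G h \<bullet> v" for v
  proof (rule prod_add_prod_le[OF I])
    fix i assume i: "i \<in> I"
    note Ei = E(1)[OF i] and Pi = sets_polarize[OF h E(1)[OF i]]
    have fin: "emeasure (volume G) (E i \<inter> positive_side u) < \<infinity>"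
        "emeasure (volume G) (polarize G h (E i) \<inter> positive_side u) < \<infinity>" for u
      using E(2)[OF i] emeasure_polarize[OF h Ei] 
        emeasure_mono[of "E i \<inter> positive_side u" "E i" "volume G"]
        emeasure_mono[of "polarize G h (E i) \<inter> positive_side u" "polarize G h (E i)" "volume G"] Ei Pi
      by (auto simp: le_less_trans)
    have em: "emeasure (volume G) (E i \<inter> positive_side u) = ennreal (mass G (E i \<inter> positive_side u))"
      "emeasure (volume G) (polarize G h (E i) \<inter> positive_side u)
          = ennreal (mass G (polarize G h (E i) \<inter> positive_side u))" for u
      using fin[of u] by (simp_all add: emeasure_eq_ennreal_measure)
    note * = emeasure_polarize_positive_side[OF h Ei v, unfolded em]
    show "mass G (E i \<inter> positive_side v) \<le> mass G (polarize G h (E i) \<inter> positive_side v)"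
      using *(1) by simp
    show "mass G (E i \<inter> positive_side (coreflect G h v)) \<le> mass G (polarize G h (E i) \<inter> positive_side v)"
      using *(2) by simp
    show "mass G (E i \<inter> positive_side v) + mass G (E i \<inter> positive_side (coreflect G h v))
      \<le> mass G (polarize G h (E i) \<inter> positive_side v) + mass G (polarize G h (E i) \<inter> positive_side
          (coreflect G h v))"
      using *(3) by (simp flip: ennreal_plus)
  qed auto
  show ?thesis
  proof (cases "0 \<le> sharp G h \<bullet> v")
    case False
    have "sharp G h \<bullet> coreflect G h v = - (sharp G h \<bullet> v)"
      using h by (rule inner_sharp_coreflect)
    then show ?thesis
      using pos[of "coreflect G h v"] False by (simp add: coreflect_coreflect[OF h] add.commute)
  qed (rule pos)
qed

text \<open>
Reflections preserve the measure on normals, so the energy is half the integral of the sum of the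
separations of \<open>v\<close> and of its mirror image, and this sum decreases for each \<open>v\<close>.
\<close>

lemma crossing_energy_polarize:
  assumes h: "normal_form G h > 0" and I: "finite I" "I \<noteq> {}"
    and E: "\<And>i. i \<in> I \<Longrightarrow> E i \<in> sets (volume G)" "\<And>i. i \<in> I \<Longrightarrow> emeasure (volume G) (E i) < \<infinity>"
  shows "crossing_energy G I (\<lambda>i. polarize G h (E i)) \<le> crossing_energy G I E"
proof -
  let ?E' = "\<lambda>i. polarize G h (E i)"
  have E': "?E' i \<in> sets (volume G)" "emeasure (volume G) (?E' i) < \<infinity>" "mass G (?E' i) = mass G (E i)"
      if "i \<in> I" for i
    using sets_polarize[OF h E(1)[OF that]] emeasure_polarize[OF h E(1)[OF that]] E(2)[OF that]
    by (auto simp: measure_def)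
  have two: "2 * crossing_energy G I F = (\<integral>\<^sup>+v\<in>unit_normals G. ennreal (separation G I F v + separation
      G I F (coreflect G h v)) \<partial>lborel)"
    if F: "\<And>i. i \<in> I \<Longrightarrow> F i \<in> sets (volume G)" "\<And>i. i \<in> I \<Longrightarrow> emeasure (volume G) (F i) < \<infinity>" for F
  proof -
    note [measurable] = measurable_separation[OF F(1)]
    have "2 * crossing_energy G I F = crossing_energy G I F + (\<integral>\<^sup>+v\<in>unit_normals G. ennreal (separation
        G I F (coreflect G h v)) \<partial>lborel)"
      using nn_integral_unit_normals_coreflect[OF h, of "\<lambda>v. ennreal (separation G I F v)"]
      by (simp add: crossing_energy_def mult_2)
    also have "\<dots> = (\<integral>\<^sup>+v\<in>unit_normals G. ennreal (separation G I F v + separation G I F (coreflect G h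
        v)) \<partial>lborel)"
      unfolding crossing_energy_def
      by (subst nn_integral_add[symmetric]) (auto intro!: nn_integral_cong simp: separation_nonneg[OF I
          F] indicator_def)
    finally show ?thesis .
  qed
  have minus: "coreflect G h (- v) = - coreflect G h v" for v
    using linear_coreflect[of G h] by (simp add: linear_neg)
  have t: "2 * crossing_energy G I E = (\<integral>\<^sup>+v\<in>unit_normals G. ennreal (separation G I E v + separation G
      I E (coreflect G h v)) \<partial>lborel)"
    using E by (intro two)
  have t': "2 * crossing_energy G I ?E' = (\<integral>\<^sup>+v\<in>unit_normals G. ennreal (separation G I ?E' v +
      separation G I ?E' (coreflect G h v)) \<partial>lborel)"
    using E' by (intro two)
  have le: "(\<Prod>i\<in>I. mass G (E i \<inter> positive_side v)) + (\<Prod>i\<in>I. mass G (E i \<inter> positive_side (coreflect G h v)))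
    \<le> (\<Prod>i\<in>I. mass G (?E' i \<inter> positive_side v)) + (\<Prod>i\<in>I. mass G (?E' i \<inter> positive_side (coreflect G h
        v)))" for v
    using E by (intro prod_mass_polarize_le[OF h I(1)])
  have "2 * crossing_energy G I ?E' \<le> 2 * crossing_energy G I E"
    unfolding t t'
  proof (intro nn_integral_mono mult_right_mono ennreal_leI)
    fix v
    have m: "(\<Prod>i\<in>I. mass G (?E' i)) = (\<Prod>i\<in>I. mass G (E i))"
      using E'(3) by (intro prod.cong) auto
    show "separation G I ?E' v + separation G I ?E' (coreflect G h v)
        \<le> separation G I E v + separation G I E (coreflect G h v)"
      using le[of v] le[of "- v"]
      unfolding separation_def m minus by linarith
  qed auto
  then show ?thesis
    by (subst (asm) ennreal_mult_le_mult_iff) auto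
qed

section \<open>The density of a random mirror image\<close>

text \<open>
The reversed Cauchy-Schwarz inequality for unit timelike vectors.
\<close>

lemma hyperbolic_pairing:
  assumes "x \<in> model_space Hyperbolic" "y \<in> model_space Hyperbolic"
  shows "1 + snd x \<bullet> snd y \<le> fst x * fst y" "x \<noteq> y \<Longrightarrow> 1 + snd x \<bullet> snd y < fst x * fst y"
proof -
  have x: "0 < fst x" "(fst x)\<^sup>2 = 1 + snd x \<bullet> snd x" and y: "0 < fst y" "(fst y)\<^sup>2 = 1 + snd y \<bullet> snd y"
    using assms by (auto simp: model_space_curv qform_def)
  have nn: "0 \<le> (snd x - snd y) \<bullet> (snd x - snd y)"
    by simp
  have "(fst x * fst y)\<^sup>2 = (1 + snd x \<bullet> snd x) * (1 + snd y \<bullet> snd y)"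
    by (simp add: power_mult_distrib x(2) y(2))
  also have "\<dots> = 1 + (snd x - snd y) \<bullet> (snd x
      - snd y) + 2 * (snd x \<bullet> snd y) + (snd x \<bullet> snd x) * (snd y \<bullet> snd y)"
    by (simp add: inner_diff_left inner_diff_right inner_commute algebra_simps)
  finally have eq: "(fst x * fst y)\<^sup>2 - (1 + snd x \<bullet> snd y)\<^sup>2 =
      (snd x - snd y) \<bullet> (snd x - snd y) + ((snd x \<bullet> snd x) * (snd y \<bullet> snd y) - (snd x \<bullet> snd y)\<^sup>2)"
    by (simp add: power2_eq_square algebra_simps)
  have cs: "(snd x \<bullet> snd y)\<^sup>2 \<le> (snd x \<bullet> snd x) * (snd y \<bullet> snd y)"
    by (rule Cauchy_Schwarz_ineq)
  have "(1 + snd x \<bullet> snd y)\<^sup>2 \<le> (fst x * fst y)\<^sup>2"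
    using eq nn cs by linarith
  then show "1 + snd x \<bullet> snd y \<le> fst x * fst y"
    by (rule power2_le_imp_le) (use x y in simp)
  assume "x \<noteq> y"
  have "snd x \<noteq> snd y"
  proof
    assume "snd x = snd y"
    then have "fst x = fst y"
      using x y by (metis power2_eq_iff_nonneg less_imp_le)
    with \<open>snd x = snd y\<close> \<open>x \<noteq> y\<close> show False
      by (simp add: prod_eq_iff)
  qed
  then have "0 < (snd x - snd y) \<bullet> (snd x - snd y)"
    by simp
  then have "(1 + snd x \<bullet> snd y)\<^sup>2 < (fst x * fst y)\<^sup>2"
    using eq cs by linarith
  then show "1 + snd x \<bullet> snd y < fst x * fst y"
    by (rule power2_less_imp_less) (use x y in simp)
qed

lemma normal_form_diff_pos:
  assumes x: "x \<in> model_space G" and y: "y \<in> model_space G" and "x \<noteq> y"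
  shows "0 < normal_form G (x - y)"
proof (cases G)
  case Hyperbolic
  have "normal_form G (x - y) = 2 * (fst x * fst y - snd x \<bullet> snd y) - 2"
    using x y Hyperbolic
    by (simp add: normal_form_curv model_space_curv qform_def inner_diff_left inner_diff_right
        inner_commute power2_eq_square algebra_simps)
  then show ?thesis
    using hyperbolic_pairing(2)[of x y] assms Hyperbolic by simp
next
  case Euclidean
  then have "fst x = fst y"
    using x y by (auto simp: model_space_curv qform_def power2_eq_1_iff)
  then have "snd x \<noteq> snd y"
    using \<open>x \<noteq> y\<close> by (auto simp: prod_eq_iff)
  then show ?thesis
    using Euclidean by simp
qed (use assms in simp)

text \<open>
The normal is dual to \<open>x - y\<close>, up to a factor that is free and is used to prescribe the value of the
normal form. In the Euclidean case the offset is determined by the midpoint.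
\<close>

lemma exists_swapping_normal:
  assumes x: "x \<in> model_space G" and y: "y \<in> model_space G" and "x \<noteq> y" and t: "0 < t"
  obtains h where "normal_form G h = t" "reflect G h x = y"
proof -
  obtain g where g: "sharp G g = x - y" "g \<bullet> (x + y) = 0" "normal_form G g = normal_form G (x - y)"
  proof (cases "G = Euclidean")
    case True
    define g where "g = (- (snd x \<bullet> snd x - snd y \<bullet> snd y) / 2, snd x - snd y)"
    have "fst x = 1" "fst y = 1"
      using x y True by (auto simp: model_space_curv qform_def power2_eq_1_iff)
    then have "sharp G g = x - y" "g \<bullet> (x + y) = 0" "normal_form G g = normal_form G (x - y)"
      using True by (auto simp: g_def sharp_def inner_prod_def prod_eq_iff inner_diff_left inner_diff_right
          inner_add_right inner_commute field_simps)
    then show ?thesis by (rule that)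
  next
    case False
    then have k: "curv G * curv G = 1"
      by (cases G) auto
    define g where "g = (curv G * (fst x - fst y), snd x - snd y)"
    have "curv G * (qform G x - qform G y) = 0"
      using x y by (simp add: model_space_curv)
    then have "curv G * ((fst x)\<^sup>2 - (fst y)\<^sup>2) + (curv G * curv G) * (snd x \<bullet> snd x - snd y \<bullet> snd y) = 0"
      by (simp add: qform_def algebra_simps)
    then have "g \<bullet> (x + y) = 0"
      unfolding k by (simp add: g_def inner_prod_def inner_diff_left inner_add_right inner_commute
          power2_eq_square algebra_simps)
    moreover have "sharp G g = x - y"
      using k by (simp add: g_def sharp_def prod_eq_iff flip: mult.assoc)
    moreover have "normal_form G g = normal_form G (x - y)"
      using False by (cases G) (auto simp: g_def normal_form_curv power2_commute)
    ultimately show ?thesis using that by blast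
  qed
  have pos: "0 < normal_form G g"
    using normal_form_diff_pos[OF x y \<open>x \<noteq> y\<close>] g(3) by simp
  have "2 * (g \<bullet> x) = g \<bullet> (x - y) + g \<bullet> (x + y)"
    by (simp add: inner_diff_right inner_add_right)
  also have "\<dots> = normal_form G g"
    using g(1,2) inner_sharp[of g G] by simp
  finally have gx: "2 * (g \<bullet> x) = normal_form G g" .
  define c where "c = sqrt (t / normal_form G g)"
  have c: "c\<^sup>2 * normal_form G g = t" "c \<noteq> 0"
    using t pos by (auto simp: c_def)
  have nf: "normal_form G (c *\<^sub>R g) = t"
    unfolding c(1)[symmetric] by (simp add: normal_form_curv power2_eq_square algebra_simps)
  have "reflect G (c *\<^sub>R g) x = x - (2 * (c * (g \<bullet> x)) / t * c) *\<^sub>R sharp G g"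
    by (simp add: reflect_def nf) (simp add: sharp_def algebra_simps)
  also have "2 * (c * (g \<bullet> x)) / t * c = 2 * (g \<bullet> x) * c\<^sup>2 / t"
    by (simp add: power2_eq_square)
  also have "\<dots> = 1"
    unfolding gx using c(1) t by (simp add: mult.commute)
  finally have "reflect G (c *\<^sub>R g) x = y"
    by (simp add: g(1))
  with nf show ?thesis by (rule that)
qed

text \<open>
The hypersurface contains the midpoint \<open>m\<close> of \<open>x\<close> and its mirror image, and the normal form of \<open>h\<close> is
at most \<open>1\<close>; the equation \<open>h \<bullet> m = 0\<close> then bounds \<open>fst h\<close>.
\<close>

lemma norm_normal_le:
  assumes x: "x \<in> model_space G" "norm x \<le> R" and h: "h \<in> unit_normals G"
    and y: "norm (reflect G h x) \<le> R"
  shows "norm h \<le> 1 + 2 * R"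
proof -
  define y where "y = reflect G h x"
  have nf: "0 < normal_form G h" "normal_form G h \<le> 1"
    using h by (auto simp: unit_normals_def)
  have yM: "y \<in> model_space G"
    unfolding y_def by (rule reflect_in_model_space[OF nf(1) x(1)])
  have R: "0 \<le> R"
    using x(2) norm_ge_zero order_trans by blast
  define m where "m = (1/2) *\<^sub>R (x + y)"
  have hm: "h \<bullet> m = 0"
    using inner_normal_reflect[OF nf(1), of x] by (simp add: m_def y_def inner_add_right)
  have "norm (x + y) \<le> R + R"
    using x(2) y unfolding y_def by (intro norm_triangle_mono)
  then have "norm m \<le> R"
    by (simp add: m_def)
  then have m2: "(fst m)\<^sup>2 + snd m \<bullet> snd m \<le> R\<^sup>2"
  proof -
    have "(norm m)\<^sup>2 = (fst m)\<^sup>2 + snd m \<bullet> snd m"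
      by (simp add: norm_prod_def power2_norm_eq_inner)
    then show ?thesis
      using power_mono[OF \<open>norm m \<le> R\<close>, of 2] by simp
  qed
  have "fst h * fst m = - (snd h \<bullet> snd m)"
    using hm by (simp add: inner_prod_def)
  then have "(fst h)\<^sup>2 * (fst m)\<^sup>2 = (snd h \<bullet> snd m)\<^sup>2"
    by (metis power2_minus power_mult_distrib)
  also have "\<dots> \<le> (snd h \<bullet> snd h) * (snd m \<bullet> snd m)"
    by (rule Cauchy_Schwarz_ineq)
  finally have cs: "(fst h)\<^sup>2 * (fst m)\<^sup>2 \<le> (snd h \<bullet> snd h) * (snd m \<bullet> snd m)" .
  have "(fst h)\<^sup>2 + snd h \<bullet> snd h \<le> 1 + 2 * R\<^sup>2"
  proof (cases G)
    case Spherical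
    then show ?thesis
      using nf(2) by (simp add: normal_form_curv del: normal_form.simps) (smt (verit) zero_le_power2)
  next
    case Euclidean
    then have "fst m = 1"
      using x(1) yM by (auto simp: model_space_curv qform_def power2_eq_1_iff m_def)
    moreover have "snd h \<bullet> snd h \<le> 1"
      using nf(2) Euclidean by simp
    then have "(snd h \<bullet> snd h) * (snd m \<bullet> snd m) \<le> 1 * (snd m \<bullet> snd m)"
      by (intro mult_right_mono) auto
    ultimately show ?thesis
      using cs m2 \<open>snd h \<bullet> snd h \<le> 1\<close> zero_le_power2[of R] inner_ge_zero[of "snd m"] by (simp, linarith)
  next
    case Hyperbolic
    define a where "a = (fst h)\<^sup>2"
    define b where "b = (fst m)\<^sup>2"
    have "1 + snd x \<bullet> snd y \<le> fst x * fst y"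
      using hyperbolic_pairing(1) x(1) yM Hyperbolic by blast
    moreover have "(fst x)\<^sup>2 = 1 + snd x \<bullet> snd x" "(fst y)\<^sup>2 = 1 + snd y \<bullet> snd y"
      using x(1) yM Hyperbolic by (auto simp: model_space_curv qform_def)
    moreover have "4 * b = (fst x)\<^sup>2 + (fst y)\<^sup>2 + 2 * (fst x * fst y)"
      by (simp add: b_def m_def power2_eq_square algebra_simps)
    moreover have "4 * (snd m \<bullet> snd m) = snd x \<bullet> snd x + snd y \<bullet> snd y + 2 * (snd x \<bullet> snd y)"
      by (simp add: m_def inner_add_left inner_add_right inner_commute algebra_simps)
    ultimately have m1: "snd m \<bullet> snd m \<le> b - 1"
      by linarith
    have q: "snd h \<bullet> snd h \<le> 1 + a"
      using nf(2) Hyperbolic unfolding normal_form_curv a_def by simp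
    have "a * b \<le> (1 + a) * (b - 1)"
      using cs q m1 by (smt (verit, ccfv_SIG) a_def b_def inner_ge_zero mult_mono)
    then have "a \<le> b - 1"
      by (simp add: algebra_simps)
    moreover have "b \<le> R\<^sup>2"
      using m2 inner_ge_zero[of "snd m"] unfolding b_def by linarith
    ultimately show ?thesis
      using q unfolding a_def by linarith
  qed
  then have "(norm h)\<^sup>2 \<le> 1 + 2 * R\<^sup>2"
    by (simp add: norm_prod_def power2_norm_eq_inner)
  also have "\<dots> \<le> (1 + 2 * R)\<^sup>2"
    using R by (simp add: power2_eq_square algebra_simps)
  finally show ?thesis
    by (rule power2_le_imp_le) (use R in simp)
qed

lemma measurable_sharp [measurable]: "sharp G \<in> borel_measurable borel"
  unfolding sharp_def by (intro borel_measurable_continuous_onI continuous_intros)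

lemma measurable_reflect_normal: "(\<lambda>h. reflect G h x) \<in> borel_measurable borel"
  unfolding reflect_def by measurable

lemma norm_sharp_le: "norm (sharp G h) \<le> norm h"
proof -
  have "(curv G * fst h)\<^sup>2 \<le> (fst h)\<^sup>2"
    by (cases G) auto
  then show ?thesis
    by (simp add: sharp_def norm_prod_def)
qed

lemma linear_sharp: "linear (sharp G)"
  by (rule linearI) (auto simp: sharp_def algebra_simps)

text \<open>
For fixed \<open>x\<close>, the quadratic map \<open>h \<mapsto> normal_form h * reflect h x\<close> takes the normals that move \<open>x\<close>
into \<open>A\<close> onto the cone over \<open>A\<close>, except possibly the ray through \<open>x\<close>: the ray is determined by the
mirror image and the position on it by the normal form. Its derivative is bounded on bounded sets.
\<close>

lemma emeasure_volume_le_normals: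
  fixes x :: "'n::finite point"
  assumes x: "x \<in> model_space G" "norm x \<le> R" and A: "A \<in> sets (volume G)" "\<And>y. y \<in> A \<Longrightarrow> norm y \<le> R"
  shows "emeasure (volume G) A \<le> ennreal (real (Suc CARD('n)) * (fact (Suc CARD('n)) * (6 * (1 + 2 * R)
      * R) ^ Suc CARD('n)))
    * emeasure lborel {h \<in> unit_normals G. norm h \<le> 1 + 2 * R \<and> reflect G h x \<in> A}"
proof -
  define S where "S = {h \<in> unit_normals G. norm h \<le> 1 + 2 * R \<and> reflect G h x \<in> A}"
  define Psi where "Psi h = normal_form G h *\<^sub>R x - (2 * (h \<bullet> x)) *\<^sub>R sharp G h" for h
  define Psi' where "Psi' h \<eta> = (2 * (sharp G h \<bullet> \<eta>)) *\<^sub>R x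
      - ((2 * (\<eta> \<bullet> x)) *\<^sub>R sharp G h + (2 * (h \<bullet> x)) *\<^sub>R sharp G \<eta>)" for h \<eta>
  have R: "0 \<le> R"
    using x(2) norm_ge_zero order_trans by blast
  have bl: "bounded_linear (sharp G :: 'n point \<Rightarrow> _)"
    using linear_sharp by (simp add: linear_conv_bounded_linear)
  have A': "A - {x} \<in> sets (volume G)" "A \<in> sets borel"
    using A(1) by (auto simp: sets_volume_iff)
  have S: "S \<in> sets borel"
  proof -
    have "(\<lambda>h. reflect G h x) -` A \<inter> space borel \<in> sets borel"
      by (rule measurable_sets[OF measurable_reflect_normal A'(2)])
    moreover have "S = unit_normals G \<inter> cball 0 (1 + 2 * R) \<inter> ((\<lambda>h. reflect G h x) -` A \<inter> space borel)"
      by (auto simp: S_def)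
    ultimately show ?thesis by simp
  qed
  have sub: "solid_cone G (A - {x}) \<subseteq> Psi ` S"
  proof
    fix z assume z: "z \<in> solid_cone G (A - {x})"
    define t where "t = sqrt (qform G z)"
    define y where "y = z /\<^sub>R t"
    have t: "0 < t" "t \<le> 1"
      using z by (auto simp: solid_cone_def t_def)
    have y: "y \<in> A" "y \<noteq> x"
      using z by (auto simp: solid_cone_def t_def y_def)
    then have "y \<in> model_space G"
      using A(1) by (auto simp: sets_volume_iff)
    then obtain h where h: "normal_form G h = t" "reflect G h x = y"
      using exists_swapping_normal[OF x(1) _ _ t(1)] y(2) by metis
    have u: "h \<in> unit_normals G"
      using h(1) t by (simp add: unit_normals_def)
    have "norm h \<le> 1 + 2 * R"
      using norm_normal_le[OF x u] h(2) A(2)[OF y(1)] by simp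
    then have "h \<in> S"
      using u h(2) y(1) by (simp add: S_def)
    moreover have "Psi h = t *\<^sub>R reflect G h x"
      using t h(1) by (simp add: Psi_def reflect_def scaleR_diff_right)
    then have "Psi h = z"
      using t by (simp add: h(2) y_def)
    ultimately show "z \<in> Psi ` S" by blast
  qed
  have der: "(Psi has_derivative Psi' h) (at h)" for h
  proof -
    have d: "((\<lambda>h. h \<bullet> sharp G h) has_derivative (\<lambda>\<eta>. h \<bullet> sharp G \<eta> + \<eta> \<bullet> sharp G h)) (at h)"
      by (rule has_derivative_inner[OF has_derivative_ident bounded_linear_imp_has_derivative[OF bl]])
    have sym: "h \<bullet> sharp G \<eta> + \<eta> \<bullet> sharp G h = 2 * (sharp G h \<bullet> \<eta>)" for \<eta>
      by (simp add: sharp_def inner_prod_def inner_commute)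
    have ds: "(sharp G has_derivative sharp G) (at h)"
      using bl by (rule bounded_linear_imp_has_derivative)
    have d2: "((\<lambda>h. 2 * (h \<bullet> x)) has_derivative (\<lambda>\<eta>. 2 * (\<eta> \<bullet> x))) (at h)"
      by (intro bounded_linear_imp_has_derivative bounded_linear_const_mult bounded_linear_inner_left)
    show ?thesis
      unfolding Psi_def Psi'_def inner_sharp[symmetric]
      using has_derivative_diff[OF has_derivative_scaleR_left[OF d, of x] has_derivative_scaleR[OF d2 ds]]
      by (simp only: sym) (simp add: algebra_simps)
  qed
  have cont: "continuous_on UNIV (\<lambda>h. Psi' h \<eta>)" for \<eta>
    unfolding Psi'_def by (intro continuous_intros bounded_linear.continuous_on[OF bl])
  have bnd: "norm (Psi' h \<eta>) \<le> 6 * (1 + 2 * R) * R * norm \<eta>" if "h \<in> S" for h \<eta>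
  proof -
    have h: "norm h \<le> 1 + 2 * R"
      using that by (simp add: S_def)
    define B where "B = (1 + 2 * R) * R * norm \<eta>"
    have 1: "norm ((2 * (sharp G h \<bullet> \<eta>)) *\<^sub>R x) \<le> 2 * B"
    proof -
      have "\<bar>sharp G h \<bullet> \<eta>\<bar> * norm x \<le> ((1 + 2 * R) * norm \<eta>) * R"
        using Cauchy_Schwarz_ineq2[of "sharp G h" \<eta>] norm_sharp_le[of G h] h x(2) R
        by (intro mult_mono order_trans[OF Cauchy_Schwarz_ineq2] mult_right_mono) auto
      then show ?thesis by (simp add: B_def abs_mult algebra_simps)
    qed
    have 2: "norm ((2 * (\<eta> \<bullet> x)) *\<^sub>R sharp G h) \<le> 2 * B"
    proof -
      have "\<bar>\<eta> \<bullet> x\<bar> * norm (sharp G h) \<le> (norm \<eta> * R) * (1 + 2 * R)"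
        using norm_sharp_le[of G h] h x(2) R
        by (intro mult_mono order_trans[OF Cauchy_Schwarz_ineq2] mult_left_mono) auto
      then show ?thesis by (simp add: B_def abs_mult algebra_simps)
    qed
    have 3: "norm ((2 * (h \<bullet> x)) *\<^sub>R sharp G \<eta>) \<le> 2 * B"
    proof -
      have "\<bar>h \<bullet> x\<bar> * norm (sharp G \<eta>) \<le> ((1 + 2 * R) * R) * norm \<eta>"
        using norm_sharp_le[of G \<eta>] h x(2) R
        by (intro mult_mono order_trans[OF Cauchy_Schwarz_ineq2]) auto
      then show ?thesis by (simp add: B_def abs_mult algebra_simps)
    qed
    have "norm (Psi' h \<eta>) \<le> 2 * B + (2 * B + 2 * B)"
      unfolding Psi'_def by (intro order_trans[OF norm_triangle_ineq4] add_mono order_trans[OF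
          norm_triangle_ineq] 1 2 3)
    then show ?thesis by (simp add: B_def algebra_simps)
  qed
  have bS: "bounded S"
    by (rule bounded_subset[OF bounded_cball[of 0 "1 + 2 * R"]]) (auto simp: S_def)
  have mC: "solid_cone G (A - {x}) \<in> sets borel"
    using A' by (intro sets_solid_cone) simp
  have "emeasure lborel (solid_cone G (A - {x})) \<le>
      ennreal (fact (Suc CARD('n)) * (6 * (1 + 2 * R) * R) ^ Suc CARD('n)) * emeasure lborel S"
    by (rule emeasure_le_differentiable_image[OF S bS mC sub der cont bnd])
  then have "ennreal (real (Suc CARD('n))) * emeasure lborel (solid_cone G (A - {x})) \<le>
      ennreal (real (Suc CARD('n))) * (ennreal (fact (Suc CARD('n)) * (6 * (1 + 2 * R) * R) ^ Suc
          CARD('n)) * emeasure lborel S)"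
    by (rule mult_left_mono) simp
  also have "\<dots> = ennreal (real (Suc CARD('n)) * (fact (Suc CARD('n)) * (6 * (1 + 2 * R) * R) ^ Suc
      CARD('n))) * emeasure lborel S"
    using R by (subst ennreal_mult[of "real (Suc CARD('n))"]) (auto simp: mult.assoc)
  also have "ennreal (real (Suc CARD('n))) * emeasure lborel (solid_cone G (A - {x}))
      = emeasure (volume G) (A - {x})"
    by (rule emeasure_volume_solid_cone[OF A'(1), symmetric])
  also have "\<dots> = emeasure (volume G) A"
    using A(1) null_sets_singleton[OF x(1)] by (rule emeasure_Diff_null_set[rotated])
  finally show ?thesis
    unfolding S_def .
qed

section \<open>Reflections that overlap two given sets\<close>

text \<open>
By \<open>emeasure_volume_le_normals\<close> and Fubini, the integral over bounded normals \<open>h\<close> of the measure of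
the part of \<open>A'\<close> that \<open>h\<close> reflects into \<open>A\<close> is at least a constant times the product of the two
measures. Since the set \<open>H\<close> of these normals has finite measure, one of them is as good as the
average.
\<close>

lemma exists_reflection_overlap:
  fixes R \<epsilon> :: real
  assumes "0 < \<epsilon>"
  obtains \<delta> where "0 < \<delta>"
    "\<And>A A' :: 'n::finite point set. \<lbrakk>A \<in> sets (volume G); A' \<in> sets (volume G);
       \<And>x. x \<in> A \<union> A' \<Longrightarrow> norm x \<le> R; ennreal \<epsilon> \<le> emeasure (volume G) A; ennreal \<epsilon> \<le> emeasure (volume G) A'\<rbrakk>
     \<Longrightarrow> \<exists>h. 0 < normal_form G h \<and> ennreal \<delta> \<le> emeasure (volume G) {x \<in> A'. reflect G h x \<in> A}"
proof -
  define H where "H = unit_normals G \<inter> cball (0 :: 'n point) (1 + 2 * R)"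
  define L where "L = measure lborel H"
  define C where "C = \<bar>real (Suc CARD('n)) * (fact (Suc CARD('n)) * (6 * (1 + 2 * R) * R) ^ Suc CARD('n))\<bar>"
  define \<delta> where "\<delta> = \<epsilon>\<^sup>2 / (2 * (C + 1) * (L + 1))"
  have [measurable]: "H \<in> sets borel"
    by (simp add: H_def)
  have C: "0 \<le> C" and L: "0 \<le> L"
    by (simp_all add: C_def L_def)
  have "bounded H"
    by (rule bounded_subset[OF bounded_cball]) (auto simp: H_def)
  then have HL: "emeasure lborel H = ennreal L"
    unfolding L_def using emeasure_bounded_finite[of H] by (intro emeasure_eq_ennreal_measure) auto
  show ?thesis
  proof (rule that)
    show \<delta>: "0 < \<delta>"
      using assms C L by (simp add: \<delta>_def add_nonneg_pos)
    fix A A' :: "'n point set"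
    assume A: "A \<in> sets (volume G)" and A': "A' \<in> sets (volume G)"
      and R: "\<And>x. x \<in> A \<union> A' \<Longrightarrow> norm x \<le> R"
      and eA: "ennreal \<epsilon> \<le> emeasure (volume G) A" and eA': "ennreal \<epsilon> \<le> emeasure (volume G) A'"
    show "\<exists>h. 0 < normal_form G h \<and> ennreal \<delta> \<le> emeasure (volume G) {x \<in> A'. reflect G h x \<in> A}"
    proof (rule ccontr)
      assume none: "\<not> (\<exists>h. 0 < normal_form G h \<and> ennreal \<delta>
          \<le> emeasure (volume G) {x \<in> A'. reflect G h x \<in> A})"
      have small: "emeasure (volume G) {x \<in> A'. reflect G h x \<in> A} \<le> ennreal \<delta>" if "h \<in> H" for h
      proof -
        have "0 < normal_form G h"
          using that by (simp add: H_def unit_normals_def)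
        with none have "\<not> ennreal \<delta> \<le> emeasure (volume G) {x \<in> A'. reflect G h x \<in> A}"
          by blast
        then show ?thesis by simp
      qed
      interpret V: pair_sigma_finite "volume G :: 'n point measure" "lborel :: 'n point measure" ..
      have [measurable]: "A \<in> sets borel" "A' \<in> sets borel"
        using A A' by (auto simp: sets_volume_iff)
      have snd_m: "(\<lambda>z. fst z) \<in> volume G \<Otimes>\<^sub>M (lborel :: 'n point measure) \<rightarrow>\<^sub>M borel"
        using measurable_compose[OF measurable_fst measurable_volume_ident] .
      have fst_m: "(\<lambda>z. snd z) \<in> (volume G :: 'n point measure) \<Otimes>\<^sub>M (lborel :: 'n point measure) \<rightarrow>\<^sub>M borel"
        by simp
      have refl_m: "(\<lambda>z. reflect G (snd z) (fst z)) \<in> volume G \<Otimes>\<^sub>M (lborel :: 'n point measure) \<rightarrow>\<^sub>M borel"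
        unfolding reflect_def
        by (intro borel_measurable_diff borel_measurable_scaleR borel_measurable_divide
            borel_measurable_times
            borel_measurable_inner snd_m fst_m measurable_compose[OF fst_m measurable_sharp] 
            measurable_compose[OF fst_m normal_form_measurable]) simp_all
      define K where "K x h = (indicator A' x * indicator H h * indicator A (reflect G h x) :: ennreal)"
          for x h
      have K: "case_prod K \<in> borel_measurable (volume G \<Otimes>\<^sub>M lborel)"
        unfolding K_def split_beta
        by (intro borel_measurable_times_ennreal measurable_compose[OF snd_m] measurable_compose[OF
            fst_m] measurable_compose[OF refl_m] borel_measurable_indicator) simp_all
      have inner1: "ennreal C * (\<integral>\<^sup>+h. K x h \<partial>lborel) \<ge> emeasure (volume G) A * indicator A' x" if
          "x \<in> model_space G" for x
      proof (cases "x \<in> A'")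
        case True
        let ?S = "{h \<in> unit_normals G. norm h \<le> 1 + 2 * R \<and> reflect G h x \<in> A}"
        have S: "?S = H \<inter> ((\<lambda>h. reflect G h x) -` A \<inter> space borel)"
          by (auto simp: H_def)
        have [measurable]: "?S \<in> sets borel"
          unfolding S by (intro sets.Int measurable_sets[OF measurable_reflect_normal]) simp_all
        have "(\<integral>\<^sup>+h. K x h \<partial>lborel) = (\<integral>\<^sup>+h. indicator ?S h \<partial>lborel)"
          using True unfolding S by (intro nn_integral_cong) (auto simp: K_def indicator_def)
        then have "(\<integral>\<^sup>+h. K x h \<partial>lborel) = emeasure lborel ?S"
          by simp
        moreover have "emeasure (volume G) A \<le> ennreal C * emeasure lborel ?S"
          using True R by (intro order_trans[OF emeasure_volume_le_normals[OF that _ A, of R]]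
              mult_right_mono ennreal_leI)
            (auto simp: C_def)
        ultimately show ?thesis
          using True by simp
      qed simp
      have inner2: "(\<integral>\<^sup>+x. K x h \<partial>volume G) \<le> ennreal \<delta> * indicator H h" for h
      proof (cases "h \<in> H")
        case True
        have "0 < normal_form G h"
          using True by (auto simp: H_def unit_normals_def)
        note m = measurable_sets[OF measurable_reflect_volume[OF this] A]
        have "{x \<in> A'. reflect G h x \<in> A} = A' \<inter> (reflect G h -` A \<inter> space (volume G))"
          using A' by (auto simp: sets_volume_iff)
        then have S: "{x \<in> A'. reflect G h x \<in> A} \<in> sets (volume G)"
          using m A' by simp
        have "(\<integral>\<^sup>+x. K x h \<partial>volume G) = (\<integral>\<^sup>+x. indicator {x \<in> A'. reflect G h x \<in> A} x \<partial>volume G)"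
          using True by (intro nn_integral_cong) (auto simp: K_def indicator_def)
        then show ?thesis
          using S small[OF True] True by simp
      qed (simp add: K_def)
      have "(\<integral>\<^sup>+x. \<integral>\<^sup>+h. K x h \<partial>lborel \<partial>volume G) = (\<integral>\<^sup>+h. \<integral>\<^sup>+x. K x h \<partial>volume G \<partial>lborel)"
        using V.Fubini'[OF K] by simp
      also have "\<dots> \<le> (\<integral>\<^sup>+h. ennreal \<delta> * indicator H h \<partial>lborel)"
        by (intro nn_integral_mono inner2)
      also have "\<dots> = ennreal \<delta> * ennreal L"
        by (simp add: nn_integral_cmult_indicator HL)
      finally have total: "(\<integral>\<^sup>+x. \<integral>\<^sup>+h. K x h \<partial>lborel \<partial>volume G) \<le> ennreal \<delta> * ennreal L" .
      have "ennreal (\<epsilon>\<^sup>2) = ennreal \<epsilon> * ennreal \<epsilon>"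
        using assms by (simp add: power2_eq_square ennreal_mult)
      also have "\<dots> \<le> emeasure (volume G) A * emeasure (volume G) A'"
        by (intro mult_mono eA eA') auto
      also have "\<dots> = (\<integral>\<^sup>+x. emeasure (volume G) A * indicator A' x \<partial>volume G)"
        using A' by (simp add: nn_integral_cmult_indicator)
      also have "\<dots> \<le> (\<integral>\<^sup>+x. ennreal C * (\<integral>\<^sup>+h. K x h \<partial>lborel) \<partial>volume G)"
        by (intro nn_integral_mono inner1) simp
      also have "\<dots> = ennreal C * (\<integral>\<^sup>+x. \<integral>\<^sup>+h. K x h \<partial>lborel \<partial>volume G)"
        using K by (intro nn_integral_cmult lborel.borel_measurable_nn_integral) 
      also have "\<dots> \<le> ennreal C * (ennreal \<delta> * ennreal L)"
        by (intro mult_left_mono total) simp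
      also have "ennreal C * (ennreal \<delta> * ennreal L) = ennreal (C * (\<delta> * L))"
        using C L \<delta> by (simp add: ennreal_mult)
      finally have "\<epsilon>\<^sup>2 \<le> C * (\<delta> * L)"
        using C L \<delta> by (subst (asm) ennreal_le_iff) auto
      also have "\<dots> \<le> (C + 1) * (\<delta> * (L + 1))"
        using C L \<delta> by (intro mult_mono) auto
      also have "\<dots> = \<epsilon>\<^sup>2 / 2"
        using C L by (simp add: \<delta>_def divide_simps)
      finally show False
        using assms by simp
    qed
  qed
qed

text \<open>
In the hyperbolic case, \<open>lorentz x c \<ge> fst x * (fst c - norm (snd c))\<close>, and the last factor is
positive because \<open>c\<close> lies above the light cone.
\<close>

lemma bounded_normal_form_ball:
  assumes c: "c \<in> model_space G"
  obtains R where "\<And>x. x \<in> model_space G \<Longrightarrow> normal_form G (x - c) \<le> \<rho> \<Longrightarrow> norm x \<le> R"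
proof (cases G)
  case Spherical
  then have "norm x = 1" if "x \<in> model_space G" for x :: "'a point"
    using that by (simp add: norm_eq_sqrt_inner model_space.simps)
  then show ?thesis by (intro that[of 1]) simp
next
  case Euclidean
  show ?thesis
  proof (rule that[of "sqrt \<rho> + norm c"])
    fix x :: "'a point" assume x: "x \<in> model_space G" "normal_form G (x - c) \<le> \<rho>"
    have "fst x = fst c"
      using x(1) c Euclidean by (auto simp: model_space_curv qform_def power2_eq_1_iff)
    then have "norm (x - c) = sqrt (normal_form G (x - c))"
      using Euclidean by (simp add: norm_prod_def norm_eq_sqrt_inner)
    also have "\<dots> \<le> sqrt \<rho>"
      using x(2) by simp
    finally show "norm x \<le> sqrt \<rho> + norm c"
      using norm_triangle_ineq[of "x - c" c] by simp
  qed
next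
  case Hyperbolic
  have c': "0 < fst c" "(fst c)\<^sup>2 = 1 + (norm (snd c))\<^sup>2"
    using c Hyperbolic by (auto simp: model_space_curv qform_def power2_norm_eq_inner)
  then have "(norm (snd c))\<^sup>2 < (fst c)\<^sup>2"
    by simp
  then have gap: "0 < fst c - norm (snd c)"
    using power2_less_imp_less[of "norm (snd c)" "fst c"] c'(1) by simp
  show ?thesis
  proof (rule that[of "2 * ((1 + \<rho> / 2) / (fst c - norm (snd c)))"])
    fix x :: "'a point" assume x: "x \<in> model_space G" "normal_form G (x - c) \<le> \<rho>"
    have x': "0 < fst x" "(fst x)\<^sup>2 = 1 + (norm (snd x))\<^sup>2"
      using x(1) Hyperbolic by (auto simp: model_space_curv qform_def power2_norm_eq_inner)
    have le: "norm (snd x) \<le> fst x"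
      by (rule power2_le_imp_le) (use x' in auto)
    have "normal_form G (x - c) = 2 * (fst x * fst c - snd x \<bullet> snd c) - 2"
      using x' c' Hyperbolic
      by (simp add: normal_form_curv inner_diff_left inner_diff_right inner_commute
          power2_norm_eq_inner) (simp add: power2_eq_square algebra_simps)
    then have "fst x * fst c - snd x \<bullet> snd c \<le> 1 + \<rho> / 2"
      using x(2) by simp
    moreover have "snd x \<bullet> snd c \<le> norm (snd x) * norm (snd c)"
      by (rule norm_cauchy_schwarz)
    moreover have "norm (snd x) * norm (snd c) \<le> fst x * norm (snd c)"
      using le by (intro mult_right_mono) auto
    ultimately have "fst x * (fst c - norm (snd c)) \<le> 1 + \<rho> / 2"
      by (simp add: algebra_simps)
    then have "fst x \<le> (1 + \<rho> / 2) / (fst c - norm (snd c))"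
      using gap by (simp add: pos_le_divide_eq)
    moreover have "norm x \<le> fst x + norm (snd x)"
      using norm_Pair_le[of "fst x" "snd x"] x'(1) by simp
    ultimately show "norm x \<le> 2 * ((1 + \<rho> / 2) / (fst c - norm (snd c)))"
      using le by linarith
  qed
qed

text \<open>
A set that contains with each of its points all points of the model that are at most as far from
\<open>c\<close>: an open or closed ball, or everything.
\<close>

definition centred :: "geometry \<Rightarrow> 'n::finite point \<Rightarrow> 'n point set \<Rightarrow> bool" where
  "centred G c B \<longleftrightarrow> (\<forall>x\<in>model_space G. \<forall>y\<in>B. normal_form G (x - c) \<le> normal_form G (y - c) \<longrightarrow> x \<in> B)"

text \<open>
If \<open>c\<close> lies on the side \<open>0 \<le> h \<bullet> x\<close>, then \<open>x \<in> B\<close> follows from \<open>reflect G h x \<in> B\<close> for \<open>x\<close> on that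
side. A pair of mirror images contributes differently to \<open>E - B\<close> and to \<open>polarize G h E - B\<close> only if
polarization moves its member in \<open>E - B\<close> into \<open>B - E\<close>, and then it ceases to contribute.
\<close>

lemma emeasure_polarize_Diff:
  fixes E :: "'n::finite point set"
  assumes h: "0 < normal_form G h" and c: "c \<in> model_space G" "0 \<le> h \<bullet> c"
    and B: "B \<in> sets (volume G)" "centred G c B" and E: "E \<in> sets (volume G)"
  shows "emeasure (volume G) (polarize G h E - B) + emeasure (volume G) {x \<in> E - B. reflect G h x \<in> B - E}
    \<le> emeasure (volume G) (E - B)"
proof -
  let ?O = "{x \<in> E - B. reflect G h x \<in> B - E}"
  note P = sets_polarize[OF h E]
  have "?O = (E - B) \<inter> (reflect G h -` (B - E) \<inter> space (volume G))"
    using E by (auto simp: sets_volume_iff)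
  then have O: "?O \<in> sets (volume G)"
    using measurable_sets[OF measurable_reflect_volume[OF h], of "B - E"] B(1) E by simp
  have "emeasure (volume G) (polarize G h E - B) + emeasure (volume G) ?O
      = (\<integral>\<^sup>+x. indicator (polarize G h E - B) x + indicator ?O x \<partial>volume G)"
    using P O B(1) by (subst nn_integral_add) auto
  also have "\<dots> \<le> (\<integral>\<^sup>+x. indicator (E - B) x \<partial>volume G)"
  proof (rule nn_integral_le_symmetrized[OF h])
    note [measurable] = P O B(1) E
    show "(\<lambda>x. indicator (polarize G h E - B) x + indicator ?O x :: ennreal) \<in> borel_measurable (volume G)"
      by measurable
    show "(indicator (E - B) :: _ \<Rightarrow> ennreal) \<in> borel_measurable (volume G)"
      by measurable
    fix x :: "'n point" assume x: "x \<in> model_space G"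
    have r: "reflect G h x \<in> model_space G" "reflect G h (reflect G h x) = x"
      using reflect_in_model_space[OF h x] reflect_reflect[OF h] by auto
    have d: "normal_form G (reflect G h x - c) - normal_form G (x - c)
        = 4 * (h \<bullet> x) * (h \<bullet> c) / normal_form G h"
      by (rule normal_form_reflect_diff[OF h x c(1)])
    have "0 < h \<bullet> x \<longrightarrow> reflect G h x \<in> B \<longrightarrow> x \<in> B"
    proof (intro impI)
      assume a: "0 < h \<bullet> x" "reflect G h x \<in> B"
      then have "0 \<le> 4 * (h \<bullet> x) * (h \<bullet> c) / normal_form G h"
        using h c(2) by simp
      then show "x \<in> B"
        using d B(2) x a(2) unfolding centred_def by fastforce
    qed
    moreover have "h \<bullet> x < 0 \<longrightarrow> x \<in> B \<longrightarrow> reflect G h x \<in> B"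
    proof (intro impI)
      assume a: "h \<bullet> x < 0" "x \<in> B"
      then have "4 * (h \<bullet> x) * (h \<bullet> c) / normal_form G h \<le> 0"
        using h c(2) by (simp add: divide_nonpos_pos mult_nonpos_nonneg)
      then show "reflect G h x \<in> B"
        using d B(2) r(1) a(2) unfolding centred_def by fastforce
    qed
    ultimately show "(indicator (polarize G h E - B) x + indicator ?O x) +
        (indicator (polarize G h E - B) (reflect G h x) + indicator ?O (reflect G h x))
      \<le> (indicator (E - B) x + indicator (E - B) (reflect G h x) :: ennreal)"
      using polarize_cases[OF h x, of E] r by (auto simp: indicator_def)
  qed
  finally show ?thesis
    using B(1) E by simp
qed

section \<open>Iterated polarization\<close>

lemma reflect_minus: "reflect G (- h) = reflect G h"
  by (rule ext) (simp add: reflect_def sharp_def normal_form_curv del: normal_form.simps)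

lemma normal_form_minus: "normal_form G (- h) = normal_form G h"
  by (simp add: normal_form_curv)

definition normal_form_ball :: "geometry \<Rightarrow> 'n::finite point \<Rightarrow> real \<Rightarrow> 'n point set" where
  "normal_form_ball G c \<rho> = {x \<in> model_space G. normal_form G (x - c) \<le> \<rho>}"

lemma sets_normal_form_ball: "normal_form_ball G c \<rho> \<in> sets (volume G)"
proof -
  have "(\<lambda>x. normal_form G (x - c)) \<in> borel_measurable borel"
    using measurable_compose[OF borel_measurable_diff normal_form_measurable, of "\<lambda>x. x" borel "\<lambda>_. c"
        G] by simp
  then have "{x. normal_form G (x - c) \<le> \<rho>} \<in> sets borel"
    by (simp add: borel_measurable_iff_le)
  then show ?thesis
    using sets_volume_Int[of "{x. normal_form G (x - c) \<le> \<rho>}" G]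
    by (simp add: normal_form_ball_def Int_def conj_commute)
qed

lemma centred_normal_form_ball: "centred G c (normal_form_ball G c \<rho>)"
  by (auto simp: centred_def normal_form_ball_def)

lemma tail_normal_form_ball:
  assumes E: "E \<in> sets (volume G)" "emeasure (volume G) E < \<infinity>" and "0 < \<epsilon>"
  shows "\<forall>\<^sub>F k in sequentially. emeasure (volume G) (E - normal_form_ball G c (real k)) < ennreal \<epsilon>"
proof -
  let ?A = "\<lambda>k. E - normal_form_ball G c (real k)"
  have "(\<Inter>k. ?A k) = {}"
    using E(1) by (auto simp: normal_form_ball_def sets_volume_iff real_arch_simple)
  moreover have "(\<lambda>k. emeasure (volume G) (?A k)) \<longlonglongrightarrow> emeasure (volume G) (\<Inter>k. ?A k)"
  proof (rule Lim_emeasure_decseq)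
    show "range ?A \<subseteq> sets (volume G)"
      using sets.Diff[OF E(1) sets_normal_form_ball] by blast
    show "decseq ?A"
      by (auto simp: decseq_def normal_form_ball_def)
    show "emeasure (volume G) (?A k) \<noteq> \<infinity>" for k
      using E emeasure_mono[of "?A k" E "volume G"] by (auto simp: top_unique)
  qed
  ultimately have "(\<lambda>k. emeasure (volume G) (?A k)) \<longlonglongrightarrow> 0"
    by (simp only: emeasure_empty)
  then show ?thesis
    using assms(3) by (intro order_tendstoD(2)) auto
qed

lemma mass_Diff_swap:
  assumes "E \<in> sets (volume G)" "B \<in> sets (volume G)" "emeasure (volume G) B < \<infinity>"
    "emeasure (volume G) E = emeasure (volume G) B"
  shows "mass G (B - E) = mass G (E - B)"
proof -
  have "mass G (E - E \<inter> B) = mass G E - mass G (E \<inter> B)" "mass G (B - B \<inter> E) = mass G B - mass G (B \<inter> E)"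
    using assms by (intro measure_Diff; auto)+
  moreover have "E - E \<inter> B = E - B" "B - B \<inter> E = B - E"
    by auto
  ultimately have "mass G (E - B) = mass G E - mass G (E \<inter> B)" "mass G (B - E) = mass G B - mass G (B \<inter> E)"
    by simp_all
  then show ?thesis
    using assms(4) by (simp add: measure_def Int_commute)
qed

text \<open>
The properties of \<open>F\<close> that survive polarizations starting from \<open>E\<close>. The bound on the mass outside of
balls around \<open>c\<close> keeps mass from escaping to infinity.
\<close>

definition rearrangement_below :: "geometry \<Rightarrow> 'i set \<Rightarrow> 'n::finite point \<Rightarrow> ('i \<Rightarrow> 'n point set) \<Rightarrow> ('i \<Rightarrow> 'n
    point set) \<Rightarrow> bool" where
  "rearrangement_below G I c E F \<longleftrightarrow> (\<forall>i\<in>I. F i \<in> sets (volume G) \<and> emeasure (volume G) (F i)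
      = emeasure (volume G) (E i)
     \<and> (\<forall>\<rho>. emeasure (volume G) (F i - normal_form_ball G c \<rho>) \<le> emeasure (volume G) (E i
         - normal_form_ball G c \<rho>)))
     \<and> crossing_energy G I F \<le> crossing_energy G I E"

lemma rearrangement_below_polarize:
  assumes F: "rearrangement_below G I c E F" and I: "finite I" "I \<noteq> {}" and c: "c \<in> model_space G"
    and h: "0 < normal_form G h" "0 \<le> h \<bullet> c"
    and E: "\<And>i. i \<in> I \<Longrightarrow> emeasure (volume G) (E i) < \<infinity>"
  shows "rearrangement_below G I c E (\<lambda>i. polarize G h (F i))"
proof -
  have Fi: "F i \<in> sets (volume G)" "emeasure (volume G) (F i) = emeasure (volume G) (E i)"
    "emeasure (volume G) (F i - normal_form_ball G c \<rho>) \<le> emeasure (volume G) (E i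
        - normal_form_ball G c \<rho>)" if "i \<in> I" for i \<rho>
    using F that by (auto simp: rearrangement_below_def)
  have "emeasure (volume G) (polarize G h (F i) - normal_form_ball G c \<rho>) \<le> emeasure (volume G) (E i
      - normal_form_ball G c \<rho>)"
    if "i \<in> I" for i \<rho>
  proof -
    have "emeasure (volume G) (polarize G h (F i) - normal_form_ball G c \<rho>) \<le>
      emeasure (volume G) (polarize G h (F i) - normal_form_ball G c \<rho>)
        + emeasure (volume G) {x \<in> F i - normal_form_ball G c \<rho>. reflect G h x \<in> normal_form_ball G c \<rho>
            - F i}"
      by simp
    also have "\<dots> \<le> emeasure (volume G) (F i - normal_form_ball G c \<rho>)"
      by (rule emeasure_polarize_Diff[OF h(1) c h(2) sets_normal_form_ball centred_normal_form_ball
          Fi(1)[OF that]])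
    also have "\<dots> \<le> emeasure (volume G) (E i - normal_form_ball G c \<rho>)"
      by (rule Fi(3)[OF that])
    finally show ?thesis .
  qed
  moreover have "crossing_energy G I (\<lambda>i. polarize G h (F i)) \<le> crossing_energy G I F"
    using Fi E by (intro crossing_energy_polarize h(1) I) auto
  ultimately show ?thesis
    using F Fi sets_polarize[OF h(1)] emeasure_polarize[OF h(1)] by (auto simp: rearrangement_below_def)
qed

text \<open>
Up to a small error, which is the same for all admissible \<open>F\<close>, the sets \<open>F i - B i\<close> and \<open>B i - F i\<close>
lie in one bounded ball. There \<open>exists_reflection_overlap\<close> provides a \<open>\<delta>\<close> that depends on \<open>\<eta>\<close> but not
on \<open>F\<close>.
\<close>

lemma discrepancy_step:
  fixes E B :: "'i \<Rightarrow> 'n::finite point set"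
  assumes I: "finite I" "I \<noteq> {}" and c: "c \<in> model_space G"
    and E: "\<And>i. i \<in> I \<Longrightarrow> E i \<in> sets (volume G)"
    and B: "\<And>i. i \<in> I \<Longrightarrow> B i \<in> sets (volume G)" "\<And>i. i \<in> I \<Longrightarrow> centred G c (B i)"
    and eq: "\<And>i. i \<in> I \<Longrightarrow> emeasure (volume G) (E i) = emeasure (volume G) (B i)"
    and fin: "\<And>i. i \<in> I \<Longrightarrow> emeasure (volume G) (B i) < \<infinity>" and \<eta>: "0 < \<eta>"
  obtains \<delta> where "0 < \<delta>" "\<And>F. rearrangement_below G I c E F \<Longrightarrow> \<eta> \<le> (\<Sum>i\<in>I. mass G (F i - B i)) \<Longrightarrow>
     \<exists>F'. rearrangement_below G I c E F' \<and> (\<Sum>i\<in>I. mass G (F' i - B i)) + \<delta> \<le> (\<Sum>i\<in>I. mass G (F i - B i))"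
proof -
  \<comment> \<open>some \<open>F j - B j\<close> has mass at least \<open>2 * \<epsilon>\<close>, of which at most \<open>\<epsilon>\<close> is lost outside of the ball\<close>
  define \<epsilon> where "\<epsilon> = \<eta> / (2 * card I)"
  have cI: "0 < card I"
    using I by (simp add: card_gt_0_iff)
  then have \<epsilon>: "0 < \<epsilon>"
    using \<eta> by (simp add: \<epsilon>_def)
  have "\<forall>\<^sub>F k in sequentially. \<forall>i\<in>I. emeasure (volume G) (E i - normal_form_ball G c (real k)) < ennreal \<epsilon> \<and>
     emeasure (volume G) (B i - normal_form_ball G c (real k)) < ennreal \<epsilon>"
  proof (intro eventually_ball_finite I(1) ballI)
    fix i assume i: "i \<in> I"
    have fE: "emeasure (volume G) (E i) < \<infinity>"
      using eq[OF i] fin[OF i] by simp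
    show "\<forall>\<^sub>F k in sequentially. emeasure (volume G) (E i - normal_form_ball G c (real k)) < ennreal \<epsilon> \<and>
        emeasure (volume G) (B i - normal_form_ball G c (real k)) < ennreal \<epsilon>"
      by (rule eventually_conj[OF tail_normal_form_ball[OF E[OF i] fE \<epsilon>] tail_normal_form_ball[OF
          B(1)[OF i] fin[OF i] \<epsilon>]])
  qed
  from eventually_happens'[OF sequentially_bot this]
  obtain k where "\<forall>i\<in>I. emeasure (volume G) (E i - normal_form_ball G c (real k)) < ennreal \<epsilon> \<and>
     emeasure (volume G) (B i - normal_form_ball G c (real k)) < ennreal \<epsilon>" ..
  then have k: "emeasure (volume G) (E i - normal_form_ball G c (real k)) < ennreal \<epsilon>"
    "emeasure (volume G) (B i - normal_form_ball G c (real k)) < ennreal \<epsilon>" if "i \<in> I" for i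
    using that by blast+
  let ?D = "normal_form_ball G c (real k)"
  obtain R where R: "\<And>x. x \<in> ?D \<Longrightarrow> norm x \<le> R"
  proof (rule bounded_normal_form_ball[OF c, of "real k"])
    fix R assume R: "\<And>x. x \<in> model_space G \<Longrightarrow> normal_form G (x - c) \<le> real k \<Longrightarrow> norm x \<le> R"
    show thesis
      by (rule that[of R]) (simp add: normal_form_ball_def R)
  qed
  obtain \<delta> where \<delta>: "0 < \<delta>"
    "\<And>A A' :: 'n point set. \<lbrakk>A \<in> sets (volume G); A' \<in> sets (volume G);
       \<And>x. x \<in> A \<union> A' \<Longrightarrow> norm x \<le> R; ennreal \<epsilon> \<le> emeasure (volume G) A; ennreal \<epsilon> \<le> emeasure (volume G) A'\<rbrakk>
     \<Longrightarrow> \<exists>h. 0 < normal_form G h \<and> ennreal \<delta> \<le> emeasure (volume G) {x \<in> A'. reflect G h x \<in> A}"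
  proof (rule exists_reflection_overlap[OF \<epsilon>, of G R])
    fix \<delta>
    assume pos: "0 < \<delta>" and overlap: "\<And>A A' :: 'n point set. \<lbrakk>A \<in> sets (volume G); A' \<in> sets (volume G);
       \<And>x. x \<in> A \<union> A' \<Longrightarrow> norm x \<le> R; ennreal \<epsilon> \<le> emeasure (volume G) A; ennreal \<epsilon> \<le> emeasure (volume G) A'\<rbrakk>
     \<Longrightarrow> \<exists>h. 0 < normal_form G h \<and> ennreal \<delta> \<le> emeasure (volume G) {x \<in> A'. reflect G h x \<in> A}"
    show thesis
      by (rule that[OF pos overlap])
  qed
  show ?thesis
  proof (rule that[OF \<delta>(1)])
    fix F assume F: "rearrangement_below G I c E F" and large: "\<eta> \<le> (\<Sum>i\<in>I. mass G (F i - B i))"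
    have Fi: "F i \<in> sets (volume G)" "emeasure (volume G) (F i) = emeasure (volume G) (B i)"
      "emeasure (volume G) (F i - ?D) \<le> emeasure (volume G) (E i - ?D)" if "i \<in> I" for i
      using F that eq by (auto simp: rearrangement_below_def)
    have fin': "emeasure (volume G) (F i - X) \<noteq> \<infinity>" "emeasure (volume G) (B i - X) \<noteq> \<infinity>" if "i \<in> I" for i X
      using emeasure_mono[of "F i - X" "F i" "volume G"] emeasure_mono[of "B i - X" "B i" "volume G"]
        Fi[OF that] fin[OF that] B(1)[OF that] by (auto simp: top_unique)
    have "\<exists>i\<in>I. 2 * \<epsilon> \<le> mass G (F i - B i)"
    proof (rule ccontr)
      assume "\<not> ?thesis"
      then have "(\<Sum>i\<in>I. mass G (F i - B i)) < (\<Sum>i\<in>I. 2 * \<epsilon>)"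
        using I by (intro sum_strict_mono) auto
      also have "\<dots> = \<eta>"
        using cI by (simp add: \<epsilon>_def)
      finally show False using large by simp
    qed
    then obtain j where j: "j \<in> I" "2 * \<epsilon> \<le> mass G (F j - B j)" by blast
    have split: "ennreal \<epsilon> \<le> emeasure (volume G) ((X - Y) \<inter> ?D)"
      if X: "X \<in> sets (volume G)" "Y \<in> sets (volume G)" and fX: "emeasure (volume G) (X - Y) \<noteq> \<infinity>"
        and m: "2 * \<epsilon> \<le> mass G (X - Y)" and t: "emeasure (volume G) (X - ?D) < ennreal \<epsilon>" for X Y
    proof -
      have "ennreal \<epsilon> + ennreal \<epsilon> \<le> emeasure (volume G) (X - Y)"
        using m \<epsilon> fX by (subst emeasure_eq_ennreal_measure) (auto simp flip: ennreal_plus intro!: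
            ennreal_leI)
      also have "\<dots> \<le> emeasure (volume G) ((X - Y) \<inter> ?D) + emeasure (volume G) (X - ?D)"
        using X sets_normal_form_ball[of G c "real k"]
        by (intro order_trans[OF emeasure_mono emeasure_subadditive]) auto
      also have "\<dots> \<le> emeasure (volume G) ((X - Y) \<inter> ?D) + ennreal \<epsilon>"
        using t by (intro add_left_mono) simp
      finally have "ennreal \<epsilon> + ennreal \<epsilon> \<le> ennreal \<epsilon> + emeasure (volume G) ((X - Y) \<inter> ?D)"
        by (simp only: add.commute)
      then show ?thesis
        by (simp add: ennreal_add_left_cancel_le)
    qed
    have e1: "ennreal \<epsilon> \<le> emeasure (volume G) ((F j - B j) \<inter> ?D)"
      using Fi[OF j(1)] k(1)[OF j(1)] B(1)[OF j(1)] j(2) fin'(1)[OF j(1)] by (intro split) auto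
    have e2: "ennreal \<epsilon> \<le> emeasure (volume G) ((B j - F j) \<inter> ?D)"
      using Fi[OF j(1)] k(2)[OF j(1)] B(1)[OF j(1)] j(2) fin'(2)[OF j(1)]
        mass_Diff_swap[OF Fi(1)[OF j(1)] B(1)[OF j(1)] fin[OF j(1)] Fi(2)[OF j(1)]]
      by (intro split) auto
    obtain h0 where h0: "0 < normal_form G h0"
      "ennreal \<delta> \<le> emeasure (volume G) {x \<in> (F j - B j) \<inter> ?D. reflect G h0 x \<in> (B j - F j) \<inter> ?D}"
      using \<delta>(2)[of "(B j - F j) \<inter> ?D" "(F j - B j) \<inter> ?D"] e1 e2 Fi(1)[OF j(1)] B(1)[OF j(1)] R
        sets_normal_form_ball[of G c "real k"] by auto
    \<comment> \<open>\<open>h0\<close> and \<open>- h0\<close> define the same reflection; the sign is chosen such that \<open>c\<close> is on the side that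
      gains mass\<close>
    define h where "h = (if 0 \<le> h0 \<bullet> c then h0 else - h0)"
    have h: "0 < normal_form G h" "0 \<le> h \<bullet> c" "reflect G h = reflect G h0"
      using h0(1) by (auto simp: h_def normal_form_minus reflect_minus)
    let ?F' = "\<lambda>i. polarize G h (F i)"
    have F': "rearrangement_below G I c E ?F'"
      using eq fin by (intro rearrangement_below_polarize[OF F I c h(1,2)]) auto
    have drop: "mass G (?F' i - B i) + measure (volume G) {x \<in> F i - B i. reflect G h x \<in> B i - F i}
        \<le> mass G (F i - B i)" if i: "i \<in> I" for i
    proof -
      have e: "emeasure (volume G) (?F' i - B i) + emeasure (volume G) {x \<in> F i
          - B i. reflect G h x \<in> B i - F i} \<le> emeasure (volume G) (F i - B i)"
        by (rule emeasure_polarize_Diff[OF h(1) c h(2) B(1)[OF i] B(2)[OF i] Fi(1)[OF i]])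
      have "emeasure (volume G) (?F' i - B i) \<noteq> \<infinity>" "emeasure (volume G) {x \<in> F i
          - B i. reflect G h x \<in> B i - F i} \<noteq> \<infinity>"
        using e fin'(1)[OF i, of "B i"] by (auto simp: top_unique)
      then show ?thesis
        using e fin'(1)[OF i, of "B i"] by (simp add: emeasure_eq_ennreal_measure flip: ennreal_plus)
    qed
    have "\<delta> \<le> measure (volume G) {x \<in> F j - B j. reflect G h x \<in> B j - F j}"
    proof -
      let ?O = "{x \<in> F j - B j. reflect G h x \<in> B j - F j}"
      have "?O = (F j - B j) \<inter> (reflect G h -` (B j - F j) \<inter> space (volume G))"
        using Fi(1)[OF j(1)] by (auto simp: sets_volume_iff)
      then have O: "?O \<in> sets (volume G)"
        using measurable_sets[OF measurable_reflect_volume[OF h(1)], of "B j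
            - F j"] B(1)[OF j(1)] Fi(1)[OF j(1)] by simp
      then have "ennreal \<delta> \<le> emeasure (volume G) ?O"
        by (intro order_trans[OF h0(2)] emeasure_mono) (auto simp: h(3))
      moreover have "emeasure (volume G) ?O \<noteq> \<infinity>"
      proof -
        have "emeasure (volume G) ?O \<le> emeasure (volume G) (F j - B j)"
          using Fi(1)[OF j(1)] B(1)[OF j(1)] by (intro emeasure_mono) auto
        then show ?thesis
          using fin'(1)[OF j(1), of "B j"] top_unique by (metis infinity_ennreal_def)
      qed
      ultimately show ?thesis
        by (simp add: emeasure_eq_ennreal_measure)
    qed
    then have "mass G (?F' j - B j) + \<delta> \<le> mass G (F j - B j)"
      using drop[OF j(1)] by simp
    moreover have "(\<Sum>i\<in>I - {j}. mass G (?F' i - B i)) \<le> (\<Sum>i\<in>I - {j}. mass G (F i - B i))"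
      using drop by (intro sum_mono) (smt (verit) DiffD1 measure_nonneg)
    ultimately have "(\<Sum>i\<in>I. mass G (?F' i - B i)) + \<delta> \<le> (\<Sum>i\<in>I. mass G (F i - B i))"
      using I(1) j(1) by (simp add: sum.remove)
    then show "\<exists>F'. rearrangement_below G I c E F' \<and> (\<Sum>i\<in>I. mass G (F' i - B i)) + \<delta>
        \<le> (\<Sum>i\<in>I. mass G (F i - B i))"
      using F' by blast
  qed
qed

section \<open>Comparison with concentric balls\<close>

text \<open>
Otherwise the discrepancy could be decreased by the same \<open>\<delta>\<close> arbitrarily often.
\<close>

lemma exists_small_discrepancy:
  fixes E B :: "'i \<Rightarrow> 'n::finite point set"
  assumes I: "finite I" "I \<noteq> {}" and c: "c \<in> model_space G"
    and E: "\<And>i. i \<in> I \<Longrightarrow> E i \<in> sets (volume G)"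
    and B: "\<And>i. i \<in> I \<Longrightarrow> B i \<in> sets (volume G)" "\<And>i. i \<in> I \<Longrightarrow> centred G c (B i)"
    and eq: "\<And>i. i \<in> I \<Longrightarrow> emeasure (volume G) (E i) = emeasure (volume G) (B i)"
    and fin: "\<And>i. i \<in> I \<Longrightarrow> emeasure (volume G) (B i) < \<infinity>" and \<eta>: "0 < \<eta>"
  shows "\<exists>F. rearrangement_below G I c E F \<and> (\<Sum>i\<in>I. mass G (F i - B i)) < \<eta>"
proof (rule ccontr)
  assume "\<not> ?thesis"
  then have large: "\<eta> \<le> (\<Sum>i\<in>I. mass G (F i - B i))" if "rearrangement_below G I c E F" for F
    using that by (meson not_le)
  obtain \<delta> where \<delta>: "0 < \<delta>" and step: "\<And>F. rearrangement_below G I c E F \<Longrightarrow> \<eta> \<le> (\<Sum>i\<in>I. mass G (F i - B i)) \<Longrightarrow>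
     \<exists>F'. rearrangement_below G I c E F' \<and> (\<Sum>i\<in>I. mass G (F' i - B i)) + \<delta> \<le> (\<Sum>i\<in>I. mass G (F i - B i))"
    using discrepancy_step[of I c G E B \<eta>, OF I c E B eq fin \<eta>] by blast
  have iter: "\<exists>F. rearrangement_below G I c E F \<and> (\<Sum>i\<in>I. mass G (F i - B i)) + real k * \<delta>
      \<le> (\<Sum>i\<in>I. mass G (E i - B i))" for k
  proof (induction k)
    case 0
    show ?case
      using E by (intro exI[of _ E]) (auto simp: rearrangement_below_def)
  next
    case (Suc k)
    then obtain F where F: "rearrangement_below G I c E F"
      "(\<Sum>i\<in>I. mass G (F i - B i)) + real k * \<delta> \<le> (\<Sum>i\<in>I. mass G (E i - B i))" by blast
    obtain F' where F': "rearrangement_below G I c E F'"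
      "(\<Sum>i\<in>I. mass G (F' i - B i)) + \<delta> \<le> (\<Sum>i\<in>I. mass G (F i - B i))"
      using step[OF F(1) large[OF F(1)]] by blast
    show ?case
      using F' F(2) by (intro exI[of _ F']) (simp add: algebra_simps)
  qed
  obtain k where k: "(\<Sum>i\<in>I. mass G (E i - B i)) < real k * \<delta>"
    using reals_Archimedean3[OF \<delta>] by blast
  from iter[of k] obtain F where "(\<Sum>i\<in>I. mass G (F i - B i)) + real k * \<delta> \<le> (\<Sum>i\<in>I. mass G (E i - B i))"
    by blast
  moreover have "0 \<le> (\<Sum>i\<in>I. mass G (F i - B i))"
    by (intro sum_nonneg) simp
  ultimately show False
    using k by linarith
qed

lemma mass_Int_diff_le:
  assumes F: "F \<in> sets (volume G)" and B: "B \<in> sets (volume G)" "emeasure (volume G) B < \<infinity>"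
    and eq: "emeasure (volume G) F = emeasure (volume G) B" and H: "\<And>E. E \<in> sets (volume G)
        \<Longrightarrow> E \<inter> H \<in> sets (volume G)"
  shows "\<bar>mass G (F \<inter> H) - mass G (B \<inter> H)\<bar> \<le> mass G (F - B)"
proof -
  have f: "X \<in> sets (volume G) \<Longrightarrow> X \<subseteq> F \<Longrightarrow> X \<in> fmeasurable (volume G)"
     "X \<in> sets (volume G) \<Longrightarrow> X \<subseteq> B \<Longrightarrow> X \<in> fmeasurable (volume G)" for X
    using emeasure_mono[of X F "volume G"] emeasure_mono[of X B "volume G"] F B eq
        by (auto simp: fmeasurable_def)
  have le: "mass G (X \<inter> H) \<le> mass G (Y \<inter> H) + mass G (X - Y)"
    if "X \<in> sets (volume G)" "Y \<in> sets (volume G)" "emeasure (volume G) X < \<infinity>"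
        "emeasure (volume G) Y < \<infinity>" for X Y
  proof -
    have fm: "Y \<inter> H \<in> fmeasurable (volume G)" "X - Y \<in> fmeasurable (volume G)"
      using that H[OF that(2)] emeasure_mono[of "Y \<inter> H" Y "volume G"] emeasure_mono[of "X - Y" X "volume G"]
      by (auto simp: fmeasurable_def)
    have "mass G (X \<inter> H) \<le> mass G ((Y \<inter> H) \<union> (X - Y))"
      using H[OF that(1)] fm by (intro measure_mono_fmeasurable) (auto intro: fmeasurable.Un)
    also have "\<dots> \<le> mass G (Y \<inter> H) + mass G (X - Y)"
      using fm by (intro measure_Un_le) (auto simp: fmeasurableD)
    finally show ?thesis .
  qed
  show ?thesis
    using le[of F B] le[of B F] F B eq mass_Diff_swap[OF F B eq] by simp
qed

text \<open>
Along rearrangements whose discrepancy tends to \<open>0\<close> the half-space masses converge to those of \<open>B\<close>,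
hence so does the separation of each \<open>v\<close>, and Fatou's lemma applies.
\<close>

lemma crossing_energy_centred_le:
  fixes E B :: "'i \<Rightarrow> 'n::finite point set"
  assumes I: "finite I" "I \<noteq> {}" and c: "c \<in> model_space G"
    and E: "\<And>i. i \<in> I \<Longrightarrow> E i \<in> sets (volume G)"
    and B: "\<And>i. i \<in> I \<Longrightarrow> B i \<in> sets (volume G)" "\<And>i. i \<in> I \<Longrightarrow> centred G c (B i)"
    and eq: "\<And>i. i \<in> I \<Longrightarrow> emeasure (volume G) (E i) = emeasure (volume G) (B i)"
    and fin: "\<And>i. i \<in> I \<Longrightarrow> emeasure (volume G) (B i) < \<infinity>"
  shows "crossing_energy G I B \<le> crossing_energy G I E"
proof -
  have "\<exists>F. rearrangement_below G I c E F \<and> (\<Sum>i\<in>I. mass G (F i - B i)) < 1 / real (Suc k)" for k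
    using I c E B eq fin by (intro exists_small_discrepancy) auto
  then obtain F where F: "\<And>k. rearrangement_below G I c E (F k)"
    "\<And>k. (\<Sum>i\<in>I. mass G (F k i - B i)) < 1 / real (Suc k)"
    by metis
  have Fi: "F k i \<in> sets (volume G)" "emeasure (volume G) (F k i) = emeasure (volume G) (B i)" if
      "i \<in> I" for i k
    using F(1)[of k] eq that by (auto simp: rearrangement_below_def)
  have conv: "(\<lambda>k. mass G (F k i \<inter> positive_side v)) \<longlonglongrightarrow> mass G (B i \<inter> positive_side v)" if i: "i \<in> I" for i v
  proof -
    have "norm (mass G (F k i \<inter> positive_side v) - mass G (B i \<inter> positive_side v)) \<le> 1 / real (Suc k)" for k
    proof -
      have "\<bar>mass G (F k i \<inter> positive_side v) - mass G (B i \<inter> positive_side v)\<bar> \<le> mass G (F k i - B i)"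
        using i by (intro mass_Int_diff_le Fi B(1) fin sets_positive_side)
      also have "\<dots> \<le> (\<Sum>i\<in>I. mass G (F k i - B i))"
        using I(1) i by (intro member_le_sum) auto
      finally show ?thesis
        using F(2)[of k] by simp
    qed
    then have "(\<lambda>k. mass G (F k i \<inter> positive_side v) - mass G (B i \<inter> positive_side v)) \<longlonglongrightarrow> 0"
      by (intro Lim_null_comparison[OF _ LIMSEQ_Suc[OF lim_1_over_n]] always_eventually) auto
    then show ?thesis
      by (simp add: LIM_zero_iff)
  qed
  have const: "mass G (F k i) = mass G (B i)" if "i \<in> I" for i k
    using Fi(2)[OF that] by (simp add: measure_def)
  have lim: "(\<lambda>k. separation G I (F k) v) \<longlonglongrightarrow> separation G I B v" for v
  proof -
    have "(\<lambda>k. (\<Prod>i\<in>I. mass G (B i)) - (\<Prod>i\<in>I. mass G (F k i \<inter> positive_side v))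
        - (\<Prod>i\<in>I. mass G (F k i \<inter> positive_side (- v))))
       \<longlonglongrightarrow> separation G I B v"
      unfolding separation_def by (intro tendsto_diff tendsto_const tendsto_prod conv)
    moreover have "(\<Prod>i\<in>I. mass G (F k i)) = (\<Prod>i\<in>I. mass G (B i))" for k
      by (intro prod.cong refl const)
    ultimately show ?thesis
      unfolding separation_def[of G I "F _" v] by simp
  qed
  have "crossing_energy G I B = (\<integral>\<^sup>+v. liminf (\<lambda>k. ennreal (separation G I (F k) v) * indicator
      (unit_normals G) v) \<partial>lborel)"
    unfolding crossing_energy_def
  proof (intro nn_integral_cong)
    fix v
    have "(\<lambda>k. ennreal (separation G I (F k) v) * indicator (unit_normals G) v)
        \<longlonglongrightarrow> ennreal (separation G I B v) * indicator (unit_normals G) v"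
      using lim[of v] by (cases "v \<in> unit_normals G") (auto intro: tendsto_ennrealI)
    from lim_imp_Liminf[OF sequentially_bot this]
    show "ennreal (separation G I B v) * indicator (unit_normals G) v =
        liminf (\<lambda>k. ennreal (separation G I (F k) v) * indicator (unit_normals G) v)" by simp
  qed
  also have "\<dots> \<le> liminf (\<lambda>k. crossing_energy G I (F k))"
    unfolding crossing_energy_def
  proof (rule nn_integral_liminf)
    fix k
    have "separation G I (F k) \<in> borel_measurable borel"
      using Fi by (intro measurable_separation)
    then show "(\<lambda>v. ennreal (separation G I (F k) v) * indicator (unit_normals G) v) \<in> borel_measurable
        lborel"
      by (intro borel_measurable_times_ennreal borel_measurable_indicator measurable_compose[OF _
          measurable_ennreal])
        (simp_all add: sets_unit_normals)
  qed
  also have "\<dots> \<le> liminf (\<lambda>k :: nat. crossing_energy G I E)"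
    using F(1) by (intro Liminf_mono always_eventually) (auto simp: rearrangement_below_def)
  also have "\<dots> = crossing_energy G I E"
    by (simp add: Liminf_const)
  finally show ?thesis .
qed

section \<open>The bathtub principle\<close>

text \<open>
The distribution function of a coordinate on \<open>L\<close> is continuous, so it attains each intermediate
value.
\<close>

lemma exists_subset_of_measure:
  fixes L :: "'n::finite point set"
  assumes L: "L \<in> sets (volume G)" "emeasure (volume G) L < \<infinity>" and p: "0 \<le> p" "p \<le> mass G L"
  obtains S where "S \<in> sets (volume G)" "S \<subseteq> L" "emeasure (volume G) S = ennreal p"
proof -
  have LM: "L \<in> sets borel" "L \<subseteq> model_space G"
    using L by (auto simp: sets_volume_iff)
  define i :: 'n where "i = undefined"
  have coord: "(\<lambda>x. snd x $ i) \<in> borel_measurable (volume G)"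
    by (intro measurable_volume_if_borel borel_measurable_continuous_onI continuous_intros)
  define M where "M = distr (density (volume G) (indicator L)) borel (\<lambda>x. snd x $ i)"
  have half: "L \<inter> {x. snd x $ i \<le> s} \<in> sets (volume G)" for s
  proof -
    have "{x :: 'n point. snd x $ i \<le> s} \<in> sets borel"
      by (intro borel_closed closed_Collect_le continuous_intros)
    then show ?thesis
      using LM by (auto simp: sets_volume_iff)
  qed
  have emM: "emeasure M X = emeasure (volume G) (L \<inter> {x. snd x $ i \<in> X})" if [measurable]:
      "X \<in> sets borel" for X
  proof -
    note [measurable] = coord L(1)
    have m: "(\<lambda>x. snd x $ i) -` X \<inter> model_space G \<in> sets (volume G)"
      using measurable_sets[OF coord that] by simp
    have "emeasure M X = emeasure (density (volume G) (indicator L)) ((\<lambda>x. snd x $ i) -` X \<inter> model_space G)"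
      unfolding M_def by (subst emeasure_distr) auto
    also have "\<dots> = (\<integral>\<^sup>+x. indicator L x * indicator ((\<lambda>x. snd x $ i) -` X \<inter> model_space G) x \<partial>volume G)"
      using m by (subst emeasure_density) auto
    also have "\<dots> = (\<integral>\<^sup>+x. indicator (L \<inter> {x. snd x $ i \<in> X}) x \<partial>volume G)"
      using LM by (intro nn_integral_cong) (auto simp: indicator_def)
    also have "L \<inter> {x. snd x $ i \<in> X} = L \<inter> ((\<lambda>x. snd x $ i) -` X \<inter> model_space G)"
      using LM by auto
    also have "(\<integral>\<^sup>+x. indicator (L \<inter> ((\<lambda>x. snd x $ i) -` X \<inter> model_space G)) x \<partial>volume G)
       = emeasure (volume G) (L \<inter> ((\<lambda>x. snd x $ i) -` X \<inter> model_space G))"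
      using m L(1) by simp
    also have "L \<inter> ((\<lambda>x. snd x $ i) -` X \<inter> model_space G) = L \<inter> {x. snd x $ i \<in> X}"
      using LM by auto
    finally show ?thesis .
  qed
  have setsM: "sets M = sets borel"
    by (simp add: M_def)
  interpret finM: finite_measure M
    using emM[of UNIV] L(2) by (intro finite_measureI) (simp add: M_def)
  interpret M: finite_borel_measure M
    by standard (rule setsM)
  have spaceM: "space M = UNIV"
    by (simp add: M_def)
  have tot: "measure M (space M) = mass G L"
    using emM[of UNIV] by (simp add: spaceM measure_def)
  have cdf: "cdf M s = mass G (L \<inter> {x. snd x $ i \<le> s})" for s
    using emM[of "{..s}"] by (simp add: cdf_def measure_def)
  have cont: "isCont (cdf M) s" for s
  proof -
    have "L \<inter> {x. snd x $ i = s} \<in> null_sets (volume G)"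
    proof (rule null_sets_subset[OF null_sets_coordinate[of G i s]])
      have "{x :: 'n point. snd x $ i = s} \<in> sets borel"
        by (intro borel_closed closed_Collect_eq continuous_intros)
      then show "L \<inter> {x. snd x $ i = s} \<in> sets (volume G)"
        using LM by (auto simp: sets_volume_iff)
    qed (use LM in auto)
    then have "measure M {s} = 0"
      using emM[of "{s}"] by (simp add: measure_def null_sets_def)
    then show ?thesis
      by (simp add: M.isCont_cdf)
  qed
  have result: "\<exists>s. cdf M s = p" if "0 < p" "p < mass G L"
  proof -
    have "\<forall>\<^sub>F s in at_bot. cdf M s < p"
      using M.cdf_lim_at_bot that(1) by (rule order_tendstoD)
    then obtain s1 where s1: "\<And>s. s \<le> s1 \<Longrightarrow> cdf M s < p"
      by (auto simp: eventually_at_bot_linorder)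
    have "\<forall>\<^sub>F s in at_top. p < cdf M s"
      using M.cdf_lim_at_top that(2) unfolding tot by (rule order_tendstoD)
    then obtain s2 where s2: "\<And>s. s2 \<le> s \<Longrightarrow> p < cdf M s"
      by (auto simp: eventually_at_top_linorder)
    have "\<exists>s\<ge>min s1 s2. s \<le> max s1 s2 \<and> cdf M s = p"
      using s1[of "min s1 s2"] s2[of "max s1 s2"] cont
          by (intro IVT') (auto simp: continuous_at_imp_continuous_on)
    then show ?thesis by blast
  qed
  have fin: "emeasure (volume G) (L \<inter> X) \<noteq> \<infinity>" for X
    using emeasure_mono[of "L \<inter> X" L "volume G"] L by (auto simp: top_unique)
  consider "p = 0" | "p = mass G L" | "0 < p" "p < mass G L"
    using p by linarith
  then show ?thesis
  proof cases
    case 1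
    then show ?thesis by (intro that[of "{}"]) auto
  next
    case 2
    then show ?thesis using L by (intro that[of L]) (auto simp: emeasure_eq_ennreal_measure)
  next
    case 3
    then obtain s where s: "cdf M s = p"
      using result by blast
    show ?thesis
      using half[of s] fin[of "{x. snd x $ i \<le> s}"] s cdf[of s]
      by (intro that[of "L \<inter> {x. snd x $ i \<le> s}"]) (auto simp: emeasure_eq_ennreal_measure)
  qed
qed

text \<open>
Take the infimum of all levels whose sublevel set in \<open>K\<close> has measure at least \<open>m\<close>, and use continuity
of the measure from above and from below.
\<close>

lemma exists_threshold:
  fixes \<Phi> :: "'a \<Rightarrow> ennreal"
  assumes K: "K \<in> sets M" "emeasure M K < \<infinity>" and \<Phi>[measurable]: "\<Phi> \<in> borel_measurable M" and m: "m
      \<le> emeasure M K"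
  obtains t where "emeasure M {x \<in> K. \<Phi> x < t} \<le> m" "m \<le> emeasure M {x \<in> K. \<Phi> x \<le> t}"
proof -
  note [measurable] = K(1)
  have KM: "K \<subseteq> space M" using K(1) by (rule sets.sets_into_space)
  have le_sets: "{x \<in> K. \<Phi> x \<le> t} \<in> sets M" for t
  proof -
    have "{x \<in> K. \<Phi> x \<le> t} = K \<inter> {x \<in> space M. \<Phi> x \<le> t}" using KM by auto
    then show ?thesis by simp
  qed
  define S where "S = {t. m \<le> emeasure M {x \<in> K. \<Phi> x \<le> t}}"
  have "top \<in> S"
    using m by (simp add: S_def)
  then obtain f where f: "decseq f" "range f \<subseteq> S" "Inf S = (INF i. f i :: ennreal)"
    using ennreal_Inf_countable_INF[of S] by blast
  show ?thesis
  proof (rule that[of "Inf S"])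
    have inter: "{x \<in> K. \<Phi> x \<le> Inf S} = (\<Inter>i. {x \<in> K. \<Phi> x \<le> f i})"
      unfolding f(3) by (auto simp: le_INF_iff)
    have inf: "(INF i. emeasure M {x \<in> K. \<Phi> x \<le> f i}) = emeasure M (\<Inter>i. {x \<in> K. \<Phi> x \<le> f i})"
    proof (rule INF_emeasure_decseq)
      show "range (\<lambda>i. {x \<in> K. \<Phi> x \<le> f i}) \<subseteq> sets M"
        using le_sets by auto
      show "decseq (\<lambda>i. {x \<in> K. \<Phi> x \<le> f i})"
        using f(1) by (auto simp: decseq_def intro: order_trans)
      show "emeasure M {x \<in> K. \<Phi> x \<le> f i} \<noteq> \<infinity>" for i
        using emeasure_mono[of "{x \<in> K. \<Phi> x \<le> f i}" K M] K by (auto simp: top_unique)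
    qed
    have "m \<le> emeasure M {x \<in> K. \<Phi> x \<le> f i}" for i
      using f(2) by (auto simp: S_def)
    then show "m \<le> emeasure M {x \<in> K. \<Phi> x \<le> Inf S}"
      unfolding inter inf[symmetric] by (rule INF_greatest)
    show "emeasure M {x \<in> K. \<Phi> x < Inf S} \<le> m"
    proof (cases "Inf S = 0")
      case False
      then have "{s. s < Inf S} \<noteq> {}"
        by (auto intro: exI[of _ 0] simp: zero_less_iff_neq_zero)
      then obtain g where g: "incseq g" "range g \<subseteq> {s. s < Inf S}" "Sup {s. s < Inf S}
          = (SUP i. g i :: ennreal)"
        using ennreal_Sup_countable_SUP[of "{s. s < Inf S}"] by blast
      have sup: "Sup {s. s < Inf S} = Inf S"
        using Sup_lessThan[of "Inf S"] False by (simp add: lessThan_def)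
      have union: "{x \<in> K. \<Phi> x < Inf S} = (\<Union>i. {x \<in> K. \<Phi> x \<le> g i})"
      proof (intro set_eqI iffI)
        fix x assume "x \<in> {x \<in> K. \<Phi> x < Inf S}"
        then have "x \<in> K" "\<Phi> x < (SUP i. g i)"
          using g(3) sup by auto
        then show "x \<in> (\<Union>i. {x \<in> K. \<Phi> x \<le> g i})"
          by (auto simp: less_SUP_iff intro: less_imp_le)
      next
        fix x assume "x \<in> (\<Union>i. {x \<in> K. \<Phi> x \<le> g i})"
        then show "x \<in> {x \<in> K. \<Phi> x < Inf S}"
          using g(2) by (auto intro: le_less_trans)
      qed
      have sup': "(SUP i. emeasure M {x \<in> K. \<Phi> x \<le> g i}) = emeasure M (\<Union>i. {x \<in> K. \<Phi> x \<le> g i})"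
        using le_sets g(1) by (intro SUP_emeasure_incseq) (auto simp: incseq_def intro: order_trans)
      have "emeasure M {x \<in> K. \<Phi> x \<le> g i} \<le> m" for i
      proof -
        have "g i < Inf S"
          using g(2) by blast
        then have "g i \<notin> S"
          using Inf_lower[of "g i" S] by (meson leD)
        then show ?thesis by (simp add: S_def)
      qed
      then show ?thesis
        unfolding union sup'[symmetric] by (rule SUP_least)
    qed simp
  qed
qed

text \<open>
\<open>E\<close> consists of the points of \<open>K\<close> with \<open>\<Phi>\<close> below a threshold \<open>t\<close>, filled up with a part of the level
set of \<open>t\<close>. Compared with \<open>f\<close>, the function \<open>a\<close> times the indicator of \<open>E\<close> has moved mass from places
with \<open>t \<le> \<Phi>\<close> to places with \<open>\<Phi> \<le> t\<close>.
\<close>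

lemma bathtub_finite:
  fixes f \<Phi> :: "'n::finite point \<Rightarrow> ennreal" and a :: real
  assumes K: "K \<in> sets (volume G)" "emeasure (volume G) K < \<infinity>" and a: "0 < a"
    and [measurable]: "f \<in> borel_measurable (volume G)" "\<Phi> \<in> borel_measurable (volume G)"
    and f: "\<And>x. f x \<le> ennreal a"
  shows "\<exists>E. E \<in> sets (volume G) \<and> E \<subseteq> K \<and> ennreal a * emeasure (volume G) E = (\<integral>\<^sup>+x\<in>K. f x \<partial>volume G)
    \<and> ennreal a * (\<integral>\<^sup>+x\<in>E. \<Phi> x \<partial>volume G) \<le> (\<integral>\<^sup>+x\<in>K. f x * \<Phi> x \<partial>volume G)"
proof -
  let ?\<mu> = "volume G :: 'n point measure"
  note [measurable] = K(1)
  have KM: "K \<subseteq> space ?\<mu>" using K(1) by (rule sets.sets_into_space)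
  define I where "I = (\<integral>\<^sup>+x\<in>K. f x \<partial>?\<mu>)"
  have I_le: "I \<le> ennreal a * emeasure ?\<mu> K"
  proof -
    have "I \<le> (\<integral>\<^sup>+x. ennreal a * indicator K x \<partial>?\<mu>)"
      unfolding I_def by (intro nn_integral_mono mult_right_mono f) auto
    then show ?thesis by (simp add: nn_integral_cmult_indicator)
  qed
  then have I_fin: "I < \<infinity>"
    using K(2) by (simp add: ennreal_mult_less_top le_less_trans)
  define m where "m = I / ennreal a"
  have m: "ennreal a * m = I"
  proof -
    obtain i where "I = ennreal i" "0 \<le> i"
      using I_fin by (cases I) auto
    then show ?thesis
      using a by (simp add: m_def divide_ennreal flip: ennreal_mult)
  qed
  have "m \<le> emeasure ?\<mu> K"
    unfolding m_def using I_le a by (intro divide_le_posI_ennreal) (auto simp: mult.commute)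
  then have mK: "m \<le> emeasure ?\<mu> K" .
  obtain t where t: "emeasure ?\<mu> {x \<in> K. \<Phi> x < t} \<le> m" "m \<le> emeasure ?\<mu> {x \<in> K. \<Phi> x \<le> t}"
  proof (rule exists_threshold[OF K assms(5) mK])
    fix t assume "emeasure ?\<mu> {x \<in> K. \<Phi> x < t} \<le> m" "m \<le> emeasure ?\<mu> {x \<in> K. \<Phi> x \<le> t}"
    then show thesis by (rule that)
  qed
  define A where "A = {x \<in> K. \<Phi> x < t}"
  define L where "L = {x \<in> K. \<Phi> x = t}"
  have A: "A \<in> sets ?\<mu>" and L: "L \<in> sets ?\<mu>"
  proof -
    have "A = K \<inter> {x \<in> space ?\<mu>. \<Phi> x < t}" "L = K \<inter> {x \<in> space ?\<mu>. \<Phi> x = t}"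
      using KM by (auto simp: A_def L_def)
    moreover have "{x \<in> space ?\<mu>. \<Phi> x < t} \<in> sets ?\<mu>" "{x \<in> space ?\<mu>. \<Phi> x = t} \<in> sets ?\<mu>"
      by measurable
    ultimately show "A \<in> sets ?\<mu>" "L \<in> sets ?\<mu>"
      using K(1) by (auto intro: sets.Int)
  qed
  have fin: "emeasure ?\<mu> A < \<infinity>" "emeasure ?\<mu> L < \<infinity>" "m < \<infinity>"
    using emeasure_mono[of A K ?\<mu>] emeasure_mono[of L K ?\<mu>] K \<open>m \<le> emeasure ?\<mu> K\<close>
    by (auto simp: A_def L_def le_less_trans)
  have "{x \<in> K. \<Phi> x \<le> t} = A \<union> L" "A \<inter> L = {}"
    by (auto simp: A_def L_def)
  then have AL: "m \<le> emeasure ?\<mu> A + emeasure ?\<mu> L"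
    using t(2) A L by (simp add: plus_emeasure)
  define p where "p = enn2real (m - emeasure ?\<mu> A)"
  have p: "ennreal p = m - emeasure ?\<mu> A"
    using fin by (simp add: p_def less_top[symmetric])
  have "ennreal p \<le> emeasure ?\<mu> L"
    unfolding p using AL fin by (auto simp: ennreal_minus_le_iff add.commute)
  then have "p \<le> mass G L"
    using fin(2) by (simp add: emeasure_eq_ennreal_measure)
  moreover have "0 \<le> p"
    by (simp add: p_def)
  ultimately have p_range: "0 \<le> p" "p \<le> mass G L"
    by simp_all
  obtain S where S: "S \<in> sets ?\<mu>" "S \<subseteq> L" "emeasure ?\<mu> S = ennreal p"
  proof (rule exists_subset_of_measure[OF L fin(2) p_range])
    fix S assume "S \<in> sets ?\<mu>" "S \<subseteq> L" "emeasure ?\<mu> S = ennreal p"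
    then show thesis by (rule that)
  qed
  define E where "E = A \<union> S"
  have E[measurable]: "E \<in> sets ?\<mu>" and EK: "E \<subseteq> K"
    using A S by (auto simp: E_def A_def L_def)
  have "emeasure ?\<mu> E = emeasure ?\<mu> A + emeasure ?\<mu> S"
    unfolding E_def using A S by (intro plus_emeasure[symmetric]) (auto simp: A_def L_def)
  also have "\<dots> = m"
    unfolding S(3) p using t(1) fin by (simp add: A_def[symmetric] ennreal_add_diff_cancel_right
        add_diff_inverse_ennreal)
  finally have mE: "ennreal a * emeasure ?\<mu> E = I"
    using m by simp
  have KE: "K - E \<in> sets ?\<mu>" by measurable
  have low: "\<Phi> x \<le> t" if "x \<in> E" for x
    using that S(2) by (auto simp: E_def A_def L_def)
  have high: "t \<le> \<Phi> x" if "x \<in> K - E" for x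
    using that by (auto simp: E_def A_def)
  \<comment> \<open>\<open>u\<close> is the mass that is added on \<open>E\<close>; it balances the mass of \<open>f\<close> outside of \<open>E\<close>\<close>
  define u where "u x = ennreal a - f x" for x
  have u[measurable]: "u \<in> borel_measurable ?\<mu>"
    unfolding u_def by measurable
  have uf: "u x + f x = ennreal a" for x
    unfolding u_def using f by (simp add: diff_add_cancel_ennreal)
  define P where "P = (\<integral>\<^sup>+x\<in>E. f x \<partial>?\<mu>)"
  have split: "(\<integral>\<^sup>+x\<in>K. g x \<partial>?\<mu>) = (\<integral>\<^sup>+x\<in>E. g x \<partial>?\<mu>) + (\<integral>\<^sup>+x\<in>K - E. g x \<partial>?\<mu>)"
    if [measurable]: "g \<in> borel_measurable ?\<mu>" for g
    using EK by (subst nn_integral_add[symmetric]) (auto intro!: nn_integral_cong simp: indicator_def)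
  have "P + (\<integral>\<^sup>+x\<in>E. u x \<partial>?\<mu>) = (\<integral>\<^sup>+x. ennreal a * indicator E x \<partial>?\<mu>)"
    unfolding P_def by (subst nn_integral_add[symmetric]) (auto intro!: nn_integral_cong simp:
        indicator_def add.commute[of "f _"] uf)
  also have "\<dots> = P + (\<integral>\<^sup>+x\<in>K - E. f x \<partial>?\<mu>)"
    using mE split[of f] by (simp add: nn_integral_cmult_indicator P_def I_def)
  finally have bal: "(\<integral>\<^sup>+x\<in>E. u x \<partial>?\<mu>) = (\<integral>\<^sup>+x\<in>K - E. f x \<partial>?\<mu>)"
  proof -
    assume eq: "P + (\<integral>\<^sup>+x\<in>E. u x \<partial>?\<mu>) = P + (\<integral>\<^sup>+x\<in>K - E. f x \<partial>?\<mu>)"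
    have "P \<noteq> \<infinity>"
      using split[of f] I_fin by (auto simp: P_def I_def)
    with eq show ?thesis by (simp add: ennreal_add_left_cancel)
  qed
  have "(\<integral>\<^sup>+x\<in>E. u x * \<Phi> x \<partial>?\<mu>) \<le> (\<integral>\<^sup>+x. t * (u x * indicator E x) \<partial>?\<mu>)"
    by (intro nn_integral_mono) (auto simp: indicator_def mult.commute[of t] intro!: mult_left_mono low)
  also have "\<dots> = t * (\<integral>\<^sup>+x\<in>K - E. f x \<partial>?\<mu>)"
    unfolding bal[symmetric] by (rule nn_integral_cmult) measurable
  also have "\<dots> = (\<integral>\<^sup>+x. t * (f x * indicator (K - E) x) \<partial>?\<mu>)"
    by (rule nn_integral_cmult[symmetric]) measurable
  also have "\<dots> \<le> (\<integral>\<^sup>+x\<in>K - E. f x * \<Phi> x \<partial>?\<mu>)"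
    using high by (intro nn_integral_mono) (auto simp: indicator_def mult.commute[of t] intro!:
        mult_left_mono)
  finally have part: "(\<integral>\<^sup>+x\<in>E. u x * \<Phi> x \<partial>?\<mu>) \<le> (\<integral>\<^sup>+x\<in>K - E. f x * \<Phi> x \<partial>?\<mu>)" .
  have "ennreal a * (\<integral>\<^sup>+x\<in>E. \<Phi> x \<partial>?\<mu>) = (\<integral>\<^sup>+x\<in>E. (u x + f x) * \<Phi> x \<partial>?\<mu>)"
    unfolding uf by (subst nn_integral_cmult[symmetric]) (auto simp: mult.assoc)
  also have "\<dots> = (\<integral>\<^sup>+x\<in>E. f x * \<Phi> x \<partial>?\<mu>) + (\<integral>\<^sup>+x\<in>E. u x * \<Phi> x \<partial>?\<mu>)"
    by (subst nn_integral_add[symmetric]) (auto intro!: nn_integral_cong simp: distrib_right add.commute)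
  also have "\<dots> \<le> (\<integral>\<^sup>+x\<in>E. f x * \<Phi> x \<partial>?\<mu>) + (\<integral>\<^sup>+x\<in>K - E. f x * \<Phi> x \<partial>?\<mu>)"
    by (intro add_left_mono part)
  also have "\<dots> = (\<integral>\<^sup>+x\<in>K. f x * \<Phi> x \<partial>?\<mu>)"
    by (rule split[symmetric]) measurable
  finally have "ennreal a * (\<integral>\<^sup>+x\<in>E. \<Phi> x \<partial>?\<mu>) \<le> (\<integral>\<^sup>+x\<in>K. f x * \<Phi> x \<partial>?\<mu>)" .
  then show ?thesis
    using E EK mE[unfolded I_def] by blast
qed

text \<open>
On a set of infinite measure, the measures of the sublevel sets of \<open>\<Phi>\<close> may jump to infinity at the
threshold. Therefore the space is cut into countably many pieces of finite measure, and mass is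
rearranged within each piece.
\<close>

lemma bathtub:
  fixes f \<Phi> :: "'n::finite point \<Rightarrow> ennreal" and a :: real
  assumes a: "0 < a"
    and f_m: "f \<in> borel_measurable (volume G)" and P_m: "\<Phi> \<in> borel_measurable (volume G)"
    and f: "\<And>x. f x \<le> ennreal a"
  shows "\<exists>E. E \<in> sets (volume G) \<and> ennreal a * emeasure (volume G) E = (\<integral>\<^sup>+x. f x \<partial>volume G)
    \<and> ennreal a * (\<integral>\<^sup>+x\<in>E. \<Phi> x \<partial>volume G) \<le> (\<integral>\<^sup>+x. f x * \<Phi> x \<partial>volume G)"
proof -
  let ?\<mu> = "volume G :: 'n point measure"
  obtain K :: "nat \<Rightarrow> 'n point set" where K: "range K \<subseteq> sets ?\<mu>" "(\<Union>i. K i) = space ?\<mu>"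
    "\<And>i. emeasure ?\<mu> (K i) \<noteq> \<infinity>" "disjoint_family K"
  proof (rule volume.sigma_finite_disjoint[where G = G])
    fix K :: "nat \<Rightarrow> 'n point set"
    assume "range K \<subseteq> sets ?\<mu>" "(\<Union>i. K i) = space ?\<mu>" "\<And>i. emeasure ?\<mu> (K i) \<noteq> \<infinity>" "disjoint_family K"
    then show thesis by (rule that)
  qed
  have Ki: "K i \<in> sets ?\<mu>" "emeasure ?\<mu> (K i) < \<infinity>" for i
    using K(1,3) by (auto simp: less_top)
  have "\<forall>i. \<exists>E. E \<in> sets ?\<mu> \<and> E \<subseteq> K i \<and> ennreal a * emeasure ?\<mu> E = (\<integral>\<^sup>+x\<in>K i. f x \<partial>?\<mu>)
    \<and> ennreal a * (\<integral>\<^sup>+x\<in>E. \<Phi> x \<partial>?\<mu>) \<le> (\<integral>\<^sup>+x\<in>K i. f x * \<Phi> x \<partial>?\<mu>)"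
    using bathtub_finite[OF Ki a f_m P_m f] by blast
  from choice[OF this] obtain E where E_all: "\<forall>i. E i \<in> sets ?\<mu> \<and> E i \<subseteq> K i \<and>
    ennreal a * emeasure ?\<mu> (E i) = (\<integral>\<^sup>+x\<in>K i. f x \<partial>?\<mu>)
    \<and> ennreal a * (\<integral>\<^sup>+x\<in>E i. \<Phi> x \<partial>?\<mu>) \<le> (\<integral>\<^sup>+x\<in>K i. f x * \<Phi> x \<partial>?\<mu>)" ..
  have E: "E i \<in> sets ?\<mu>" "E i \<subseteq> K i" "ennreal a * emeasure ?\<mu> (E i) = (\<integral>\<^sup>+x\<in>K i. f x \<partial>?\<mu>)"
    "ennreal a * (\<integral>\<^sup>+x\<in>E i. \<Phi> x \<partial>?\<mu>) \<le> (\<integral>\<^sup>+x\<in>K i. f x * \<Phi> x \<partial>?\<mu>)" for i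
    by (simp_all only: spec[OF E_all, of i])
  have dE: "disjoint_family E"
    using K(4) E(2) unfolding disjoint_family_on_def by blast
  have whole: "(\<integral>\<^sup>+x. g x \<partial>?\<mu>) = (\<Sum>i. \<integral>\<^sup>+x\<in>K i. g x \<partial>?\<mu>)" if "g \<in> borel_measurable ?\<mu>" for g
  proof -
    have "(\<integral>\<^sup>+x. g x \<partial>?\<mu>) = (\<integral>\<^sup>+x\<in>(\<Union>i. K i). g x \<partial>?\<mu>)"
      unfolding K(2) by (intro nn_integral_cong) (auto simp: indicator_def)
    then show ?thesis
      using nn_integral_disjoint_family[OF that Ki(1) K(4)] by simp
  qed
  have "ennreal a * emeasure ?\<mu> (\<Union>i. E i) = (\<Sum>i. ennreal a * emeasure ?\<mu> (E i))"
    using suminf_emeasure[of E ?\<mu>] E(1) dE by (auto simp: image_subset_iff)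
  also have "\<dots> = (\<integral>\<^sup>+x. f x \<partial>?\<mu>)"
    unfolding E(3) by (rule whole[OF f_m, symmetric])
  finally have 1: "ennreal a * emeasure ?\<mu> (\<Union>i. E i) = (\<integral>\<^sup>+x. f x \<partial>?\<mu>)" .
  have "ennreal a * (\<integral>\<^sup>+x\<in>(\<Union>i. E i). \<Phi> x \<partial>?\<mu>) = (\<Sum>i. ennreal a * (\<integral>\<^sup>+x\<in>E i. \<Phi> x \<partial>?\<mu>))"
    using nn_integral_disjoint_family[OF P_m E(1) dE] by simp
  also have "\<dots> \<le> (\<Sum>i. \<integral>\<^sup>+x\<in>K i. f x * \<Phi> x \<partial>?\<mu>)"
    by (intro suminf_le E(4)) auto
  also have "\<dots> = (\<integral>\<^sup>+x. f x * \<Phi> x \<partial>?\<mu>)"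
    using f_m P_m by (intro whole[symmetric]) simp
  finally show ?thesis
    using 1 E(1) by (intro exI[of _ "\<Union>i. E i"]) auto
qed

section \<open>Half-spaces and geodesic segments\<close>

text \<open>
By the addition theorems, the difference of both sides has norm \<open>0\<close>.
\<close>

lemma spherical_segment_combination:
  fixes x y z :: "'a::real_inner"
  assumes "x \<bullet> x = 1" "y \<bullet> y = 1" "z \<bullet> z = 1" "x \<bullet> z = cos a" "z \<bullet> y = cos b" "x \<bullet> y = cos (a + b)"
  shows "sin (a + b) *\<^sub>R z = sin b *\<^sub>R x + sin a *\<^sub>R y"
proof -
  define w where "w = sin (a + b) *\<^sub>R z - sin b *\<^sub>R x - sin a *\<^sub>R y"
  have "w \<bullet> w = (sin (a + b))\<^sup>2 + (sin b)\<^sup>2 + (sin a)\<^sup>2 - 2 * sin (a + b) * sin b * cos a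
      - 2 * sin (a + b) * sin a * cos b + 2 * sin a * sin b * cos (a + b)"
    using assms by (simp add: w_def inner_diff_left inner_diff_right inner_commute power2_eq_square
        algebra_simps)
  also have "\<dots> = (sin b)\<^sup>2 * (1 - (cos a)\<^sup>2 - (sin a)\<^sup>2) + (sin a)\<^sup>2 * (1 - (cos b)\<^sup>2 - (sin b)\<^sup>2)"
  proof -
    have "(s * c' + c * s')\<^sup>2 + s'\<^sup>2 + s\<^sup>2 - 2 * (s * c' + c * s') * s' * c - 2 * (s * c' + c * s') * s * c'
        + 2 * s * s' * (c * c' - s * s') = s'\<^sup>2 * (1 - c\<^sup>2 - s\<^sup>2) + s\<^sup>2 * (1 - c'\<^sup>2 - s'\<^sup>2)"
            for s c s' c' :: real
      by (simp add: power2_eq_square algebra_simps)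
    then show ?thesis
      unfolding sin_add cos_add .
  qed
  also have "\<dots> = 0"
    by (simp add: sin_squared_eq)
  finally have "w = 0"
    by (simp only: inner_eq_zero_iff)
  then show ?thesis
    by (simp add: w_def algebra_simps)
qed

lemma lorentz_commute: "lorentz x y = lorentz y x"
  by (simp add: lorentz_def inner_commute mult.commute)

lemma lorentz_add_left: "lorentz (x + y) z = lorentz x z + lorentz y z"
  by (simp add: lorentz_def inner_add_left algebra_simps)

lemma lorentz_add_right: "lorentz z (x + y) = lorentz z x + lorentz z y"
  by (simp add: lorentz_def inner_add_right algebra_simps)

lemma lorentz_diff_left: "lorentz (x - y) z = lorentz x z - lorentz y z"
  by (simp add: lorentz_def inner_diff_left algebra_simps)

lemma lorentz_diff_right: "lorentz z (x - y) = lorentz z x - lorentz z y"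
  by (simp add: lorentz_def inner_diff_right algebra_simps)

lemma lorentz_scaleR: "lorentz (c *\<^sub>R x) y = c * lorentz x y" "lorentz x (c *\<^sub>R y) = c * lorentz x y"
  by (simp_all add: lorentz_def algebra_simps)

lemmas lorentz_simps = lorentz_add_left lorentz_add_right lorentz_diff_left lorentz_diff_right
    lorentz_scaleR

lemma hyperbolic_lorentz:
  assumes "x \<in> model_space Hyperbolic"
  shows "lorentz x x = 1"
  using assms by (simp add: model_space.simps)

lemma hyperbolic_lorentz_ge_1:
  assumes "x \<in> model_space Hyperbolic" "y \<in> model_space Hyperbolic"
  shows "1 \<le> lorentz x y" "x \<noteq> y \<Longrightarrow> 1 < lorentz x y"
  using hyperbolic_pairing[OF assms] by (simp_all add: lorentz_def)

text \<open>
The Lorentz form is negative definite on the orthogonal complement of a timelike vector.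
\<close>

lemma lorentz_orthogonal_null:
  assumes z: "z \<in> model_space Hyperbolic" and w: "lorentz w w = 0" "lorentz w z = 0"
  shows "w = 0"
proof -
  have z2: "(fst z)\<^sup>2 = 1 + snd z \<bullet> snd z"
    using z by (auto simp: model_space_curv qform_def)
  have w2: "(fst w)\<^sup>2 = snd w \<bullet> snd w"
    using w(1) by (simp add: lorentz_def power2_eq_square)
  have "(fst w)\<^sup>2 * (fst z)\<^sup>2 = (snd w \<bullet> snd z)\<^sup>2"
    using w(2) by (simp add: lorentz_def flip: power_mult_distrib)
  also have "\<dots> \<le> (snd w \<bullet> snd w) * (snd z \<bullet> snd z)"
    by (rule Cauchy_Schwarz_ineq)
  finally have "(fst w)\<^sup>2 \<le> 0"
    unfolding w2 z2 by (simp add: algebra_simps)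
  then have "fst w = 0" by simp
  then show ?thesis
    using w2 by (simp add: prod_eq_iff)
qed

lemma hyperbolic_segment_combination:
  assumes x: "x \<in> model_space Hyperbolic" and y: "y \<in> model_space Hyperbolic" and z:
      "z \<in> model_space Hyperbolic"
    and "lorentz x z = cosh a" "lorentz z y = cosh b" "lorentz x y = cosh (a + b)"
  shows "sinh (a + b) *\<^sub>R z = sinh b *\<^sub>R x + sinh a *\<^sub>R y"
proof -
  note xyz = hyperbolic_lorentz[OF x] hyperbolic_lorentz[OF y] hyperbolic_lorentz[OF z] assms(4-6)
    assms(4-6)[unfolded lorentz_commute[of x] lorentz_commute[of z y]]
  define w where "w = sinh (a + b) *\<^sub>R z - (sinh b *\<^sub>R x + sinh a *\<^sub>R y)"
  have "lorentz w w = (sinh (a + b))\<^sup>2 + (sinh b)\<^sup>2 + (sinh a)\<^sup>2 - 2 * sinh (a + b) * sinh b * cosh a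
      - 2 * sinh (a + b) * sinh a * cosh b + 2 * sinh a * sinh b * cosh (a + b)"
    unfolding w_def lorentz_simps xyz by (simp add: power2_eq_square algebra_simps)
  also have "\<dots> = (sinh b)\<^sup>2 * (1 - (cosh a)\<^sup>2 + (sinh a)\<^sup>2) + (sinh a)\<^sup>2 * (1 - (cosh b)\<^sup>2 + (sinh b)\<^sup>2)"
    unfolding sinh_add cosh_add by (simp add: power2_eq_square algebra_simps)
  also have "\<dots> = 0"
    by (simp add: cosh_square_eq)
  finally have "lorentz w w = 0" .
  moreover have "lorentz w z = 0"
    unfolding w_def lorentz_simps xyz sinh_add by (simp add: algebra_simps)
  ultimately show ?thesis
    using lorentz_orthogonal_null[OF z, of w] by (simp add: w_def)
qed

lemma gdist_spherical:
  assumes "x \<in> model_space Spherical" "y \<in> model_space Spherical"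
  shows "cos (gdist Spherical x y) = x \<bullet> y" "0 \<le> gdist Spherical x y" "gdist Spherical x y \<le> pi"
proof -
  have "norm x = 1" "norm y = 1"
    using assms by (auto simp: model_space.simps norm_eq_sqrt_inner)
  then have "\<bar>x \<bullet> y\<bar> \<le> 1"
    using Cauchy_Schwarz_ineq2[of x y] by simp
  then show "cos (gdist Spherical x y) = x \<bullet> y" "0 \<le> gdist Spherical x y" "gdist Spherical x y \<le> pi"
    by (auto simp: arccos_lbound arccos_ubound abs_le_iff)
qed

lemma gdist_hyperbolic:
  assumes "x \<in> model_space Hyperbolic" "y \<in> model_space Hyperbolic"
  shows "cosh (gdist Hyperbolic x y) = lorentz x y" "0 \<le> gdist Hyperbolic x y"
  using hyperbolic_lorentz_ge_1(1)[OF assms] by (auto simp: cosh_arcosh_real arcosh_nonneg_real)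

lemma spherical_inner_1_imp_eq:
  assumes "x \<in> model_space Spherical" "y \<in> model_space Spherical" "x \<bullet> y = 1"
  shows "x = y"
proof -
  have "(x - y) \<bullet> (x - y) = 0"
    using assms by (simp add: model_space.simps inner_diff_left inner_diff_right inner_commute)
  then show ?thesis by simp
qed

text \<open>
A point of the segment is a combination of the end points with nonnegative coefficients. On the
sphere the coefficients degenerate if the end points are antipodal, but then they do not lie in a
common open half-space.
\<close>

lemma segment_in_positive_side:
  assumes x: "x \<in> model_space G" "0 < v \<bullet> x" and y: "y \<in> model_space G" "0 < v \<bullet> y"
    and z: "z \<in> geodesic_segment G x y"
  shows "0 < v \<bullet> z"
proof -
  have zM: "z \<in> model_space G" and d: "gdist G x z + gdist G z y = gdist G x y"
    using z by (auto simp: geodesic_segment_def)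
  show ?thesis
  proof (cases G)
    case Euclidean
    then have "dist x y = dist x z + dist z y"
      using d by (simp add: dist_norm)
    then have "z \<in> closed_segment x y"
      by (simp add: between_mem_segment[symmetric] between)
    then obtain u where u: "0 \<le> u" "u \<le> 1" "z = (1 - u) *\<^sub>R x + u *\<^sub>R y"
      by (auto simp: closed_segment_def)
    show ?thesis
    proof (cases "u = 0")
      case False
      then show ?thesis
        using u x y by (simp add: inner_add_right add_nonneg_pos)
    qed (use u x in simp)
  next
    case Spherical
    note M = x(1)[unfolded Spherical] y(1)[unfolded Spherical] zM[unfolded Spherical]
    define a b where "a = gdist Spherical x z" and "b = gdist Spherical z y"
    have ab: "gdist Spherical x y = a + b"
      using d Spherical by (simp add: a_def b_def)
    note a = gdist_spherical[OF M(1,3), folded a_def] and b = gdist_spherical[OF M(3,2), folded b_def]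
      and t = gdist_spherical[OF M(1,2), unfolded ab]
    have comb: "sin (a + b) *\<^sub>R z = sin b *\<^sub>R x + sin a *\<^sub>R y"
      using M a b t by (intro spherical_segment_combination) (auto simp: model_space.simps)
    show ?thesis
    proof (cases "a + b = 0 \<or> a + b = pi")
      case True
      then show ?thesis
      proof
        assume "a + b = 0"
        then have "a = 0" using a b by linarith
        then have "x \<bullet> z = 1" using a by simp
        then show ?thesis using spherical_inner_1_imp_eq[OF M(1,3)] x by simp
      next
        assume "a + b = pi"
        then have "x \<bullet> (- y) = 1" using t by simp
        moreover have "- y \<in> model_space Spherical" using M(2) by (simp add: model_space.simps)
        ultimately have "x = - y" using spherical_inner_1_imp_eq[OF M(1)] by blast
        then show ?thesis using x y by simp
      qed
    next
      case False
      then have s: "0 < sin (a + b)"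
        using a b t by (intro sin_gt_zero) auto
      have sa: "0 \<le> sin a" "0 \<le> sin b"
        using a b by (auto intro: sin_ge_zero)
      have "sin a \<noteq> 0 \<or> sin b \<noteq> 0"
        using s by (auto simp: sin_add)
      then have "0 < sin b * (v \<bullet> x) + sin a * (v \<bullet> y)"
      proof -
        have "0 < sin b * (v \<bullet> x) \<or> 0 < sin a * (v \<bullet> y)"
          using sa x(2) y(2) \<open>sin a \<noteq> 0 \<or> sin b \<noteq> 0\<close> by (simp add: zero_less_mult_iff) linarith
        moreover have "0 \<le> sin b * (v \<bullet> x)" "0 \<le> sin a * (v \<bullet> y)"
          using sa x(2) y(2) by simp_all
        ultimately show ?thesis by linarith
      qed
      also have "\<dots> = sin (a + b) * (v \<bullet> z)"
        using arg_cong[OF comb, of "\<lambda>u. v \<bullet> u"] by (simp add: inner_add_right)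
      finally show ?thesis
        using s by (simp add: zero_less_mult_iff)
    qed
  next
    case Hyperbolic
    note M = x(1)[unfolded Hyperbolic] y(1)[unfolded Hyperbolic] zM[unfolded Hyperbolic]
    define a b where "a = gdist Hyperbolic x z" and "b = gdist Hyperbolic z y"
    have ab: "gdist Hyperbolic x y = a + b"
      using d Hyperbolic by (simp add: a_def b_def)
    note a = gdist_hyperbolic[OF M(1,3), folded a_def] and b = gdist_hyperbolic[OF M(3,2), folded b_def]
      and t = gdist_hyperbolic[OF M(1,2), unfolded ab]
    have comb: "sinh (a + b) *\<^sub>R z = sinh b *\<^sub>R x + sinh a *\<^sub>R y"
      using M a b t by (intro hyperbolic_segment_combination) auto
    show ?thesis
    proof (cases "a + b = 0")
      case True
      then have "a = 0" using a b by linarith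
      then have "lorentz x z = 1" using a by simp
      then have "x = z" using hyperbolic_lorentz_ge_1(2)[OF M(1,3)] by (cases "x = z") auto
      then show ?thesis using x by simp
    next
      case False
      then have s: "0 < sinh (a + b)"
        using t(2) by simp
      have sa: "0 \<le> sinh a" "0 \<le> sinh b"
        using a b by auto
      have "sinh a \<noteq> 0 \<or> sinh b \<noteq> 0"
        using s by (auto simp: sinh_add)
      then have "0 < sinh b * (v \<bullet> x) + sinh a * (v \<bullet> y)"
      proof -
        have "0 < sinh b * (v \<bullet> x) \<or> 0 < sinh a * (v \<bullet> y)"
          using sa x(2) y(2) \<open>sinh a \<noteq> 0 \<or> sinh b \<noteq> 0\<close> by (simp add: zero_less_mult_iff) linarith
        moreover have "0 \<le> sinh b * (v \<bullet> x)" "0 \<le> sinh a * (v \<bullet> y)"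
          using sa x(2) y(2) by simp_all
        ultimately show ?thesis by linarith
      qed
      also have "\<dots> = sinh (a + b) * (v \<bullet> z)"
        using arg_cong[OF comb, of "\<lambda>u. v \<bullet> u"] by (simp add: inner_add_right)
      finally show ?thesis
        using s by (simp add: zero_less_mult_iff)
    qed
  qed
qed

lemma path_crossing:
  fixes v :: "'a::euclidean_space" and p :: "real \<Rightarrow> 'a"
  assumes p: "continuous_on {0..t} p" and t: "0 \<le> t" and le: "v \<bullet> p 0 \<le> 0" "0 \<le> v \<bullet> p t"
  shows "\<exists>z\<in>p ` {0..t}. v \<bullet> z = 0"
proof -
  have "\<exists>s\<ge>0. s \<le> t \<and> v \<bullet> p s = 0"
    using le t by (intro IVT') (auto intro!: continuous_intros p)
  then show ?thesis by auto
qed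

text \<open>
A parametrized geodesic from \<open>x\<close> to \<open>y\<close> is continuous, so a linear function that changes sign between
its end points has a zero on it. One compact arc serves for all \<open>v\<close>, which makes the set of
hypersurfaces that hit the arc a generator of the hit-or-miss sigma-algebra.
\<close>

lemma crossing_compact_segment:
  fixes x y :: "'n::finite point"
  assumes x: "x \<in> model_space G" and y: "y \<in> model_space G" and na: "G = Spherical \<Longrightarrow> x \<noteq> - y"
  shows "\<exists>K. compact K \<and> K \<subseteq> geodesic_segment G x y \<and> (\<forall>v. v \<bullet> x \<le> 0 \<longrightarrow> 0 \<le> v \<bullet> y \<longrightarrow> (\<exists>z\<in>K. v \<bullet> z = 0))"
proof -
  have path: ?thesis
    if "continuous_on {0..t} p" "0 \<le> t" "p 0 = x" "p t = y" "\<And>s. 0 \<le> s \<Longrightarrow> s \<le> t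
        \<Longrightarrow> p s \<in> geodesic_segment G x y" for p and t :: real
    using that path_crossing[OF that(1,2)]
    by (intro exI[of _ "p ` {0..t}"]) (auto intro: compact_continuous_image)
  show ?thesis
  proof (cases "x = y")
    case True
    have "gdist G x x = 0"
      using x by (cases G) (auto simp: model_space.simps)
    then show ?thesis
      using True x by (intro exI[of _ "{x}"]) (auto simp: geodesic_segment_def)
  next
    case False
    show ?thesis
    proof (cases G)
      case Euclidean
      show ?thesis
      proof (rule path[of 1 "\<lambda>s. x + s *\<^sub>R (y - x)"])
        show "x + s *\<^sub>R (y - x) \<in> geodesic_segment G x y" if "0 \<le> s" "s \<le> 1" for s
        proof -
          have "y - (x + s *\<^sub>R (y - x)) = (1 - s) *\<^sub>R (y - x)"
            by (simp add: algebra_simps)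
          then have "norm (x + s *\<^sub>R (y - x) - y) = (1 - s) * norm (y - x)"
            using that by (metis abs_of_nonneg diff_ge_0_iff_ge norm_minus_commute norm_scaleR)
          moreover have "norm (x - (x + s *\<^sub>R (y - x))) = s * norm (y - x)"
            using that by simp
          ultimately have "norm (x - (x + s *\<^sub>R (y - x))) + norm (x + s *\<^sub>R (y - x) - y) = norm (x - y)"
            by (simp add: norm_minus_commute algebra_simps)
          moreover have "x + s *\<^sub>R (y - x) \<in> model_space G"
            using x y Euclidean by (simp add: model_space.simps inner_add_left inner_diff_left)
          ultimately show ?thesis
            using Euclidean by (simp add: geodesic_segment_def)
        qed
      qed (auto intro!: continuous_intros)
    next
      case Spherical
      note M = x[unfolded Spherical] y[unfolded Spherical]
      define t where "t = gdist Spherical x y"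
      note T = gdist_spherical[OF M, folded t_def]
      have "- y \<in> model_space Spherical" using M(2) by (simp add: model_space.simps)
      then have "t \<noteq> 0" "t \<noteq> pi"
        using T spherical_inner_1_imp_eq[OF M] spherical_inner_1_imp_eq[OF M(1), of
            "- y"] False na[OF Spherical] by auto
      then have t: "0 < t" "t < pi" using T by auto
      then have S: "0 < sin t" by (rule sin_gt_zero)
      define p where "p s = (sin (t - s) / sin t) *\<^sub>R x + (sin s / sin t) *\<^sub>R y" for s
      have xx: "x \<bullet> x = 1" "y \<bullet> y = 1" using M by (auto simp: model_space.simps)
      have px: "x \<bullet> p s = cos s" for s
      proof -
        have "x \<bullet> p s = (sin (t - s) + sin s * cos t) / sin t"
          using T(1) xx by (simp add: p_def inner_add_right add_divide_distrib)
        also have "\<dots> = cos s"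
          using S by (simp add: sin_diff field_simps)
        finally show ?thesis .
      qed
      have py: "p s \<bullet> y = cos (t - s)" for s
      proof -
        have "p s \<bullet> y = (sin (t - s) * cos t + sin s) / sin t"
          using T(1) xx by (simp add: p_def inner_add_left add_divide_distrib)
        also have "sin (t - s) * cos t + sin s = sin (t - s) * cos t + sin (t - (t - s))"
          by simp
        also have "\<dots> = sin t * cos (t - s)"
          unfolding sin_diff[of t "t - s"] by simp
        finally show ?thesis using S by simp
      qed
      have pp: "p s \<bullet> p s = 1" for s
      proof -
        have "p s \<bullet> p s = (sin (t - s) / sin t) * (x \<bullet> p s) + (sin s / sin t) * (p s \<bullet> y)"
          unfolding p_def[of s] by (simp add: inner_add_left inner_add_right inner_commute algebra_simps)
        also have "\<dots> = (sin (t - s) * cos s + cos (t - s) * sin s) / sin t"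
          unfolding px py by (simp add: add_divide_distrib mult.commute)
        also have "\<dots> = 1"
          using S by (simp add: sin_add[symmetric])
        finally show ?thesis .
      qed
      show ?thesis
      proof (rule path[of t p])
        show "continuous_on {0..t} p"
          unfolding p_def using S by (intro continuous_intros) auto
        show "p s \<in> geodesic_segment G x y" if "0 \<le> s" "s \<le> t" for s
        proof -
          have "arccos (cos s) = s" "arccos (cos (t - s)) = t - s"
            using that t by (auto intro!: arccos_cos)
          then show ?thesis
            using Spherical px[of s] py[of s] pp[of s] t_def
            by (simp add: geodesic_segment_def model_space.simps)
        qed
      qed (use S t in \<open>auto simp: p_def\<close>)
    next
      case Hyperbolic
      note M = x[unfolded Hyperbolic] y[unfolded Hyperbolic]
      define t where "t = gdist Hyperbolic x y"
      note T = gdist_hyperbolic[OF M, folded t_def]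
      have "t \<noteq> 0"
        using T(1) hyperbolic_lorentz_ge_1(2)[OF M False] by auto
      then have t: "0 < t" using T(2) by auto
      then have S: "0 < sinh t" by simp
      define p where "p s = (sinh (t - s) / sinh t) *\<^sub>R x + (sinh s / sinh t) *\<^sub>R y" for s
      note xx = hyperbolic_lorentz[OF M(1)] hyperbolic_lorentz[OF M(2)]
      have px: "lorentz x (p s) = cosh s" for s
      proof -
        have "lorentz x (p s) = (sinh (t - s) + sinh s * cosh t) / sinh t"
          using T(1) xx by (simp add: p_def lorentz_simps add_divide_distrib)
        also have "\<dots> = cosh s"
          using S by (simp add: sinh_diff field_simps)
        finally show ?thesis .
      qed
      have py: "lorentz (p s) y = cosh (t - s)" for s
      proof -
        have "lorentz (p s) y = (sinh (t - s) * cosh t + sinh s) / sinh t"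
          using T(1) xx by (simp add: p_def lorentz_simps add_divide_distrib)
        also have "sinh (t - s) * cosh t + sinh s = sinh (t - s) * cosh t + sinh (t - (t - s))"
          by simp
        also have "\<dots> = sinh t * cosh (t - s)"
          unfolding sinh_diff[of t "t - s"] by simp
        finally show ?thesis using S by simp
      qed
      have pp: "lorentz (p s) (p s) = 1" for s
      proof -
        have "lorentz (p s) (p s) = (sinh (t - s) / sinh t) * lorentz x (p s) + (sinh s / sinh t) *
            lorentz (p s) y"
          by (subst (1) p_def) (simp add: lorentz_simps lorentz_commute[of y])
        also have "\<dots> = (sinh (t - s) * cosh s + cosh (t - s) * sinh s) / sinh t"
          unfolding px py by (simp add: add_divide_distrib mult.commute)
        also have "\<dots> = 1"
          using S by (simp add: sinh_add[symmetric])
        finally show ?thesis .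
      qed
      show ?thesis
      proof (rule path[of t p])
        show "continuous_on {0..t} p"
          unfolding p_def using S by (intro continuous_intros) auto
        show "p s \<in> geodesic_segment G x y" if "0 \<le> s" "s \<le> t" for s
        proof -
          have "arcosh (cosh s) = s" "arcosh (cosh (t - s)) = t - s"
            using that by (auto intro!: arcosh_cosh_real)
          moreover have "0 < fst (p s)"
          proof -
            have "0 < fst x" "0 < fst y" using M by (auto simp: model_space_curv)
            moreover have "0 \<le> sinh (t - s)" "0 \<le> sinh s" "0 < sinh (t - s) \<or> 0 < sinh s"
              using that t by auto
            ultimately have "0 < sinh (t - s) * fst x + sinh s * fst y"
              by (auto intro: add_pos_nonneg add_nonneg_pos)
            moreover have "fst (p s) = (sinh (t - s) * fst x + sinh s * fst y) / sinh t"
              by (simp add: p_def add_divide_distrib)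
            ultimately show ?thesis
              using S by simp
          qed
          ultimately show ?thesis
            using Hyperbolic px[of s] py[of s] pp[of s] t_def
            by (simp add: geodesic_segment_def model_space.simps base_point_def inner_prod_def)
        qed
      qed (use S t in \<open>auto simp: p_def\<close>)
    qed
  qed
qed

section \<open>Hulls, hypersurfaces and balls\<close>

lemma segment_subset_conv:
  assumes "x \<in> X" "y \<in> X" "G = Spherical \<Longrightarrow> x \<noteq> - y"
  shows "geodesic_segment G x y \<subseteq> conv G X"
  using assms unfolding conv_def hull_def geodesically_convex_def by blast

lemma geodesically_convex_positive_side: "geodesically_convex G (model_space G \<inter> positive_side v)"
  unfolding geodesically_convex_def
proof (intro conjI ballI impI subsetI)
  fix x y z assume "x \<in> model_space G \<inter> positive_side v" "y \<in> model_space G \<inter> positive_side v"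
      "z \<in> geodesic_segment G x y"
  then show "z \<in> model_space G \<inter> positive_side v"
    using segment_in_positive_side[of x G v y z] by (simp add: geodesic_segment_def)
qed auto

lemma conv_subset_positive_side:
  assumes "X \<subseteq> model_space G" "\<And>x. x \<in> X \<Longrightarrow> 0 < v \<bullet> x"
  shows "conv G X \<subseteq> positive_side v"
proof -
  have "conv G X \<subseteq> model_space G \<inter> positive_side v"
    unfolding conv_def using assms by (intro hull_minimal geodesically_convex_positive_side) auto
  then show ?thesis by blast
qed

text \<open>
If all points of \<open>X\<close> lie in an open half-space, then so does the hull, because half-spaces are convex.
Otherwise two of them lie on opposite closed sides, and the segment between them is crossed.
\<close>

lemma conv_crosses_iff:
  assumes X: "X \<subseteq> model_space G" and na: "\<And>x y. x \<in> X \<Longrightarrow> y \<in> X \<Longrightarrow> G = Spherical \<Longrightarrow> x \<noteq> - y"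
  shows "section_by_normal G v \<inter> conv G X \<noteq> {} \<longleftrightarrow> (\<exists>x\<in>X. v \<bullet> x \<le> 0) \<and> (\<exists>x\<in>X. 0 \<le> v \<bullet> x)"
proof
  assume ne: "section_by_normal G v \<inter> conv G X \<noteq> {}"
  then obtain z where z: "z \<in> conv G X" "v \<bullet> z = 0"
    by (auto simp: section_by_normal_def)
  show "(\<exists>x\<in>X. v \<bullet> x \<le> 0) \<and> (\<exists>x\<in>X. 0 \<le> v \<bullet> x)"
  proof (intro conjI; rule ccontr)
    assume "\<not> (\<exists>x\<in>X. v \<bullet> x \<le> 0)"
    then show False
      using conv_subset_positive_side[OF X, of v] z by (force simp: not_le)
  next
    assume "\<not> (\<exists>x\<in>X. 0 \<le> v \<bullet> x)"
    then show False
      using conv_subset_positive_side[OF X, of "- v"] z by (force simp: not_le)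
  qed
next
  assume "(\<exists>x\<in>X. v \<bullet> x \<le> 0) \<and> (\<exists>x\<in>X. 0 \<le> v \<bullet> x)"
  then obtain x y where xy: "x \<in> X" "v \<bullet> x \<le> 0" "y \<in> X" "0 \<le> v \<bullet> y" by blast
  obtain K where K: "K \<subseteq> geodesic_segment G x y" "\<exists>z\<in>K. v \<bullet> z = 0"
    using crossing_compact_segment[of x G y] xy X na[OF xy(1,3)] by blast
  then obtain z where "z \<in> geodesic_segment G x y" "v \<bullet> z = 0" by blast
  then show "section_by_normal G v \<inter> conv G X \<noteq> {}"
    using segment_subset_conv[OF xy(1,3), of G] na[OF xy(1,3)]
    by (auto simp: section_by_normal_def geodesic_segment_def)
qed

lemma hypersurface_has_normal:
  fixes M :: "'n::finite point set"
  assumes "M \<in> hypersurfaces G"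
  obtains v where "M = section_by_normal G v"
proof -
  obtain E where E: "M = E \<inter> model_space G" "subspace E" "dim E = CARD('n)"
    using assms by (auto simp: hypersurfaces_def)
  then have "dim E < DIM('n point)"
    by simp
  then obtain v where v: "v \<noteq> 0" "span E \<subseteq> {x. v \<bullet> x = 0}"
    using lowdim_subset_hyperplane by blast
  have "E = {x. v \<bullet> x = 0}"
  proof (rule subspace_dim_equal)
    show "E \<subseteq> {x. v \<bullet> x = 0}"
      using v(2) span_superset[of E] by blast
    show "dim {x. v \<bullet> x = 0} \<le> dim E"
      using dim_hyperplane[OF v(1)] E(3) by simp
  qed (auto simp: E(2) subspace_hyperplane)
  then have "M = section_by_normal G v"
    using E(1) by (auto simp: section_by_normal_def)
  then show ?thesis by (rule that)
qed

text \<open>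
The dimension does not occur in the value, which is why the type is passed as an argument.
\<close>

definition normaliser :: "geometry \<Rightarrow> 'n::finite itself \<Rightarrow> ennreal" where
  "normaliser G T = inverse (emeasure (unnormalised_hypersurface_measure G) (normalising_set G :: 'n
      point set set))"

text \<open>
A hypersurface that meets the hull meets one of the finitely many compact arcs between points of
\<open>X\<close>; so the set of these hypersurfaces is measurable, and the hypersurface measure can be pulled back
to normals.
\<close>

lemma U1_conv:
  fixes X :: "'n::finite point set"
  assumes X: "X \<subseteq> model_space G" "finite X" and na: "\<And>x y. x \<in> X \<Longrightarrow> y \<in> X \<Longrightarrow> G = Spherical \<Longrightarrow> x \<noteq> - y"
  shows "U1 G (conv G X) = normaliser G TYPE('n) *
    emeasure lborel {v \<in> unit_normals G. (\<exists>x\<in>X. v \<bullet> x \<le> 0) \<and> (\<exists>x\<in>X. 0 \<le> v \<bullet> x)}"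
proof -
  define D where "D = {M \<in> hypersurfaces G. M \<inter> conv G X \<noteq> {}}"
  have iff: "section_by_normal G v \<inter> conv G X \<noteq> {} \<longleftrightarrow> (\<exists>x\<in>X. v \<bullet> x \<le> 0) \<and> (\<exists>x\<in>X. 0 \<le> v \<bullet> x)" for v
    using X(1) na by (rule conv_crosses_iff)
  have "\<forall>p\<in>X \<times> X. \<exists>K. compact K \<and> K \<subseteq> geodesic_segment G (fst p) (snd p) \<and>
     (\<forall>v. v \<bullet> fst p \<le> 0 \<longrightarrow> 0 \<le> v \<bullet> snd p \<longrightarrow> (\<exists>z\<in>K. v \<bullet> z = 0))"
  proof
    fix p assume "p \<in> X \<times> X"
    then have "fst p \<in> X" "snd p \<in> X" by auto
    then show "\<exists>K. compact K \<and> K \<subseteq> geodesic_segment G (fst p) (snd p) \<and>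
     (\<forall>v. v \<bullet> fst p \<le> 0 \<longrightarrow> 0 \<le> v \<bullet> snd p \<longrightarrow> (\<exists>z\<in>K. v \<bullet> z = 0))"
      using X(1) na by (intro crossing_compact_segment; blast)
  qed
  from bchoice[OF this] obtain K where K: "\<forall>p\<in>X \<times> X. compact (K p) \<and> K p
      \<subseteq> geodesic_segment G (fst p) (snd p) \<and>
     (\<forall>v. v \<bullet> fst p \<le> 0 \<longrightarrow> 0 \<le> v \<bullet> snd p \<longrightarrow> (\<exists>z\<in>K p. v \<bullet> z = 0))" ..
  have K_cross: "\<exists>z\<in>K (x, y). v \<bullet> z = 0" if "x \<in> X" "v \<bullet> x \<le> 0" "y \<in> X" "0 \<le> v \<bullet> y" for x y v
  proof -
    have "(x, y) \<in> X \<times> X"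
      using that by blast
    from bspec[OF K this, unfolded fst_conv snd_conv] show ?thesis
      using that by blast
  qed
  have KM: "K p \<subseteq> model_space G" if "p \<in> X \<times> X" for p
    using K that by (auto simp: geodesic_segment_def)
  have "D = (\<Union>p\<in>X \<times> X. {M \<in> hypersurfaces G. M \<inter> K p \<noteq> {}})"
  proof (intro set_eqI iffI)
    fix M assume M: "M \<in> D"
    then have "M \<in> hypersurfaces G" and Mc: "M \<inter> conv G X \<noteq> {}"
      by (simp_all add: D_def)
    then obtain v where v: "M = section_by_normal G v"
      by - (rule hypersurface_has_normal)
    obtain x y where xy: "x \<in> X" "v \<bullet> x \<le> 0" "y \<in> X" "0 \<le> v \<bullet> y"
      using Mc[unfolded v iff] by blast
    then have "\<exists>z\<in>K (x, y). v \<bullet> z = 0"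
      by (rule K_cross)
    then obtain z where "z \<in> K (x, y)" "v \<bullet> z = 0" ..
    then have "M \<inter> K (x, y) \<noteq> {}"
      using KM[of "(x, y)"] xy by (auto simp: v section_by_normal_def)
    then show "M \<in> (\<Union>p\<in>X \<times> X. {M \<in> hypersurfaces G. M \<inter> K p \<noteq> {}})"
      using M xy by (auto simp: D_def)
  next
    fix M assume "M \<in> (\<Union>p\<in>X \<times> X. {M \<in> hypersurfaces G. M \<inter> K p \<noteq> {}})"
    then obtain x y where M: "x \<in> X" "y \<in> X" "M \<in> hypersurfaces G" "M \<inter> K (x, y) \<noteq> {}"
      by (elim UN_E SigmaE CollectE conjE) simp
    have "K (x, y) \<subseteq> geodesic_segment G x y"
      using bspec[OF K, of "(x, y)"] M(1,2) by simp
    also have "\<dots> \<subseteq> conv G X"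
      using M(1,2) na by (intro segment_subset_conv) auto
    finally have "K (x, y) \<subseteq> conv G X" .
    then show "M \<in> D"
      using M by (auto simp: D_def)
  qed
  moreover have "{M \<in> hypersurfaces G. M \<inter> K p \<noteq> {}} \<in> sets (hypersurface_algebra G)" if "p \<in> X \<times> X" for p
    unfolding hypersurface_algebra_def using K KM[OF that] that
    by (subst sets_measure_of) (auto intro!: sigma_sets.Basic)
  ultimately have D: "D \<in> sets (hypersurface_algebra G)"
    using X(2) by (auto intro!: sets.finite_UN)
  let ?V = "{v. 0 < normal_form G v \<and> normal_form G v \<le> 1}"
  have sets_nu: "sets (unnormalised_hypersurface_measure G :: 'n point set measure)
      = sets (hypersurface_algebra G)"
    by (simp add: unnormalised_hypersurface_measure_def)
  have V: "?V \<in> sets borel"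
    using sets_unit_normals by (simp add: unit_normals_def)
  have "U1 G (conv G X) = (\<integral>\<^sup>+M. indicator D M \<partial>hypersurface_measure G)"
    unfolding U1_def
  proof (rule nn_integral_cong)
    fix M assume "M \<in> space (hypersurface_measure G :: 'n point set measure)"
    then have "M \<in> hypersurfaces G"
      by (simp add: hypersurface_measure_def Let_def space_scale_measure
          unnormalised_hypersurface_measure_def)
    then show "chi (conv G X \<inter> M) = indicator D M"
      by (auto simp: chi_def D_def indicator_def Int_commute)
  qed
  also have "\<dots> = emeasure (hypersurface_measure G) D"
    using D by (intro nn_integral_indicator) (simp add: hypersurface_measure_def Let_def sets_nu)
  also have "\<dots> = normaliser G TYPE('n) * emeasure (unnormalised_hypersurface_measure G) D"
    by (simp add: hypersurface_measure_def Let_def normaliser_def)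
  also have "emeasure (unnormalised_hypersurface_measure G) D
      = emeasure (restrict_space lborel ?V) (section_by_normal G -` D \<inter> space (restrict_space lborel ?V))"
    unfolding unnormalised_hypersurface_measure_def using D
        by (intro emeasure_distr section_by_normal_measurable)
  also have "section_by_normal G -` D \<inter> space (restrict_space lborel ?V)
      = {v \<in> unit_normals G. (\<exists>x\<in>X. v \<bullet> x \<le> 0) \<and> (\<exists>x\<in>X. 0 \<le> v \<bullet> x)}"
  proof (rule set_eqI)
    fix v
    show "v \<in> section_by_normal G -` D \<inter> space (restrict_space lborel ?V) \<longleftrightarrow>
        v \<in> {v \<in> unit_normals G. (\<exists>x\<in>X. v \<bullet> x \<le> 0) \<and> (\<exists>x\<in>X. 0 \<le> v \<bullet> x)}"
    proof (cases "v \<in> ?V")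
      case True
      then show ?thesis
        using section_by_normal_in_hypersurfaces[of G v] iff[of v]
        by (simp only: D_def vimage_eq Int_iff mem_Collect_eq space_restrict_space space_lborel
            unit_normals_def) simp
    next
      case False
      then have "v \<notin> unit_normals G" "v \<notin> space (restrict_space lborel ?V)"
        by (simp_all add: unit_normals_def space_restrict_space)
      then show ?thesis by blast
    qed
  qed
  also have "emeasure (restrict_space lborel ?V) \<dots> = emeasure lborel {v \<in> unit_normals G. (\<exists>x\<in>X. v \<bullet> x
      \<le> 0) \<and> (\<exists>x\<in>X. 0 \<le> v \<bullet> x)}"
    using V by (intro emeasure_restrict_space) (auto simp: unit_normals_def)
  finally show ?thesis .
qed

lemma gdist_mono_normal_form:
  assumes c: "c \<in> model_space G" and x: "x \<in> model_space G" and y: "y \<in> model_space G"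
    and le: "normal_form G (x - c) \<le> normal_form G (y - c)"
  shows "gdist G c x \<le> gdist G c y"
proof (cases G)
  case Spherical
  have n: "normal_form G (z - c) = 2 - 2 * (c \<bullet> z)" if "z \<in> model_space G" for z
    using that c Spherical by (simp add: model_space.simps inner_diff_left inner_diff_right inner_commute)
  have "cos (gdist Spherical c y) \<le> cos (gdist Spherical c x)"
    using n[OF x] n[OF y] le gdist_spherical(1)[of c x] gdist_spherical(1)[of c y] c x y Spherical
    by (simp del: gdist.simps)
  then show ?thesis
    using gdist_spherical(2,3)[of c x] gdist_spherical(2,3)[of c y] c x y Spherical
    by (subst (asm) cos_mono_le_eq) (simp_all del: gdist.simps)
next
  case Euclidean
  have n: "gdist G c z = sqrt (normal_form G (z - c))" if "z \<in> model_space G" for z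
  proof -
    have "fst z = fst c"
      using that c Euclidean by (auto simp: model_space_curv qform_def power2_eq_1_iff)
    then have "norm (c - z) = norm (snd (z - c))"
      by (simp add: norm_prod_def norm_minus_commute)
    then show ?thesis
      using Euclidean by (simp add: norm_eq_sqrt_inner)
  qed
  show ?thesis
    using le by (simp add: n x y)
next
  case Hyperbolic
  have n: "normal_form G (z - c) = 2 * lorentz c z - 2" if "z \<in> model_space G" for z
    using that c Hyperbolic by (simp add: model_space.simps lorentz_simps lorentz_commute[of z c])
  have "cosh (gdist Hyperbolic c x) \<le> cosh (gdist Hyperbolic c y)"
    using n[OF x] n[OF y] le gdist_hyperbolic(1)[of c x] gdist_hyperbolic(1)[of c y] c x y Hyperbolic
    by (simp del: gdist.simps)
  then show ?thesis
    using gdist_hyperbolic(2)[of c x] gdist_hyperbolic(2)[of c y] c x y Hyperbolic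
    by (subst (asm) cosh_real_nonneg_le_iff) (simp_all del: gdist.simps)
qed

lemma centred_geodesic_ball:
  assumes "c \<in> model_space G"
  shows "centred G c (geodesic_ball G c r)"
  unfolding centred_def geodesic_ball_def
proof (intro ballI impI)
  fix x y assume x: "x \<in> model_space G" and y: "y \<in> {x \<in> model_space G. gdist G c x \<le> r}"
    and le: "normal_form G (x - c) \<le> normal_form G (y - c)"
  from y have yM: "y \<in> model_space G" and yr: "gdist G c y \<le> r" by auto
  show "x \<in> {x \<in> model_space G. gdist G c x \<le> r}"
    using order_trans[OF gdist_mono_normal_form[OF assms x yM le] yr] x by blast
qed

text \<open>
A centred set is the preimage of an interval under \<open>x \<mapsto> normal_form G (x - c)\<close>.
\<close>

lemma sets_geodesic_ball:
  assumes "c \<in> model_space G"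
  shows "geodesic_ball G c r \<in> sets (volume G)"
proof -
  define L where "L = {s. \<exists>y\<in>geodesic_ball G c r. s \<le> normal_form G (y - c)}"
  have "is_interval L"
    by (auto simp: is_interval_1 L_def intro: order_trans)
  then have "L \<in> sets borel"
    by (rule real_interval_borel_measurable)
  moreover have "(\<lambda>x. normal_form G (x - c)) \<in> borel_measurable borel"
    using measurable_compose[OF borel_measurable_diff normal_form_measurable, of "\<lambda>x. x" borel "\<lambda>_. c"
        G] by simp
  ultimately have "(\<lambda>x. normal_form G (x - c)) -` L \<inter> space borel \<in> sets borel"
    by (rule measurable_sets[rotated])
  from sets_volume_Int[OF this, of G] have "{x. normal_form G (x
      - c) \<in> L} \<inter> model_space G \<in> sets (volume G)"
    by (simp add: vimage_def)
  moreover have "geodesic_ball G c r = {x. normal_form G (x - c) \<in> L} \<inter> model_space G"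
    using centred_geodesic_ball[OF assms, of r] by (auto simp: L_def centred_def geodesic_ball_def)
  ultimately show ?thesis by simp
qed

section \<open>The functional as an integral over hypersurfaces\<close>

interpretation product_volume: product_sigma_finite "\<lambda>_ :: 'i. volume G :: 'n::finite point measure" for G
  by standard

definition crossing_set :: "geometry \<Rightarrow> 'i set \<Rightarrow> ('i \<Rightarrow> 'n::finite point) \<Rightarrow> 'n point set" where
  "crossing_set G I x = {v \<in> unit_normals G. (\<exists>i\<in>I. v \<bullet> x i \<le> 0) \<and> (\<exists>i\<in>I. 0 \<le> v \<bullet> x i)}"

lemma sets_crossing_pairs:
  fixes G :: geometry and I :: "'i set"
  assumes I: "finite I"
  shows "{z \<in> space (PiM I (\<lambda>_. volume G :: 'n::finite point measure) \<Otimes>\<^sub>M lborel). snd z \<in> crossing_set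
      G I (fst z)}
    \<in> sets (PiM I (\<lambda>_. volume G) \<Otimes>\<^sub>M lborel)"
proof -
  let ?P = "PiM I (\<lambda>_. volume G :: 'n point measure) \<Otimes>\<^sub>M (lborel :: 'n point measure)"
  have comp: "(\<lambda>z. snd z \<bullet> fst z i) \<in> borel_measurable ?P" if "i \<in> I" for i
  proof (rule borel_measurable_inner)
    show "snd \<in> ?P \<rightarrow>\<^sub>M borel" by simp
    have "(\<lambda>z. fst z i) \<in> ?P \<rightarrow>\<^sub>M volume G"
      using measurable_compose[OF measurable_fst measurable_component_singleton[OF that]] .
    from measurable_compose[OF this measurable_volume_ident]
    show "(\<lambda>z. fst z i) \<in> ?P \<rightarrow>\<^sub>M borel" .
  qed
  have U: "{z \<in> space ?P. snd z \<in> unit_normals G} \<in> sets ?P"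
  proof -
    have "snd -` unit_normals G \<inter> space ?P \<in> sets ?P"
      by (rule measurable_sets[OF measurable_snd]) (simp add: sets_unit_normals)
    then show ?thesis
      by (simp add: vimage_def Int_def conj_commute)
  qed
  have le1: "{z \<in> space ?P. snd z \<bullet> fst z i \<le> 0} \<in> sets ?P" if "i \<in> I" for i
    using comp[OF that] unfolding borel_measurable_iff_le by blast
  have le2: "{z \<in> space ?P. 0 \<le> snd z \<bullet> fst z i} \<in> sets ?P" if "i \<in> I" for i
    using comp[OF that] unfolding borel_measurable_iff_ge by blast
  have "{z \<in> space ?P. \<exists>i\<in>I. snd z \<bullet> fst z i \<le> 0} \<in> sets ?P" "{z \<in> space ?P. \<exists>i\<in>I. 0
      \<le> snd z \<bullet> fst z i} \<in> sets ?P"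
    using I le1 le2 by (intro sets.sets_Collect_finite_Ex; blast)+
  with U have "{z \<in> space ?P. snd z \<in> unit_normals G \<and> (\<exists>i\<in>I. snd z \<bullet> fst z i \<le> 0) \<and> (\<exists>i\<in>I. 0
      \<le> snd z \<bullet> fst z i)} \<in> sets ?P"
    by (intro sets.sets_Collect_conj)
  then show ?thesis
    by (simp add: crossing_set_def)
qed

lemma sets_crossing_set:
  assumes "finite I"
  shows "crossing_set G I x \<in> sets borel"
proof -
  have "{v. v \<bullet> x i \<le> 0} \<in> sets borel" "{v. 0 \<le> v \<bullet> x i} \<in> sets borel" for i
    by (intro borel_closed closed_Collect_le continuous_intros)+
  then have "unit_normals G \<inter> (\<Union>i\<in>I. {v. v \<bullet> x i \<le> 0}) \<inter> (\<Union>i\<in>I. {v. 0 \<le> v \<bullet> x i}) \<in> sets borel"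
    using assms sets_unit_normals[of G] by (intro sets.Int sets.finite_UN) auto
  also have "unit_normals G \<inter> (\<Union>i\<in>I. {v. v \<bullet> x i \<le> 0}) \<inter> (\<Union>i\<in>I. {v. 0 \<le> v \<bullet> x i}) = crossing_set G I x"
    by (auto simp: crossing_set_def)
  finally show ?thesis .
qed

lemma measurable_emeasure_crossing_set:
  assumes "finite I"
  shows "(\<lambda>x. emeasure lborel (crossing_set G I x)) \<in> borel_measurable (PiM I (\<lambda>_. volume G ::
      'n::finite point measure))"
proof -
  let ?P = "PiM I (\<lambda>_. volume G :: 'n point measure) \<Otimes>\<^sub>M (lborel :: 'n point measure)"
  define Q where "Q = {z \<in> space ?P. snd z \<in> crossing_set G I (fst z)}"
  have "(\<lambda>x. emeasure lborel (Pair x -` Q)) \<in> borel_measurable (PiM I (\<lambda>_. volume G :: 'n point measure))"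
    unfolding Q_def using sets_crossing_pairs[OF assms] by (rule lborel.measurable_emeasure_Pair)
  moreover have "Pair x -` Q = crossing_set G I x" if
      "x \<in> space (PiM I (\<lambda>_. volume G :: 'n point measure))" for x
    using that by (auto simp: Q_def space_pair_measure)
  ultimately show ?thesis
    by (subst measurable_cong) (auto dest: sym)
qed

text \<open>
The functional \<open>I_functional\<close> without the normalising constant; see \<open>I_functional_crossing_integral\<close>.
\<close>

definition crossing_integral :: "geometry \<Rightarrow> 'i set \<Rightarrow> ('i \<Rightarrow> 'n::finite point \<Rightarrow> ennreal) \<Rightarrow> ennreal" where
  "crossing_integral G I h = (\<integral>\<^sup>+x. emeasure lborel (crossing_set G I x) * (\<Prod>i\<in>I. h i (x i)) \<partial>PiM I (\<lambda>_.
      volume G))"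

lemma AE_PiM_component:
  assumes I: "finite I" "i \<in> I" and P: "AE t in volume G. P t"
  shows "AE x in PiM I (\<lambda>_. volume G :: 'n::finite point measure). P (x i)"
proof -
  obtain N where N: "{t \<in> space (volume G). \<not> P t} \<subseteq> N" "N \<in> null_sets (volume G)"
    using P by (auto simp: eventually_ae_filter)
  let ?S = "PiE I (\<lambda>j. if j = i then N else model_space G)"
  have Nm: "(if j = i then N else model_space G) \<in> sets (volume G)" for j
    using N(2) sets.top[of "volume G"] by auto
  have "emeasure (PiM I (\<lambda>_. volume G :: 'n point measure)) ?S = (\<Prod>j\<in>I. emeasure (volume G) (if j
      = i then N else model_space G))"
    using I(1) Nm by (intro product_volume.emeasure_PiM) auto
  also have "\<dots> = 0"
    using I N(2) by (auto intro!: prod_zero)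
  finally have "?S \<in> null_sets (PiM I (\<lambda>_. volume G :: 'n point measure))"
    using Nm I(1) by (auto intro!: null_setsI sets_PiM_I_finite)
  moreover have "{x \<in> space (PiM I (\<lambda>_. volume G :: 'n point measure)). \<not> P (x i)} \<subseteq> ?S"
    using N(1) I(2) by (auto simp: space_PiM PiE_iff extensional_def split: if_splits)
  ultimately show ?thesis
    by (rule AE_I')
qed

text \<open>
When all points but one are fixed, the exceptional set contains at most one position of that point.
\<close>

lemma AE_PiM_not_antipodal:
  assumes I: "finite I" "i \<in> I" "j \<in> I" "i \<noteq> j"
  shows "AE x in PiM I (\<lambda>_. volume G :: 'n::finite point measure). x i \<noteq> - x j"
proof -
  define I' where "I' = I - {i}"
  have I': "finite I'" "i \<notin> I'" "j \<in> I'" "I = insert i I'"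
    using I by (auto simp: I'_def)
  let ?M = "\<lambda>_ :: 'a. volume G :: 'n point measure"
  define N where "N = {x \<in> space (PiM I ?M). x i = - x j}"
  have c: "(\<lambda>x. x k) \<in> PiM I ?M \<rightarrow>\<^sub>M borel" if "k \<in> I" for k
    using measurable_compose[OF measurable_component_singleton[OF that] measurable_volume_ident] .
  have N: "N \<in> sets (PiM I ?M)"
  proof -
    have "(\<lambda>x. x i + x j) \<in> PiM I ?M \<rightarrow>\<^sub>M borel"
      using I by (intro borel_measurable_add c)
    from measurable_sets[OF this, of "{0}"] have
        "(\<lambda>x. x i + x j) -` {0} \<inter> space (PiM I ?M) \<in> sets (PiM I ?M)"
      by simp
    moreover have "(\<lambda>x. x i + x j) -` {0} \<inter> space (PiM I ?M) = N"
      by (auto simp: N_def eq_neg_iff_add_eq_0)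
    ultimately show ?thesis by simp
  qed
  have "emeasure (PiM I ?M) N = (\<integral>\<^sup>+x. indicator N x \<partial>PiM I ?M)"
    using N by simp
  also have "\<dots> = (\<integral>\<^sup>+x. \<integral>\<^sup>+t. indicator N (x(i := t)) \<partial>volume G \<partial>PiM I' ?M)"
    unfolding I'(4) using N I' by (intro product_volume.product_nn_integral_insert) auto
  also have "\<dots> = (\<integral>\<^sup>+x. 0 \<partial>PiM I' ?M)"
  proof (rule nn_integral_cong)
    fix x assume "x \<in> space (PiM I' ?M)"
    have "(\<integral>\<^sup>+t. indicator N (x(i := t)) \<partial>volume G) = (\<integral>\<^sup>+t. 0 \<partial>(volume G :: 'n point measure))"
    proof (rule nn_integral_cong_AE)
      have "AE t in volume G. t \<noteq> - x j"
      proof (cases "- x j \<in> model_space G")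
        case True
        from AE_not_in[OF null_sets_singleton[OF True]] show ?thesis by simp
      next
        case False
        then show ?thesis by (intro AE_I2) auto
      qed
      then show "AE t in volume G. indicator N (x(i := t)) = (0 :: ennreal)"
        by eventually_elim (use I(4) in \<open>auto simp: N_def indicator_def\<close>)
    qed
    then show "(\<integral>\<^sup>+t. indicator N (x(i := t)) \<partial>volume G) = (0 :: ennreal)" by simp
  qed
  finally have "N \<in> null_sets (PiM I ?M)"
    using N by (auto intro: null_setsI)
  then show ?thesis
    by (rule AE_I') (auto simp: N_def)
qed

lemma AE_PiM_all_not_antipodal:
  assumes I: "finite I"
  shows "AE x in PiM I (\<lambda>_. volume G :: 'n::finite point measure). \<forall>i\<in>I. \<forall>j\<in>I. G = Spherical \<longrightarrow> x i \<noteq> - x j"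
proof -
  have "AE x in PiM I (\<lambda>_. volume G :: 'n point measure). G = Spherical \<longrightarrow> x i \<noteq> - x j" if "i \<in> I"
      "j \<in> I" for i j
  proof (cases "i = j")
    case True
    show ?thesis
    proof (intro AE_I2 impI)
      fix x assume x: "x \<in> space (PiM I (\<lambda>_. volume G :: 'n point measure))" and "G = Spherical"
      then have "x i \<bullet> x i = 1"
        using that(1) by (auto simp: space_PiM PiE_iff model_space.simps)
      show "x i \<noteq> - x j"
      proof
        assume "x i = - x j"
        then have "x i + x i = 0" using True by (simp add: eq_neg_iff_add_eq_0)
        then have "x i = 0" by (simp flip: scaleR_2)
        with \<open>x i \<bullet> x i = 1\<close> show False by simp
      qed
    qed
  next
    case False
    from AE_PiM_not_antipodal[OF I that False, of G] show ?thesis by eventually_elim simp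
  qed
  then show ?thesis
    using I by (intro AE_finite_allI) auto
qed

lemma measurable_prod_component:
  assumes "\<And>i. i \<in> I \<Longrightarrow> h i \<in> borel_measurable (volume G)"
  shows "(\<lambda>x. \<Prod>i\<in>I. h i (x i) :: ennreal) \<in> borel_measurable (PiM I (\<lambda>_. volume G :: 'n::finite point
      measure))"
proof (rule borel_measurable_prod_ennreal)
  fix i assume "i \<in> I"
  from measurable_compose[OF measurable_component_singleton[OF this] assms[OF this]]
  show "(\<lambda>x. h i (x i)) \<in> borel_measurable (PiM I (\<lambda>_. volume G :: 'n point measure))" .
qed

lemma measurable_crossing_integrand:
  assumes "finite I" "\<And>i. i \<in> I \<Longrightarrow> h i \<in> borel_measurable (volume G)"
  shows "(\<lambda>x. emeasure lborel (crossing_set G I x) * (\<Prod>i\<in>I. h i (x i))) \<in> borel_measurable (PiM I (\<lambda>_.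
      volume G :: 'n::finite point measure))"
  using measurable_emeasure_crossing_set[OF assms(1)] measurable_prod_component[of I h G] assms(2)
  by (intro borel_measurable_times_ennreal) auto

lemma I_functional_crossing_integral:
  fixes g :: "nat \<Rightarrow> 'n::finite point \<Rightarrow> real"
  assumes g: "\<And>i. i \<in> {1..N} \<Longrightarrow> g i \<in> borel_measurable (volume G)"
  shows "I_functional G N g = normaliser G TYPE('n) * crossing_integral G {1..N} (\<lambda>i x. ennreal (g i x))"
proof -
  let ?P = "PiM {1..N} (\<lambda>_. volume G :: 'n point measure)"
  have "I_functional G N g = (\<integral>\<^sup>+x. normaliser G TYPE('n) *
      (emeasure lborel (crossing_set G {1..N} x) * (\<Prod>i\<in>{1..N}. ennreal (g i (x i)))) \<partial>?P)"
    unfolding I_functional_def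
  proof (rule nn_integral_cong_AE)
    have "AE x in ?P. \<forall>i\<in>{1..N}. \<forall>j\<in>{1..N}. G = Spherical \<longrightarrow> x i \<noteq> - x j"
      by (rule AE_PiM_all_not_antipodal) simp
    then show "AE x in ?P. U1 G (conv G (x ` {1..N})) * (\<Prod>i\<in>{1..N}. ennreal (g i (x i)))
        = normaliser G TYPE('n) *
      (emeasure lborel (crossing_set G {1..N} x) * (\<Prod>i\<in>{1..N}. ennreal (g i (x i))))"
      using AE_space
    proof eventually_elim
      case (elim x)
      then have "x ` {1..N} \<subseteq> model_space G"
        by (auto simp: space_PiM PiE_iff)
      moreover have "p \<noteq> - q" if pq: "p \<in> x ` {1..N}" "q \<in> x ` {1..N}" "G = Spherical" for p q
      proof -
        obtain i where i: "i \<in> {1..N}" "p = x i"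
          using pq(1) by (elim imageE) simp
        obtain j where j: "j \<in> {1..N}" "q = x j"
          using pq(2) by (elim imageE) simp
        have "x i \<noteq> - x j"
          using bspec[OF bspec[OF elim(1) i(1)] j(1)] pq(3) by (rule mp)
        then show ?thesis
          using i(2) j(2) by simp
      qed
      ultimately have "U1 G (conv G (x ` {1..N})) = normaliser G TYPE('n) *
          emeasure lborel {v \<in> unit_normals G. (\<exists>p\<in>x ` {1..N}. v \<bullet> p \<le> 0) \<and> (\<exists>p\<in>x ` {1..N}. 0 \<le> v \<bullet> p)}"
        by (intro U1_conv) auto
      also have "{v \<in> unit_normals G. (\<exists>p\<in>x ` {1..N}. v \<bullet> p \<le> 0) \<and> (\<exists>p\<in>x ` {1..N}. 0 \<le> v \<bullet> p)}
          = crossing_set G {1..N} x"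
        by (auto simp: crossing_set_def)
      finally show ?case
        by (simp add: mult.assoc)
    qed
  qed
  also have "\<dots> = normaliser G TYPE('n) * crossing_integral G {1..N} (\<lambda>i x. ennreal (g i x))"
    unfolding crossing_integral_def
    using g by (intro nn_integral_cmult measurable_crossing_integrand) auto
  finally show ?thesis .
qed

section \<open>From functions to sets\<close>

text \<open>
\<open>\<Phi> t\<close> is the integral over all other points when the point with index \<open>i\<close> is at \<open>t\<close>.
\<close>

lemma crossing_integral_linear:
  fixes h :: "'i \<Rightarrow> 'n::finite point \<Rightarrow> ennreal"
  assumes I: "finite I" "i \<in> I" and h: "\<And>j. j \<in> I \<Longrightarrow> h j \<in> borel_measurable (volume G)"
  obtains \<Phi> where "\<Phi> \<in> borel_measurable (volume G)"
    "\<And>g. g \<in> borel_measurable (volume G) \<Longrightarrow> crossing_integral G I (h(i := g)) = (\<integral>\<^sup>+t. g t * \<Phi> t \<partial>volume G)"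
proof -
  define I' where "I' = I - {i}"
  have I': "finite I'" "i \<notin> I'" "I = insert i I'"
    using I by (auto simp: I'_def)
  let ?M = "\<lambda>_ :: 'i. volume G :: 'n point measure"
  interpret P': sigma_finite_measure "PiM I' ?M"
    by (rule product_volume.sigma_finite[OF I'(1)])
  define w where "w t x = emeasure lborel (crossing_set G I (x(i := t))) * (\<Prod>j\<in>I'. h j (x j))"
      for t and x :: "'i \<Rightarrow> 'n point"
  have w: "(\<lambda>(t, x). w t x) \<in> borel_measurable (volume G \<Otimes>\<^sub>M PiM I' ?M)"
  proof -
    have "(\<lambda>z. (snd z)(i := fst z)) \<in> volume G \<Otimes>\<^sub>M PiM I' ?M \<rightarrow>\<^sub>M PiM I ?M"
      using I' by (intro measurable_fun_upd[where J = I']) auto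
    from measurable_compose[OF this measurable_emeasure_crossing_set[OF I(1), of G]]
    have "(\<lambda>z. emeasure lborel (crossing_set G I ((snd z)(i := fst z)))) \<in> borel_measurable (volume G
        \<Otimes>\<^sub>M PiM I' ?M)" .
    moreover have "(\<lambda>z. \<Prod>j\<in>I'. h j (snd z j)) \<in> borel_measurable (volume G \<Otimes>\<^sub>M PiM I' ?M)"
      using h I'(3) by (intro measurable_compose[OF measurable_snd measurable_prod_component]) auto
    ultimately show ?thesis
      unfolding w_def split_beta by (rule borel_measurable_times_ennreal)
  qed
  define \<Phi> where "\<Phi> t = (\<integral>\<^sup>+x. w t x \<partial>PiM I' ?M)" for t
  show ?thesis
  proof (rule that[of \<Phi>])
    show "\<Phi> \<in> borel_measurable (volume G)"
      unfolding \<Phi>_def using w by (rule P'.borel_measurable_nn_integral)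
    fix g :: "'n point \<Rightarrow> ennreal" assume g: "g \<in> borel_measurable (volume G)"
    have hg: "(h(i := g)) j \<in> borel_measurable (volume G)" if "j \<in> I" for j
      using h[OF that] g by simp
    have "crossing_integral G I (h(i := g)) =
        (\<integral>\<^sup>+t. \<integral>\<^sup>+x. emeasure lborel (crossing_set G I (x(i := t))) * (\<Prod>j\<in>I. (h(i := g)) j ((x(i := t))
            j)) \<partial>PiM I' ?M \<partial>volume G)"
      unfolding crossing_integral_def I'(3)
    proof (rule product_volume.product_nn_integral_insert_rev[OF I'(1,2)])
      show "(\<lambda>x. emeasure lborel (crossing_set G (insert i I') x) * (\<Prod>j\<in>insert i I'. (h(i := g)) j (x j)))
          \<in> borel_measurable (PiM (insert i I') ?M)"
        unfolding I'(3)[symmetric] using I(1) hg by (rule measurable_crossing_integrand)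
    qed
    also have "\<dots> = (\<integral>\<^sup>+t. \<integral>\<^sup>+x. g t * w t x \<partial>PiM I' ?M \<partial>volume G)"
    proof (intro nn_integral_cong)
      fix t and x :: "'i \<Rightarrow> 'n point"
      have "(\<Prod>j\<in>I. (h(i := g)) j ((x(i := t)) j)) = g t * (\<Prod>j\<in>I'. h j (x j))"
      proof -
        have "(\<Prod>j\<in>I'. (h(i := g)) j ((x(i := t)) j)) = (\<Prod>j\<in>I'. h j (x j))"
          using I'(2) by (intro prod.cong) auto
        then show ?thesis
          unfolding I'(3) prod.insert[OF I'(1,2)] by simp
      qed
      then show "emeasure lborel (crossing_set G I (x(i := t))) * (\<Prod>j\<in>I. (h(i := g)) j ((x(i := t)) j))
          = g t * w t x"
        by (simp add: w_def mult_ac)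
    qed
    also have "\<dots> = (\<integral>\<^sup>+t. g t * \<Phi> t \<partial>volume G)"
    proof (rule nn_integral_cong)
      fix t assume t: "t \<in> space (volume G :: 'n point measure)"
      have "(\<lambda>x. w t x) \<in> borel_measurable (PiM I' ?M)"
        using measurable_compose[OF measurable_Pair1'[OF t] w] by simp
      then show "(\<integral>\<^sup>+x. g t * w t x \<partial>PiM I' ?M) = g t * \<Phi> t"
        unfolding \<Phi>_def by (rule nn_integral_cmult)
    qed
    finally show "crossing_integral G I (h(i := g)) = (\<integral>\<^sup>+t. g t * \<Phi> t \<partial>volume G)" .
  qed
qed

lemma replace_by_indicator:
  fixes h :: "'i \<Rightarrow> 'n::finite point \<Rightarrow> ennreal" and a :: real
  assumes I: "finite I" "i \<in> I" and h: "\<And>j. j \<in> I \<Longrightarrow> h j \<in> borel_measurable (volume G)"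
    and a: "0 < a" "\<And>x. h i x \<le> ennreal a"
  shows "\<exists>E :: 'n point set. E \<in> sets (volume G) \<and> ennreal a * emeasure (volume G) E
      = (\<integral>\<^sup>+x. h i x \<partial>volume G)
    \<and> crossing_integral G I (h(i := \<lambda>x. ennreal a * indicator E x)) \<le> crossing_integral G I h"
proof -
  obtain \<Phi> where \<Phi>: "\<Phi> \<in> borel_measurable (volume G)"
    and lin: "\<And>g. g \<in> borel_measurable (volume G) \<Longrightarrow> crossing_integral G I (h(i := g))
        = (\<integral>\<^sup>+t. g t * \<Phi> t \<partial>volume G)"
  proof (rule crossing_integral_linear[OF I h])
    fix \<Phi> assume 1: "\<Phi> \<in> borel_measurable (volume G)"
      and 2: "\<And>g. g \<in> borel_measurable (volume G) \<Longrightarrow> crossing_integral G I (h(i := g))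
          = (\<integral>\<^sup>+t. g t * \<Phi> t \<partial>volume G)"
    show thesis by (rule that[OF 1 2])
  qed
  obtain E where E: "E \<in> sets (volume G)" "ennreal a * emeasure (volume G) E = (\<integral>\<^sup>+x. h i x \<partial>volume G)"
    "ennreal a * (\<integral>\<^sup>+x\<in>E. \<Phi> x \<partial>volume G) \<le> (\<integral>\<^sup>+x. h i x * \<Phi> x \<partial>volume G)"
    using bathtub[OF a(1) h[OF I(2)] \<Phi> a(2)] by blast
  have "crossing_integral G I (h(i := \<lambda>x. ennreal a * indicator E x))
      = (\<integral>\<^sup>+t. ennreal a * indicator E t * \<Phi> t \<partial>volume G)"
    using E(1) by (intro lin) simp
  also have "\<dots> = (\<integral>\<^sup>+t. ennreal a * (\<Phi> t * indicator E t) \<partial>volume G)"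
    by (intro nn_integral_cong) (simp add: mult_ac)
  also have "\<dots> = ennreal a * (\<integral>\<^sup>+x\<in>E. \<Phi> x \<partial>volume G)"
    using \<Phi> E(1) by (intro nn_integral_cmult) simp
  also have "\<dots> \<le> (\<integral>\<^sup>+x. h i x * \<Phi> x \<partial>volume G)"
    by (rule E(3))
  also have "\<dots> = crossing_integral G I (h(i := h i))"
    using h[OF I(2)] by (rule lin[symmetric])
  finally show ?thesis
    using E(1,2) by auto
qed

text \<open>
The functions are replaced one after the other: the kernel \<open>\<Phi>\<close> of \<open>crossing_integral_linear\<close> for one
index depends on the functions that the others have at that moment.
\<close>

lemma exists_indicators_below:
  fixes h :: "'i \<Rightarrow> 'n::finite point \<Rightarrow> ennreal" and a :: "'i \<Rightarrow> real"
  assumes I: "finite I" and h: "\<And>j. j \<in> I \<Longrightarrow> h j \<in> borel_measurable (volume G)"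
    and a: "\<And>i. i \<in> I \<Longrightarrow> 0 < a i" "\<And>i x. i \<in> I \<Longrightarrow> h i x \<le> ennreal (a i)"
  shows "\<exists>E :: 'i \<Rightarrow> 'n point set. (\<forall>i\<in>I. E i \<in> sets (volume G)
      \<and> ennreal (a i) * emeasure (volume G) (E i) = (\<integral>\<^sup>+x. h i x \<partial>volume G))
    \<and> crossing_integral G I (\<lambda>i x. ennreal (a i) * indicator (E i) x) \<le> crossing_integral G I h"
proof -
  have cong: "crossing_integral G I h1 = crossing_integral G I h2" if "\<And>i. i \<in> I \<Longrightarrow> h1 i = h2 i"
      for h1 h2 :: "'i \<Rightarrow> 'n point \<Rightarrow> ennreal"
    unfolding crossing_integral_def using that by (intro nn_integral_cong) (simp cong: prod.cong)
  have "\<exists>E :: 'i \<Rightarrow> 'n point set. (\<forall>i\<in>J. E i \<in> sets (volume G)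
      \<and> ennreal (a i) * emeasure (volume G) (E i) = (\<integral>\<^sup>+x. h i x \<partial>volume G))
    \<and> crossing_integral G I (\<lambda>i. if i \<in> J then (\<lambda>x. ennreal (a i) * indicator (E i) x) else h i)
        \<le> crossing_integral G I h"
    if "finite J" "J \<subseteq> I" for J
    using that
  proof (induction J rule: finite_induct)
    case empty
    then show ?case by simp
  next
    case (insert i J)
    then have J: "J \<subseteq> I" "i \<in> I" "i \<notin> J" by auto
    obtain E where E: "\<forall>i\<in>J. E i \<in> sets (volume G) \<and> ennreal (a i) * emeasure (volume G) (E i)
        = (\<integral>\<^sup>+x. h i x \<partial>volume G)"
      "crossing_integral G I (\<lambda>i. if i \<in> J then (\<lambda>x. ennreal (a i) * indicator (E i) x) else h i)
          \<le> crossing_integral G I h"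
      using insert.IH[OF J(1)] by blast
    define k where "k j = (if j \<in> J then (\<lambda>x. ennreal (a j) * indicator (E j) x) else h j)" for j
    have km: "k j \<in> borel_measurable (volume G)" if "j \<in> I" for j
    proof (cases "j \<in> J")
      case True
      then have "E j \<in> sets (volume G)"
        using E(1) by blast
      then show ?thesis
        using True by (simp add: k_def)
    qed (use h[OF that] in \<open>simp add: k_def\<close>)
    have ki: "k i = h i"
      using J(3) by (simp add: k_def)
    have "\<exists>S :: 'n point set. S \<in> sets (volume G) \<and> ennreal (a i) * emeasure (volume G) S
        = (\<integral>\<^sup>+x. k i x \<partial>volume G)
      \<and> crossing_integral G I (k(i := \<lambda>x. ennreal (a i) * indicator S x)) \<le> crossing_integral G I k"
      using a(2)[OF J(2)] by (intro replace_by_indicator I J(2) km a(1)) (simp_all add: ki)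
    then obtain S where S: "S \<in> sets (volume G)" "ennreal (a i) * emeasure (volume G) S
        = (\<integral>\<^sup>+x. k i x \<partial>volume G)"
      "crossing_integral G I (k(i := \<lambda>x. ennreal (a i) * indicator S x)) \<le> crossing_integral G I k"
      by blast
    have eq: "(\<lambda>j. if j \<in> insert i J then (\<lambda>x. ennreal (a j) * indicator ((E(i := S)) j) x) else h j)
        = k(i := \<lambda>x. ennreal (a i) * indicator S x)"
      using J(3) by (auto simp: k_def fun_eq_iff)
    show ?case
    proof (intro exI[of _ "E(i := S)"] conjI)
      show "\<forall>j\<in>insert i J. (E(i := S)) j \<in> sets (volume G)
          \<and> ennreal (a j) * emeasure (volume G) ((E(i := S)) j) = (\<integral>\<^sup>+x. h j x \<partial>volume G)"
        using E(1) S(1,2) J(3) ki by auto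
      show "crossing_integral G I (\<lambda>j. if j \<in> insert i J then (\<lambda>x. ennreal (a j) * indicator ((E(i :=
          S)) j) x) else h j) \<le> crossing_integral G I h"
        unfolding eq using order_trans[OF S(3)] E(2) by (simp add: k_def[abs_def])
    qed
  qed
  from this[OF I subset_refl] obtain E where E: "\<forall>i\<in>I. E i \<in> sets (volume G)
      \<and> ennreal (a i) * emeasure (volume G) (E i) = (\<integral>\<^sup>+x. h i x \<partial>volume G)"
      "crossing_integral G I (\<lambda>i. if i \<in> I then (\<lambda>x. ennreal (a i) * indicator (E i) x) else h i)
          \<le> crossing_integral G I h"
    by (elim exE conjE)
  have "crossing_integral G I (\<lambda>i. if i \<in> I then (\<lambda>x. ennreal (a i) * indicator (E i) x) else h i)
      = crossing_integral G I (\<lambda>i x. ennreal (a i) * indicator (E i) x)"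
    by (rule cong) simp
  with E(2) have "crossing_integral G I (\<lambda>i x. ennreal (a i) * indicator (E i) x) \<le> crossing_integral G I h"
    by (simp only:)
  with E(1) have "(\<forall>i\<in>I. E i \<in> sets (volume G) \<and> ennreal (a i) * emeasure (volume G) (E i)
      = (\<integral>\<^sup>+x. h i x \<partial>volume G))
    \<and> crossing_integral G I (\<lambda>i x. ennreal (a i) * indicator (E i) x) \<le> crossing_integral G I h"
    by (rule conjI)
  note below = this
  show ?thesis
    by (rule exI[of _ E], rule below)
qed

text \<open>
The tuples that \<open>v\<close> fails to separate form two disjoint products, one for each open half-space.
\<close>

lemma emeasure_crossing_product:
  fixes E :: "'i \<Rightarrow> 'n::finite point set"
  assumes I: "finite I" "I \<noteq> {}" and v: "v \<in> unit_normals G"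
    and E: "\<And>i. i \<in> I \<Longrightarrow> E i \<in> sets (volume G)" "\<And>i. i \<in> I \<Longrightarrow> emeasure (volume G) (E i) < \<infinity>"
  shows "emeasure (PiM I (\<lambda>_. volume G)) {x \<in> PiE I E. v \<in> crossing_set G I x}
      = ennreal (separation G I E v)"
proof -
  let ?P = "PiM I (\<lambda>_. volume G :: 'n point measure)"
  let ?p = "\<lambda>u. PiE I (\<lambda>i. E i \<inter> positive_side u)"
  have fin: "emeasure (volume G) (E i \<inter> positive_side u) < \<infinity>" if "i \<in> I" for i u
    using emeasure_mono[of "E i \<inter> positive_side u" "E i" "volume G"] E[OF that]
        by (auto simp: le_less_trans)
  have whole: "emeasure ?P (PiE I E) = ennreal (\<Prod>i\<in>I. mass G (E i))"
  proof -
    have "emeasure ?P (PiE I E) = (\<Prod>i\<in>I. emeasure (volume G) (E i))"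
      using I(1) E(1) by (rule product_volume.emeasure_PiM)
    also have "\<dots> = (\<Prod>i\<in>I. ennreal (mass G (E i)))"
      using E(2) by (intro prod.cong refl emeasure_eq_ennreal_measure) (auto simp: less_top)
    finally show ?thesis by (simp add: prod_ennreal)
  qed
  have side: "emeasure ?P (?p u) = ennreal (\<Prod>i\<in>I. mass G (E i \<inter> positive_side u))" for u
  proof -
    have "emeasure ?P (?p u) = (\<Prod>i\<in>I. emeasure (volume G) (E i \<inter> positive_side u))"
      using I(1) E(1) by (intro product_volume.emeasure_PiM sets_positive_side)
    also have "\<dots> = (\<Prod>i\<in>I. ennreal (mass G (E i \<inter> positive_side u)))"
      using fin[of _ u] by (intro prod.cong refl emeasure_eq_ennreal_measure) (auto simp: less_top)
    finally show ?thesis by (simp add: prod_ennreal)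
  qed
  have sets: "PiE I E \<in> sets ?P" "?p u \<in> sets ?P" for u
    using I(1) E(1) by (auto intro!: sets_PiM_I_finite sets_positive_side)
  obtain i where i: "i \<in> I" using I(2) by blast
  have disj: "?p v \<inter> ?p (- v) = {}"
  proof (rule ccontr)
    assume "?p v \<inter> ?p (- v) \<noteq> {}"
    then obtain x where "x \<in> ?p v" "x \<in> ?p (- v)" by blast
    then have "0 < v \<bullet> x i" "0 < - v \<bullet> x i"
      using i by (auto simp: PiE_iff)
    then show False by simp
  qed
  have sub: "?p v \<union> ?p (- v) \<subseteq> PiE I E"
    by (auto simp: PiE_iff)
  have eq: "{x \<in> PiE I E. v \<in> crossing_set G I x} = PiE I E - (?p v \<union> ?p (- v))"
  proof (rule set_eqI)
    fix x
    show "x \<in> {x \<in> PiE I E. v \<in> crossing_set G I x} \<longleftrightarrow> x \<in> PiE I E - (?p v \<union> ?p (- v))"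
    proof (cases "x \<in> PiE I E")
      case True
      have side_iff: "x \<in> ?p u \<longleftrightarrow> (\<forall>i\<in>I. 0 < u \<bullet> x i)" for u
        using True by (simp add: PiE_iff)
      have cross_iff: "v \<in> crossing_set G I x \<longleftrightarrow> \<not> (\<forall>i\<in>I. 0 < v \<bullet> x i) \<and> \<not> (\<forall>i\<in>I. 0 < - v \<bullet> x i)"
        using v by (simp add: crossing_set_def not_less)
      show ?thesis
        using True by (simp only: mem_Collect_eq Diff_iff Un_iff side_iff cross_iff) blast
    qed simp
  qed
  have "emeasure ?P (?p v \<union> ?p (- v)) = ennreal (\<Prod>i\<in>I. mass G (E i \<inter> positive_side v)) + ennreal (\<Prod>i\<in>I.
      mass G (E i \<inter> positive_side (- v)))"
    unfolding side[symmetric] using disj sets by (intro plus_emeasure[symmetric])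
  also have "\<dots> = ennreal ((\<Prod>i\<in>I. mass G (E i \<inter> positive_side v)) + (\<Prod>i\<in>I. mass G (E i \<inter> positive_side (-
      v))))"
    by (intro ennreal_plus[symmetric] prod_nonneg) auto
  finally have un: "emeasure ?P (?p v \<union> ?p (- v))
      = ennreal ((\<Prod>i\<in>I. mass G (E i \<inter> positive_side v)) + (\<Prod>i\<in>I. mass G (E i \<inter> positive_side (- v))))" .
  have "emeasure ?P (PiE I E - (?p v \<union> ?p (- v))) = emeasure ?P (PiE I E) - emeasure ?P (?p v \<union> ?p (- v))"
    using sets(1) sub un sets.Un[OF sets(2)[of v] sets(2)[of "- v"]]
    by (intro emeasure_Diff) simp_all
  also have "\<dots> = ennreal (separation G I E v)"
    unfolding whole un separation_def by (subst ennreal_minus) (auto intro!: add_nonneg_nonneg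
        prod_nonneg simp: diff_diff_add)
  finally show ?thesis
    unfolding eq .
qed

lemma crossing_integral_indicator:
  fixes E :: "'i \<Rightarrow> 'n::finite point set" and a :: "'i \<Rightarrow> ennreal"
  assumes I: "finite I" "I \<noteq> {}"
    and E: "\<And>i. i \<in> I \<Longrightarrow> E i \<in> sets (volume G)" "\<And>i. i \<in> I \<Longrightarrow> emeasure (volume G) (E i) < \<infinity>"
  shows "crossing_integral G I (\<lambda>i x. a i * indicator (E i) x) = (\<Prod>i\<in>I. a i) * crossing_energy G I E"
proof -
  let ?P = "PiM I (\<lambda>_. volume G :: 'n point measure)"
  interpret P: sigma_finite_measure ?P
    by (rule product_volume.sigma_finite[OF I(1)])
  interpret PL: pair_sigma_finite ?P "lborel :: 'n point measure" ..
  let ?Q = "{z \<in> space (?P \<Otimes>\<^sub>M lborel). snd z \<in> crossing_set G I (fst z)}"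
  define K where "K x v = (indicator ?Q (x, v) * indicator (PiE I E) x :: ennreal)" for x v
  have sE: "PiE I E \<in> sets ?P"
    using I(1) E(1) by (auto intro!: sets_PiM_I_finite)
  have K: "case_prod K \<in> borel_measurable (?P \<Otimes>\<^sub>M lborel)"
  proof -
    have "(\<lambda>z. indicator ?Q z * indicator (PiE I E) (fst z) :: ennreal) \<in> borel_measurable (?P \<Otimes>\<^sub>M lborel)"
      using sets_crossing_pairs[OF I(1), of G] sE
      by (intro borel_measurable_times_ennreal borel_measurable_indicator measurable_compose[OF
          measurable_fst])
    moreover have "case_prod K = (\<lambda>z. indicator ?Q z * indicator (PiE I E) (fst z))"
      by (simp add: K_def fun_eq_iff split_beta)
    ultimately show ?thesis by (simp only:)
  qed
  have "crossing_integral G I (\<lambda>i x. a i * indicator (E i) x)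
      = (\<integral>\<^sup>+x. (\<Prod>i\<in>I. a i) * (\<integral>\<^sup>+v. K x v \<partial>lborel) \<partial>?P)"
    unfolding crossing_integral_def
  proof (rule nn_integral_cong)
    fix x assume x: "x \<in> space ?P"
    have ind: "(\<Prod>i\<in>I. indicator (E i) (x i)) = (indicator (PiE I E) x :: ennreal)"
    proof (cases "x \<in> PiE I E")
      case False
      then obtain i where "i \<in> I" "x i \<notin> E i"
        using x by (auto simp: space_PiM PiE_iff)
      then have "(\<Prod>i\<in>I. indicator (E i) (x i)) = (0 :: ennreal)"
        using I(1) by (intro prod_zero bexI[of _ i]) auto
      then show ?thesis using False by simp
    qed (auto simp: PiE_iff)
    have "(\<integral>\<^sup>+v. K x v \<partial>lborel) = (\<integral>\<^sup>+v. indicator (PiE I E) x * indicator (crossing_set G I x) v \<partial>lborel)"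
      using x by (intro nn_integral_cong) (simp add: K_def indicator_def space_pair_measure)
    also have "\<dots> = indicator (PiE I E) x * emeasure lborel (crossing_set G I x)"
      using sets_crossing_set[OF I(1), of G x] by (intro nn_integral_cmult_indicator) simp
    finally have "(\<integral>\<^sup>+v. K x v \<partial>lborel) = indicator (PiE I E) x * emeasure lborel (crossing_set G I x)" .
    then show "emeasure lborel (crossing_set G I x) * (\<Prod>i\<in>I. a i * indicator (E i) (x i))
        = (\<Prod>i\<in>I. a i) * (\<integral>\<^sup>+v. K x v \<partial>lborel)"
      by (simp add: prod.distrib ind mult_ac)
  qed
  also have "\<dots> = (\<Prod>i\<in>I. a i) * (\<integral>\<^sup>+x. \<integral>\<^sup>+v. K x v \<partial>lborel \<partial>?P)"
    using K by (intro nn_integral_cmult lborel.borel_measurable_nn_integral)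
  also have "(\<integral>\<^sup>+x. \<integral>\<^sup>+v. K x v \<partial>lborel \<partial>?P) = (\<integral>\<^sup>+v. \<integral>\<^sup>+x. K x v \<partial>?P \<partial>lborel)"
    using PL.Fubini'[OF K] by simp
  also have "\<dots> = crossing_energy G I E"
    unfolding crossing_energy_def
  proof (rule nn_integral_cong)
    fix v :: "'n point"
    show "(\<integral>\<^sup>+x. K x v \<partial>?P) = ennreal (separation G I E v) * indicator (unit_normals G) v"
    proof (cases "v \<in> unit_normals G")
      case True
      have PE: "PiE I E \<subseteq> space ?P"
        using sE by (rule sets.sets_into_space)
      have "{x \<in> space ?P. v \<in> crossing_set G I x} \<in> sets ?P"
      proof -
        have "(\<lambda>x. (x, v)) -` ?Q \<inter> space ?P \<in> sets ?P"
          by (rule measurable_sets[OF measurable_Pair2' sets_crossing_pairs[OF I(1)]]) simp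
        moreover have "(\<lambda>x. (x, v)) -` ?Q \<inter> space ?P = {x \<in> space ?P. v \<in> crossing_set G I x}"
          by (auto simp: space_pair_measure)
        ultimately show ?thesis by simp
      qed
      then have "{x \<in> space ?P. v \<in> crossing_set G I x} \<inter> PiE I E \<in> sets ?P"
        using sE by simp
      also have "{x \<in> space ?P. v \<in> crossing_set G I x} \<inter> PiE I E = {x \<in> PiE I E. v \<in> crossing_set G I x}"
        using PE by auto
      finally have S: "{x \<in> PiE I E. v \<in> crossing_set G I x} \<in> sets ?P" .
      have "(\<integral>\<^sup>+x. K x v \<partial>?P) = (\<integral>\<^sup>+x. indicator {x \<in> PiE I E. v \<in> crossing_set G I x} x \<partial>?P)"
        by (intro nn_integral_cong) (auto simp: K_def indicator_def space_pair_measure)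
      also have "\<dots> = emeasure ?P {x \<in> PiE I E. v \<in> crossing_set G I x}"
        using S by simp
      also have "\<dots> = ennreal (separation G I E v)"
        using I True E by (rule emeasure_crossing_product)
      finally show ?thesis using True by simp
    next
      case False
      then have "K x v = 0" for x
        by (simp add: K_def crossing_set_def)
      then show ?thesis using False by simp
    qed
  qed
  finally show ?thesis .
qed

theorem theorem1p1:
  fixes G :: geometry and N :: nat
    and f :: "nat \<Rightarrow> 'n::finite point \<Rightarrow> real"
    and c :: "'n point" and r :: "nat \<Rightarrow> real"
  assumes nonneg: "\<And>i x. i \<in> {1..N} \<Longrightarrow> x \<in> model_space G \<Longrightarrow> 0 \<le> f i x"
    and bounded: "\<And>i. i \<in> {1..N} \<Longrightarrow> bounded (f i ` model_space G)"
    and integrable: "\<And>i. i \<in> {1..N} \<Longrightarrow> integrable (volume G) (f i)"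
    and nonzero: "\<And>i. i \<in> {1..N} \<Longrightarrow> Linf_norm G (f i) > 0"
    and proper: "\<And>i. i \<in> {1..N} \<Longrightarrow> G = Spherical \<Longrightarrow> proper_support (f i)"
    and centre: "c \<in> model_space G"
    and volume_balls: "\<And>i. i \<in> {1..N} \<Longrightarrow>
      emeasure (volume G) (geodesic_ball G c (r i)) = ennreal (L1_norm G (f i) / Linf_norm G (f i))"
  shows "I_functional G N f \<ge>
    I_functional G N (\<lambda>i x. Linf_norm G (f i) * indicator (geodesic_ball G c (r i)) x)"
proof (cases "N = 0")
  case True
  then show ?thesis
    by (simp add: I_functional_def)
next
  case False
  let ?I = "{1..N}"
  let ?P = "PiM ?I (\<lambda>_. volume G :: 'n point measure)"
  define a where "a i = Linf_norm G (f i)" for i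
  define B where "B i = geodesic_ball G c (r i)" for i
  have I: "finite ?I" "?I \<noteq> {}"
    using False by auto
  have a: "0 < a i" if "i \<in> ?I" for i
    using nonzero[OF that] by (simp add: a_def)
  have fm: "f i \<in> borel_measurable (volume G)" if "i \<in> ?I" for i
    using integrable[OF that] by simp
  have B: "B i \<in> sets (volume G)" "centred G c (B i)" for i
    unfolding B_def by (rule sets_geodesic_ball[OF centre], rule centred_geodesic_ball[OF centre])
  have fB: "emeasure (volume G) (B i) < \<infinity>" if "i \<in> ?I" for i
    using volume_balls[OF that] by (simp add: B_def)
  have AE_le: "AE x in volume G. ennreal (f i x) \<le> ennreal (a i)" if i: "i \<in> ?I" for i
  proof -
    let ?s = "esssup (volume G) (\<lambda>x. ereal \<bar>f i x\<bar>)"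
    have "0 < real_of_ereal ?s"
      using nonzero[OF i] by (simp add: Linf_norm_def)
    then have "?s = ereal (a i)"
      by (cases ?s) (auto simp: a_def Linf_norm_def)
    moreover have "AE x in volume G. ereal \<bar>f i x\<bar> \<le> ?s"
      using fm[OF i] by (intro esssup_AE)
    ultimately show ?thesis
      by (auto elim!: eventually_mono intro!: ennreal_leI)
  qed
  \<comment> \<open>the bound by the essential supremum, which holds almost everywhere for \<open>f i\<close>, holds everywhere for
    \<open>h i\<close>\<close>
  define h where "h i x = min (ennreal (f i x)) (ennreal (a i))" for i x
  have hm: "h i \<in> borel_measurable (volume G)" if "i \<in> ?I" for i
    unfolding h_def using fm[OF that] by simp
  have hf: "AE x in volume G. h i x = ennreal (f i x)" if "i \<in> ?I" for i
    using AE_le[OF that] by eventually_elim (simp add: h_def min_absorb1)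
  have int_h: "(\<integral>\<^sup>+x. h i x \<partial>volume G) = ennreal (L1_norm G (f i))" if i: "i \<in> ?I" for i
  proof -
    have "(\<integral>\<^sup>+x. h i x \<partial>volume G) = (\<integral>\<^sup>+x. ennreal \<bar>f i x\<bar> \<partial>volume G)"
    proof (rule nn_integral_cong_AE)
      show "AE x in volume G. h i x = ennreal \<bar>f i x\<bar>"
        using hf[OF i] AE_space by eventually_elim (simp add: nonneg[OF i])
    qed
    also have "\<dots> = ennreal (L1_norm G (f i))"
      unfolding L1_norm_def using integrable[OF i] by (intro nn_integral_eq_integral) auto
    finally show ?thesis .
  qed
  have "\<exists>E :: nat \<Rightarrow> 'n point set. (\<forall>i\<in>?I. E i \<in> sets (volume G)
      \<and> ennreal (a i) * emeasure (volume G) (E i) = (\<integral>\<^sup>+x. h i x \<partial>volume G))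
    \<and> crossing_integral G ?I (\<lambda>i x. ennreal (a i) * indicator (E i) x) \<le> crossing_integral G ?I h"
    by (intro exists_indicators_below I(1) hm a) (simp_all add: h_def)
  then obtain E :: "nat \<Rightarrow> 'n point set" where E_all: "\<forall>i\<in>?I. E i \<in> sets (volume G)
      \<and> ennreal (a i) * emeasure (volume G) (E i) = (\<integral>\<^sup>+x. h i x \<partial>volume G)"
    and below: "crossing_integral G ?I (\<lambda>i x. ennreal (a i) * indicator (E i) x) \<le> crossing_integral G ?I h"
    by (elim exE conjE)
  have E: "E i \<in> sets (volume G)" "ennreal (a i) * emeasure (volume G) (E i) = (\<integral>\<^sup>+x. h i x \<partial>volume G)"
      if "i \<in> ?I" for i
    using bspec[OF E_all that] by simp_all
  have EB: "emeasure (volume G) (E i) = emeasure (volume G) (B i)" if i: "i \<in> ?I" for i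
  proof -
    have "ennreal (a i) * emeasure (volume G) (E i) = ennreal (L1_norm G (f i))"
      using E(2)[OF i] int_h[OF i] by simp
    also have "\<dots> = ennreal (a i) * emeasure (volume G) (B i)"
      unfolding B_def volume_balls[OF i] using a[OF i]
      by (subst ennreal_mult[symmetric]) (auto simp: a_def L1_norm_def)
    finally show ?thesis
      using a[OF i] by (simp add: ennreal_mult_cancel_left)
  qed
  have "crossing_integral G ?I (\<lambda>i x. ennreal (a i * indicator (B i) x))
      = crossing_integral G ?I (\<lambda>i x. ennreal (a i) * indicator (B i) x)"
    unfolding crossing_integral_def using a
    by (intro nn_integral_cong arg_cong2[where f =
        "(*)"] prod.cong refl) (simp add: ennreal_mult ennreal_indicator less_imp_le)
  also have "\<dots> = (\<Prod>i\<in>?I. ennreal (a i)) * crossing_energy G ?I B"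
    using I B fB by (intro crossing_integral_indicator)
  also have "\<dots> \<le> (\<Prod>i\<in>?I. ennreal (a i)) * crossing_energy G ?I E"
  proof (rule mult_left_mono)
    show "crossing_energy G ?I B \<le> crossing_energy G ?I E"
      by (rule crossing_energy_centred_le[OF I centre]) (erule E(1) EB fB | rule B)+
  qed simp
  also have "\<dots> = crossing_integral G ?I (\<lambda>i x. ennreal (a i) * indicator (E i) x)"
    using I E(1) EB fB by (intro crossing_integral_indicator[symmetric]) auto
  also have "\<dots> \<le> crossing_integral G ?I h"
    by (rule below)
  also have "\<dots> = crossing_integral G ?I (\<lambda>i x. ennreal (f i x))"
    unfolding crossing_integral_def
  proof (rule nn_integral_cong_AE)
    have "AE x in ?P. \<forall>i\<in>?I. h i (x i) = ennreal (f i (x i))"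
      using I(1) hf by (intro AE_finite_allI AE_PiM_component[where P = "\<lambda>t. h _ t = ennreal (f _ t)"])
    then show "AE x in ?P. emeasure lborel (crossing_set G ?I x) * (\<Prod>i\<in>?I. h i (x i)) =
        emeasure lborel (crossing_set G ?I x) * (\<Prod>i\<in>?I. ennreal (f i (x i)))"
      by eventually_elim (rule arg_cong2[where f = "(*)", OF refl prod.cong[OF refl]], blast)
  qed
  finally have le: "crossing_integral G ?I (\<lambda>i x. ennreal (a i * indicator (B i) x))
      \<le> crossing_integral G ?I (\<lambda>i x. ennreal (f i x))" .
  have "I_functional G N (\<lambda>i x. a i * indicator (B i) x)
      = normaliser G TYPE('n) * crossing_integral G ?I (\<lambda>i x. ennreal (a i * indicator (B i) x))"
    using B(1) by (intro I_functional_crossing_integral) simp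
  also have "\<dots> \<le> normaliser G TYPE('n) * crossing_integral G ?I (\<lambda>i x. ennreal (f i x))"
    by (intro mult_left_mono le) simp
  also have "\<dots> = I_functional G N f"
    using fm by (intro I_functional_crossing_integral[symmetric])
  finally show ?thesis
    by (simp add: a_def B_def)
qed

end
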